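(* Consider the multi-antenna NOMA downlink model described in the context, with $N\ge 2$ clusters, $K\ge 2$ users per cluster, $M>(N-1)K$ transmit antennas, all powers $P_{i,j}>0$, and user $(n,k)$ allotted $B_{n,k}\ge 0$ feedback bits. Put $\delta_{n,k}=2^{-B_{n,k}/(M-1)}$, $S^{(1)}_{n,k}=\frac{d_{n,k}^{-\alpha}}{\sigma_{n,k}^2}\sum_{j=1}^{k}P_{n,j}$, $S^{(2)}_{n,k}=\frac{d_{n,k}^{-\alpha}}{\sigma_{n,k}^2}\sum_{j=1}^{k-1}P_{n,j}$, $S^{(3)}_{n,k}=\frac{d_{n,k}^{-\alpha}}{\sigma_{n,k}^2}\sum_{i=1,i\ne n}^{N}\sum_{j=1}^{K}P_{i,j}$, and $c_{n,k}=S^{(3)}_{n,k}\delta_{n,k}/(M-1)$. Then for every $n$ and $k$ the ergodic rate $R_{n,k}=\mathbb{E}[\log_2(1+\gamma_{n,k})]$ satisfies $R_{n,k}\ge R^{LB1}_{n,k}$, where $$R^{LB1}_{n,1}=\Theta\big(S^{(1)}_{n,1},\,c_{n,1}\big)-\log_2(e)\exp\!\Big(\tfrac{M-1}{S^{(3)}_{n,1}\delta_{n,1}}\Big)\sum_{q=1}^{M-1}E_q\!\Big(\tfrac{M-1}{S^{(3)}_{n,1}\delta_{n,1}}\Big),$$ $$R^{LB1}_{n,k}=\Theta\big(S^{(1)}_{n,k},c_{n,k}\big)-\Theta\big(S^{(2)}_{n,k},c_{n,k}\big)\quad (k>1),$$ with $E_q(x)=\int_1^\infty e^{-xt}t^{-q}\,dt$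 and, for $a,b>0$, $$\Theta(a,b)=\log_2(e)\Bigg[\frac{(-1)^M(M-1)}{b^{M-1}}I_1(a)+\sum_{p=1}^{M-1}\sum_{q=1}^{M-p}\frac{(-1)^{p+q+1}(M-1)}{(q-1)!\,b^p}I_2(a,b,p,q)+\sum_{p=1}^{M-1}\sum_{q=2}^{M-p}\sum_{s=0}^{q-2}\frac{(-1)^{p+s-1}(q-s-2)!\,(M-1)}{(q-1)!\,b^{p}}I_3(a,b,p,s)\Bigg],$$ $$I_1(a)=\sum_{t=0}^{M-2}\binom{M-2}{t}\frac{(-1)^t}{a^{t+1}}\tilde\Psi\Big(-M-1-t,\tfrac1a\Big),$$ $$I_2(a,b,p,q)=\sum_{r=0}^{M-2}\sum_{t=0}^{p-1+r}\binom{M-2}{r}\binom{p-1+r}{t}\frac{(-1)^{p-1-t}b^{p-1+r-t}}{a^{r+1}}\Psi\Big(q-4-t,\tfrac{1}{a+b},\tfrac1b\Big),$$ $$I_3(a,b,p,s)=\sum_{t=0}^{M-2}\binom{M-2}{t}\frac{(-1)^t a^{p-1}}{b^{s-1}(p+t)}\,{}_2F_1\Big(s-1,p+t;p+t+1;-\tfrac ab\Big),$$ where ${}_2F_1$ is the Gauss hypergeometric function, $\mathrm{Ei}(x)=-\mathrm{PV}\!\int_{-x}^{\infty}\frac{e^{-t}}{t}dt$, and for $0<u<v$ and integer $n$: for $n>0$: $\Psi(n,u,v)=\sum_{k=0}^{n}\frac{(-1)^k n!}{(n-k)!}\big[v^{n-k}e^{v}\mathrm{Ei}(-v)-u^{n-k}e^{u}\mathrm{Ei}(-u)\big]-\sum_{k=0}^{n-1}\frac{(-1)^k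 n!\,(v^{n-k}-u^{n-k})}{(n-k)(n-k)!}-(-1)^n n!\ln\frac vu$; for $n=0$: $\Psi(0,u,v)=e^v\mathrm{Ei}(-v)-e^u\mathrm{Ei}(-u)-\ln\frac vu$; for $n=-1$: $\Psi(-1,u,v)=\mathrm{Ei}(-v)\mathrm{Ei}(v)-\mathrm{Ei}(-u)\mathrm{Ei}(u)+\frac{\mathrm{Ei}^2(-u)-\mathrm{Ei}^2(-v)}{2}+\sum_{m=0}^{\infty}\sum_{l=0}^{2m}\frac{2(v^le^{-v}-u^le^{-u})}{(2m+1)^2\,l!}$; for $n\le -2$: $\Psi(n,u,v)=\sum_{k=1}^{-n-1}\frac{(-n-k-1)!}{(-n-1)!}\big[u^{n+k}e^u\mathrm{Ei}(-u)-v^{n+k}e^v\mathrm{Ei}(-v)\big]+\frac{\mathrm{Ei}(-v)\mathrm{Ei}(v)-\mathrm{Ei}(-u)\mathrm{Ei}(u)}{(-n-1)!}+\sum_{k=1}^{-n-1}\frac{(-n-k-1)!(v^{n+k}-u^{n+k})}{(-n-1)!(n+k)}+\frac{\mathrm{Ei}^2(-u)-\mathrm{Ei}^2(-v)}{2(-n-1)!}+\frac{1}{(-n-1)!}\sum_{m=0}^{\infty}\sum_{l=0}^{2m}\frac{2(v^le^{-v}-u^le^{-u})}{(2m+1)^2\,l!}$; and for $n\le-2$, $u>0$: $\tilde\Psi(n,u)=\frac{e^u\mathrm{Ei}(-u)}{(-n-1)!}\sum_{k=1}^{-n-1}(-n-k-1)!\,u^{n+k}-\frac{\mathrm{Ei}(-u)\mathrm{Ei}(u)}{(-n-1)!}-\sum_{k=1}^{-n-1}\frac{(-n-k-1)!\,u^{n+k}}{(-n-1)!(n+k)}+\frac{\mathrm{Ei}^2(-u)}{2(-n-1)!}-\frac{1}{(-n-1)!}\sum_{m=0}^{\infty}\sum_{l=0}^{2m}\frac{2u^le^{-u}}{(2m+1)^2\,l!}$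 (the limit of $\Psi(n,u,v)$ as $v\to+\infty$).
   Context: System: a base station with $M$ antennas serves $NK$ single-antenna users grouped into $N$ clusters of $K$ users; user $(n,k)$ is at distance $d_{n,k}$, path-loss exponent $\alpha>0$, noise variance $\sigma_{n,k}^2>0$, channel $d_{n,k}^{-\alpha/2}\mathbf h_{n,k}$ with $\mathbf h_{n,k}\in\mathbb C^{1\times M}$ having i.i.d. $\mathcal{CN}(0,1)$ entries. User $(n,k)$ quantizes its channel direction $\tilde{\mathbf h}_{n,k}=\mathbf h_{n,k}/\|\mathbf h_{n,k}\|$ with a random codebook of $2^{B_{n,k}}$ i.i.d. isotropic unit vectors, $\hat{\mathbf h}_{n,k}=\arg\max_{\mathbf c}|\tilde{\mathbf h}_{n,k}\mathbf c^H|$, and writes $\tilde{\mathbf h}_{n,k}=\cos\theta_{n,k}\hat{\mathbf h}_{n,k}+\sin\theta_{n,k}\tilde{\mathbf e}_{n,k}$ with $\tilde{\mathbf e}_{n,k}$ a unit vector orthogonal to $\hat{\mathbf h}_{n,k}$. The zero-forcing beamformer $\mathbf w_n$ of cluster $n$ is a unit vector orthogonal to all $\hat{\mathbf h}_{m,j}$, $m\ne n$ (uniformly random in that null space). Cluster $n$ transmits $\sum_j\sqrt{P_{n,j}}s_{n,j}$ on $\mathbf w_n$; user $(n,k)$ cancels the signals of users $(n,j)$, $j>k$, by SIC, so its SINR is $\gamma_{n,k}=\dfrac{\frac{d_{n,k}^{-\alpha}}{\sigma_{n,k}^2}P_{n,k}\,G Z}{1+S^{(2)}_{n,k}GZ+\frac{d_{n,k}^{-\alpha}}{\sigma_{n,k}^2}\,GT\sum_{i\ne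 n}V_i\sum_{l=1}^K P_{i,l}}$, where $G=\|\mathbf h_{n,k}\|^2$, $T=\sin^2\theta_{n,k}$, $Z=|\tilde{\mathbf h}_{n,k}\mathbf w_n|^2$, $V_i=|\tilde{\mathbf e}_{n,k}\mathbf w_i|^2$ ($S^{(2)}_{n,1}=0$). The analysis model for these random quantities is: with $X\sim\mathrm{Gamma}(1,1)$ and $Y\sim\mathrm{Gamma}(M-1,1)$ independent, $(GT,\,G(1-T))$ has the same joint law as $(\delta_{n,k}Y,\;X+(1-\delta_{n,k})Y)$ (quantization-cell approximation of random vector quantization); $Z\sim\mathrm{Beta}(1,M-1)$ is independent of $(G,T)$; each $V_i\sim\mathrm{Beta}(1,M-2)$ and $(V_i)_{i\ne n}$ is independent of $(G,T,Z)$. *)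

theory Defs
  imports "HOL-Probability.Probability"
begin

definition Ei :: "real \<Rightarrow> real" where
  "Ei x = - Lim (at_right 0)
      (\<lambda>\<epsilon>. set_lebesgue_integral lborel {t. - x \<le> t \<and> \<epsilon> \<le> \<bar>t\<bar>} (\<lambda>t. exp (- t) / t))"

definition En :: "nat \<Rightarrow> real \<Rightarrow> real" where
  "En q x = set_lebesgue_integral lborel {1..} (\<lambda>t. exp (- x * t) / t ^ q)"

text \<open>Gauss hypergeometric function 2F1(a,b;c;z), given (for c > b > 0 and real z < 1, which
  covers every use below) by Euler's integral representation, i.e. the analytic continuation
  of the hypergeometric series to the cut plane.\<close>
definition hyp2F1 :: "real \<Rightarrow> real \<Rightarrow> real \<Rightarrow> real \<Rightarrow> real" where
  "hyp2F1 a b c z = Gamma c / (Gamma b * Gamma (c - b)) *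
     set_lebesgue_integral lborel {0..1}
       (\<lambda>x. x powr (b - 1) * (1 - x) powr (c - b - 1) * (1 - z * x) powr (- a))"

definition psi_series :: "real \<Rightarrow> real \<Rightarrow> real" where
  "psi_series u v = (\<Sum>m. \<Sum>l\<le>2*m.
      2 * (v ^ l * exp (- v) - u ^ l * exp (- u)) / ((2 * real m + 1)^2 * fact l))"

definition tpsi_series :: "real \<Rightarrow> real" where
  "tpsi_series u = (\<Sum>m. \<Sum>l\<le>2*m. 2 * u ^ l * exp (- u) / ((2 * real m + 1)^2 * fact l))"

definition Psi :: "int \<Rightarrow> real \<Rightarrow> real \<Rightarrow> real" where
  "Psi n u v =
    (if n > 0 then
       (let n' = nat n in
         (\<Sum>k=0..n'. (-1)^k * fact n' / fact (n' - k) *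
             (v ^ (n' - k) * exp v * Ei (- v) - u ^ (n' - k) * exp u * Ei (- u)))
       - (\<Sum>k=0..<n'. (-1)^k * fact n' * (v ^ (n' - k) - u ^ (n' - k)) / (real (n' - k) * fact (n' - k)))
       - (-1)^n' * fact n' * ln (v / u))
     else if n = 0 then
       exp v * Ei (- v) - exp u * Ei (- u) - ln (v / u)
     else if n = -1 then
       Ei (- v) * Ei v - Ei (- u) * Ei u + (Ei (- u)^2 - Ei (- v)^2) / 2 + psi_series u v
     else
       (let m' = nat (- n - 1) in
         (\<Sum>k=1..m'. fact (m' - k) / fact m' *
             (u powi (n + int k) * exp u * Ei (- u) - v powi (n + int k) * exp v * Ei (- v)))
       + (Ei (- v) * Ei v - Ei (- u) * Ei u) / fact m'
       + (\<Sum>k=1..m'. fact (m' - k) * (v powi (n + int k) - u powi (n + int k)) / (fact m' * of_int (n + int k)))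
       + (Ei (- u)^2 - Ei (- v)^2) / (2 * fact m')
       + psi_series u v / fact m'))"

definition tPsi :: "int \<Rightarrow> real \<Rightarrow> real" where
  "tPsi n u =
    (let m' = nat (- n - 1) in
       exp u * Ei (- u) / fact m' * (\<Sum>k=1..m'. fact (m' - k) * u powi (n + int k))
     - Ei (- u) * Ei u / fact m'
     - (\<Sum>k=1..m'. fact (m' - k) * u powi (n + int k) / (fact m' * of_int (n + int k)))
     + Ei (- u)^2 / (2 * fact m')
     - tpsi_series u / fact m')"

definition I1 :: "nat \<Rightarrow> real \<Rightarrow> real" where
  "I1 M a = (\<Sum>t=0..M-2. real (M - 2 choose t) * (-1)^t / a ^ (t + 1)
               * tPsi (- int M - 1 - int t) (1 / a))"

definition I2 :: "nat \<Rightarrow> real \<Rightarrow> real \<Rightarrow> nat \<Rightarrow> nat \<Rightarrow> real" where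
  "I2 M a b p q = (\<Sum>r=0..M-2. \<Sum>t=0..p-1+r.
      real (M - 2 choose r) * real (p - 1 + r choose t) * (-1) powi (int p - 1 - int t)
      * b ^ (p - 1 + r - t) / a ^ (r + 1)
      * Psi (int q - 4 - int t) (1 / (a + b)) (1 / b))"

definition I3 :: "nat \<Rightarrow> real \<Rightarrow> real \<Rightarrow> nat \<Rightarrow> nat \<Rightarrow> real" where
  "I3 M a b p s = (\<Sum>t=0..M-2. real (M - 2 choose t) * (-1)^t * a ^ (p - 1)
      / (b powi (int s - 1) * real (p + t))
      * hyp2F1 (real s - 1) (real (p + t)) (real (p + t + 1)) (- a / b))"

definition Theta :: "nat \<Rightarrow> real \<Rightarrow> real \<Rightarrow> real" where
  "Theta M a b = log 2 (exp 1) *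
     ( (-1)^M * real (M - 1) / b ^ (M - 1) * I1 M a
     + (\<Sum>p=1..M-1. \<Sum>q=1..M-p. (-1)^(p + q + 1) * real (M - 1) / (fact (q - 1) * b ^ p) * I2 M a b p q)
     + (\<Sum>p=1..M-1. \<Sum>q=2..M-p. \<Sum>s=0..q-2.
          (-1)^(p + s - 1) * fact (q - s - 2) * real (M - 1) / (fact (q - 1) * b ^ p) * I3 M a b p s))"

definition beta1_density :: "nat \<Rightarrow> real \<Rightarrow> real" where
  "beta1_density m x = (if 0 \<le> x \<and> x \<le> 1 then real m * (1 - x) ^ (m - 1) else 0)"

end

theory Submission
  imports Defs
begin

text \<open>
  Write \<open>1 + \<gamma> = (1 + S1 G Z + s W) / (1 + S2 G Z + s W)\<close> with \<open>s = L G T\<close> and interference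
  \<open>W = \<Sum>i. V i Q i\<close>. The logarithm of this quotient is convex in \<open>W\<close>, and \<open>W\<close> is independent of
  \<open>(G, T, Z)\<close>, so Jensen's inequality replaces \<open>W\<close> by its mean \<open>\<Sum>i. Q i / (M - 1)\<close>. What remains are
  expectations \<open>E ln (1 + a Z (X + Y) + c Y)\<close> with \<open>X\<close>, \<open>Y\<close> independent gamma variables, and these are
  exactly \<open>ln 2 * Theta M a c\<close>: for fixed \<open>Z = z\<close>, integration by parts in \<open>X\<close> and in \<open>Y\<close> gives a recursion
  in the shape of \<open>Y\<close> (the partial fraction expansion of the law of \<open>a z X + (a z + c) Y\<close>), whose terms
  are exponential integrals in \<open>1 / (a z)\<close> and \<open>1 / (a z + c)\<close>; expanding \<open>(1 - z) ^ (M - 2)\<close> and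
  integrating over \<open>z\<close> term by term yields the functions \<open>tPsi\<close>, \<open>Psi\<close> and \<open>hyp2F1\<close>.
\<close>

section \<open>Integration and the exponential integral\<close>

text \<open>The average over \<open>z\<close> rests on one antiderivative per integer power,
  \<open>F_int n\<close> for \<open>x powi n * exp x * Ei (- x)\<close>. With
  \<open>x = 1 / (a z + b)\<close> the range of \<open>x\<close> is compact and the result is a
  difference of values of \<open>F_int\<close>, that is \<open>Psi\<close>; with
  \<open>x = 1 / (a z)\<close> the range runs to infinity as \<open>z\<close> tends to 0, and
  \<open>tPsi\<close> arises because \<open>F_int n\<close> vanishes there for negative
  \<open>n\<close>. The obstacle is \<open>n = - 1\<close>, where no further integration by parts
  helps: the double series of the definitions is there to supply the part of the antiderivative that
  products of \<open>Ei\<close> cannot give. Since \<open>Ei\<close> is a limit of truncated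
  integrals, it must be rewritten through convergent integrals and series before it can be
  differentiated at all. The expansion in powers of \<open>1 / c\<close> is possible because the
  slopes \<open>a z\<close> and \<open>a z + c\<close> differ by the same positive amount for every
  \<open>z\<close>, even where the first one degenerates.\<close>

lemma integral_FTC_atLeast:
  fixes f F :: "real \<Rightarrow> real"
  assumes F: "\<And>x. x \<ge> a \<Longrightarrow> (F has_real_derivative f x) (at x)"
    and f: "\<And>x. x \<ge> a \<Longrightarrow> isCont f x"
    and int: "set_integrable lborel {a..} f"
    and lim: "(F \<longlongrightarrow> L) at_top"
  shows "(LINT x:{a..}|lborel. f x) = L - F a"
proof -
  \<comment> \<open>Integrability, not a sign condition, justifies the limit of truncations; the
    integrations by parts below apply this to differences.\<close>
  have "((\<lambda>b. LINT x:{a..b}|lborel. f x) \<longlongrightarrow> (LINT x:{a..}|lborel. f x)) at_top"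
    by (rule tendsto_set_lebesgue_integral_at_top[OF _ int]) auto
  moreover have "(LINT x:{a..b}|lborel. f x) = F b - F a" if "a \<le> b" for b
    unfolding set_lebesgue_integral_def
    by (rule integral_FTC_atLeastAtMost[OF that])
       (auto intro!: has_field_derivative_at_within F continuous_at_imp_continuous_on f
             simp: has_real_derivative_iff_has_vector_derivative[symmetric])
  then have "\<forall>\<^sub>F b in at_top. (LINT x:{a..b}|lborel. f x) = F b - F a"
    by (intro eventually_mono[OF eventually_ge_at_top[of a]]) blast
  ultimately have "((\<lambda>b. F b - F a) \<longlongrightarrow> (LINT x:{a..}|lborel. f x)) at_top"
    using tendsto_cong by fastforce
  moreover have "((\<lambda>b. F b - F a) \<longlongrightarrow> L - F a) at_top"
    by (intro tendsto_intros lim)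
  ultimately show ?thesis
    by (metis tendsto_unique trivial_limit_at_top_linorder)
qed

lemma set_integrable_exp_minus:
  fixes x c :: real
  assumes "c > 0"
  shows "set_integrable lborel {x..} (\<lambda>t. exp (- c * t))"
proof -
  have "set_integrable lebesgue {x..} (\<lambda>t. exp (- c * t))"
    by (intro nonnegative_absolutely_integrable_1 integrable_on_exp_minus_to_infinity assms) auto
  then show ?thesis
    by (simp add: set_integrable_def integrable_completion)
qed

lemma set_integrable_exp_div_power:
  fixes x c :: real
  assumes "c > 0" "x > 0"
  shows "set_integrable lborel {x..} (\<lambda>t. exp (- c * t) / t ^ q)"
proof (rule set_integrable_bound)
  show "set_integrable lborel {x..} (\<lambda>t. exp (- c * t) / x ^ q)"
    using set_integrable_exp_minus[OF assms(1)] assms by (intro set_integrable_divide) auto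
  show "set_borel_measurable lborel {x..} (\<lambda>t. exp (- c * t) / t ^ q)"
    unfolding set_borel_measurable_def by measurable
  show "AE t in lborel. t \<in> {x..} \<longrightarrow> norm (exp (- c * t) / t ^ q) \<le> norm (exp (- c * t) / x ^ q)"
    using assms by (auto intro!: AE_I2 divide_left_mono power_mono)
qed

text \<open>Agrees with \<open>- Ei (- x)\<close> for \<open>x > 0\<close>, but converges absolutely
  and needs no principal value. Together with \<open>Shi\<close> it represents \<open>Ei\<close> on
  both half-lines.\<close>

definition E1 :: "real \<Rightarrow> real" where
  "E1 x = (LINT t:{x..}|lborel. exp (- t) / t)"

lemma set_integrable_E1: "x > 0 \<Longrightarrow> set_integrable lborel {x..} (\<lambda>t. exp (- t) / t)" for x :: real
  using set_integrable_exp_div_power[of 1 x 1] by simp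

text \<open>The variable is the lower limit of integration. For any antiderivative \<open>F\<close>
  of the integrand, \<open>E1 + F\<close> equals the limit of \<open>F\<close> at infinity and is
  therefore constant.\<close>

lemma E1_has_deriv:
  assumes "x > 0"
  shows "(E1 has_real_derivative - (exp (- x) / x)) (at x)"
proof -
  obtain F where F: "\<And>t. t > 0 \<Longrightarrow> (F has_real_derivative exp (- t) / t) (at t)"
  proof -
    have "\<exists>F. \<forall>t. 0 < ereal t \<longrightarrow> ereal t < \<infinity> \<longrightarrow> (F has_vector_derivative (exp (- t) / t)) (at t)"
      by (rule einterval_antiderivative) (auto intro!: continuous_intros)
    then show ?thesis
      using that by (auto simp: has_real_derivative_iff_has_vector_derivative)
  qed
  have lim: "(F \<longlongrightarrow> E1 y + F y) at_top" if y: "y > 0" for y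
  proof -
    have "((\<lambda>b. LINT t:{y..b}|lborel. exp (- t) / t) \<longlongrightarrow> E1 y) at_top"
      unfolding E1_def
      by (rule tendsto_set_lebesgue_integral_at_top[OF _ set_integrable_E1[OF y]]) auto
    then have "((\<lambda>b. (LINT t:{y..b}|lborel. exp (- t) / t) + F y) \<longlongrightarrow> E1 y + F y) at_top"
      by (intro tendsto_intros)
    moreover have "(LINT t:{y..b}|lborel. exp (- t) / t) = F b - F y" if "y \<le> b" for b
      unfolding set_lebesgue_integral_def using y
      by (intro integral_FTC_atLeastAtMost[OF that])
         (auto intro!: has_field_derivative_at_within F continuous_intros
               simp: has_real_derivative_iff_has_vector_derivative[symmetric])
    then have "\<forall>\<^sub>F b in at_top. (LINT t:{y..b}|lborel. exp (- t) / t) + F y = F b"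
      by (intro eventually_mono[OF eventually_ge_at_top[of y]]) simp
    ultimately show ?thesis
      using tendsto_cong by fastforce
  qed
  have eq: "E1 y = (E1 x + F x) - F y" if "y > 0" for y
    using tendsto_unique[OF _ lim[OF that] lim[OF assms]] by simp
  have "((\<lambda>y. (E1 x + F x) - F y) has_real_derivative 0 - exp (- x) / x) (at x)"
    by (intro derivative_intros F assms)
  moreover have "\<forall>\<^sub>F y in nhds x. y > 0"
    using assms by (rule order_tendstoD[OF filterlim_ident])
  then have "\<forall>\<^sub>F y in nhds x. E1 y = (E1 x + F x) - F y"
    by (rule eventually_mono) (rule eq)
  ultimately show ?thesis
    by (subst DERIV_cong_ev[OF refl _ refl]) auto
qed

lemma E1_nonneg: "x > 0 \<Longrightarrow> E1 x \<ge> 0"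
  unfolding E1_def set_lebesgue_integral_def
  by (rule integral_nonneg_AE) (auto simp: indicator_def)

lemma E1_le:
  assumes "x > 0"
  shows "E1 x \<le> exp (- x) / x"
proof -
  have "((\<lambda>t::real. - exp (- t)) \<longlongrightarrow> - 0) at_top"
    by (intro tendsto_minus filterlim_compose[OF exp_at_bot] filterlim_uminus_at_bot_at_top)
  then have "(LINT t:{x..}|lborel. exp (- t)) = 0 - (- exp (- x))"
    by (intro integral_FTC_atLeast)
       (use set_integrable_exp_minus[of 1 x] in \<open>auto intro!: derivative_eq_intros\<close>)
  then have *: "(LINT t:{x..}|lborel. exp (- t) / x) = exp (- x) / x"
    by (simp add: set_integral_divide_zero)
  have "E1 x \<le> (LINT t:{x..}|lborel. exp (- t) / x)"
    unfolding E1_def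
    by (rule set_integral_mono)
       (use assms set_integrable_exp_minus[of 1 x] set_integrable_E1[OF assms] in \<open>auto intro!: divide_left_mono set_integrable_divide\<close>)
  with * show ?thesis using assms by simp
qed

section \<open>The hyperbolic sine integral, odd part of \<open>Ei\<close>\<close>

definition Shi :: "real \<Rightarrow> real" where
  "Shi x = (\<Sum>m. x ^ (2 * m + 1) / ((2 * real m + 1)\<^sup>2 * fact (2 * m)))"

text \<open>The right-hand side is the usual coefficient of the integral of
  \<open>sinh t / t\<close>; the left-hand side is the shape in which the series returns when
  \<open>tpsi_series\<close> is differentiated.\<close>

lemma Shi_term_eq:
  "x ^ (2 * m + 1) / ((2 * real m + 1)\<^sup>2 * fact (2 * m)) = x ^ (2*m+1) / ((2 * real m + 1) * fact (2*m+1))"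
  by (simp add: power2_eq_square algebra_simps)

lemma sinh_odd_sums: "(\<lambda>m. x ^ (2 * m + 1) / fact (2 * m + 1)) sums sinh (x :: real)"
proof -
  have "(\<lambda>n. (\<lambda>n. if even n then 0 else x ^ n /\<^sub>R fact n) (2 * n + 1)) sums sinh x"
    using sinh_converges[of x]
    by (subst sums_mono_reindex) (auto simp: strict_mono_def elim!: oddE)
  then show ?thesis by (simp add: field_simps)
qed

lemma Shi_summable: "summable (\<lambda>m. x ^ (2 * m + 1) / ((2 * real m + 1)\<^sup>2 * fact (2 * m)))" for x :: real
proof (rule summable_comparison_test)
  have "(2 * real m + 1)\<^sup>2 * fact (2 * m) \<ge> fact (2 * m + 1)" for m
  proof -
    have "(2 * real m + 1)\<^sup>2 * fact (2 * m) = (2 * real m + 1) * fact (2 * m + 1)"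
      by (simp add: power2_eq_square algebra_simps)
    also have "\<dots> \<ge> 1 * fact (2 * m + 1)"
      by (intro mult_right_mono) auto
    finally show ?thesis by simp
  qed
  then show "\<exists>N. \<forall>n\<ge>N. norm (x ^ (2 * n + 1) / ((2 * real n + 1)\<^sup>2 * fact (2 * n))) \<le> \<bar>x\<bar> ^ (2 * n + 1) / fact (2 * n + 1)"
    by (intro exI[of _ 0] allI impI) (auto simp: abs_mult power_abs intro!: divide_left_mono simp del: fact_Suc power_Suc)
  show "summable (\<lambda>m. \<bar>x\<bar> ^ (2 * m + 1) / fact (2 * m + 1))"
    using sinh_odd_sums[of "\<bar>x\<bar>"] by (rule sums_summable)
qed

lemma Shi_has_deriv:
  assumes "x \<noteq> 0"
  shows "(Shi has_real_derivative sinh x / x) (at x)"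
proof -
  \<comment> \<open>A radius of at least 1 makes \<open>r ^ (2 * m)\<close> at most
    \<open>r ^ (2 * m + 1)\<close>, so the series of \<open>sinh r\<close> majorizes the termwise
    derivatives.\<close>
  let ?r = "\<bar>x\<bar> + 1"
  let ?S = "{- ?r<..<?r}"
  let ?f = "\<lambda>m x. x ^ (2 * m + 1) / ((2 * real m + 1)\<^sup>2 * fact (2 * m))"
  let ?f' = "\<lambda>m x. x ^ (2 * m) / fact (2 * m + 1)"
  have "((\<lambda>x. \<Sum>m. ?f m x) has_real_derivative (\<Sum>m. ?f' m x)) (at x)"
  proof (rule has_field_derivative_series'(2))
    show "convex ?S" by simp
    show "(?f m has_real_derivative ?f' m y) (at y within ?S)" for m y
    proof -
      have "((\<lambda>y. y ^ (2 * m + 1)) has_real_derivative (2 * real m + 1) * y ^ (2 * m)) (at y within ?S)"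
        using DERIV_pow[of "2 * m + 1" y ?S] by (simp add: add.commute)
      then have "(?f m has_real_derivative (2 * real m + 1) * y ^ (2 * m) / ((2 * real m + 1) * fact (2 * m + 1))) (at y within ?S)"
        unfolding Shi_term_eq by (rule DERIV_cdivide)
      moreover have "2 * real m + 1 \<noteq> 0" by linarith
      ultimately show ?thesis by simp
    qed
    show "uniformly_convergent_on ?S (\<lambda>n x. \<Sum>i<n. ?f' i x)"
    proof (rule Weierstrass_m_test'_ev)
      have "norm (?f' m y) \<le> ?r ^ (2 * m + 1) / fact (2 * m + 1)" if y: "y \<in> ?S" for m y
      proof -
        have "\<bar>y\<bar> ^ (2 * m) \<le> ?r ^ (2 * m)"
          using y by (intro power_mono) auto
        also have "\<dots> \<le> ?r ^ (2 * m + 1)"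
          by (rule power_increasing) auto
        finally show ?thesis
          by (auto simp: power_abs intro!: divide_right_mono simp del: fact_Suc power_Suc)
      qed
      then show "\<forall>\<^sub>F m in sequentially. \<forall>y\<in>?S. norm (?f' m y) \<le> ?r ^ (2 * m + 1) / fact (2 * m + 1)"
        by auto
      show "summable (\<lambda>m. ?r ^ (2 * m + 1) / fact (2 * m + 1))"
        using sinh_odd_sums by (rule sums_summable)
    qed
    show "x \<in> ?S" by auto
    then show "x \<in> interior ?S" by simp
    show "summable (\<lambda>m. ?f m x)" by (rule Shi_summable)
  qed
  moreover have "(\<lambda>m. (x ^ (2 * m + 1) / fact (2 * m + 1)) / x) sums (sinh x / x)"
    using sums_divide[OF sinh_odd_sums] .
  then have "(\<Sum>m. ?f' m x) = sinh x / x"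
    using assms by (simp add: sums_iff field_simps del: fact_Suc)
  ultimately show ?thesis unfolding Shi_def[abs_def] by simp
qed

text \<open>The derivative formula leaves out the origin, yet the principal value needs that point:
  \<open>Shi \<epsilon>\<close> is half of what a symmetric truncation leaves behind.\<close>

lemma isCont_Shi_0: "isCont Shi 0"
proof -
  let ?S = "{- 1<..<1::real}"
  let ?f = "\<lambda>m x. x ^ (2 * m + 1) / ((2 * real m + 1)\<^sup>2 * fact (2 * m))"
  have "uniform_limit ?S (\<lambda>n x. \<Sum>i<n. ?f i x) (\<lambda>x. \<Sum>i. ?f i x) sequentially"
  proof (rule Weierstrass_m_test)
    show "norm (?f m y) \<le> 1 ^ (2 * m + 1) / ((2 * real m + 1)\<^sup>2 * fact (2 * m))" if "y \<in> ?S" for m y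
      using that power_mono[of "\<bar>y\<bar>" 1 "2 * m + 1"]
      by (auto simp: power_abs abs_mult intro!: divide_right_mono simp del: power_Suc)
    show "summable (\<lambda>m. 1 ^ (2 * m + 1) / ((2 * real m + 1)\<^sup>2 * fact (2 * m)))"
      by (rule Shi_summable)
  qed
  then have "continuous_on ?S (\<lambda>x. \<Sum>i. ?f i x)"
    by (rule uniform_limit_theorem[rotated]) (auto intro!: always_eventually continuous_intros)
  then show ?thesis
    unfolding Shi_def[abs_def] by (simp add: continuous_on_eq_continuous_at)
qed

lemma Shi_0 [simp]: "Shi 0 = 0"
  by (simp add: Shi_def)

text \<open>The range of integration stays away from the pole, so the truncated integrals are
  constant once \<open>\<epsilon> < x\<close>.\<close>

lemma Ei_neg:
  assumes "x > 0"
  shows "Ei (- x) = - E1 x"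
proof -
  have "\<forall>\<^sub>F \<epsilon> in at_right 0. (LINT t:{t. - (- x) \<le> t \<and> \<epsilon> \<le> \<bar>t\<bar>}|lborel. exp (- t) / t) = E1 x"
    unfolding eventually_at_right_field
  proof (intro exI[of _ x] conjI allI impI assms)
    fix \<epsilon> :: real assume "0 < \<epsilon>" "\<epsilon> < x"
    then have "{t. - (- x) \<le> t \<and> \<epsilon> \<le> \<bar>t\<bar>} = {x..}" by auto
    then show "(LINT t:{t. - (- x) \<le> t \<and> \<epsilon> \<le> \<bar>t\<bar>}|lborel. exp (- t) / t) = E1 x"
      by (simp add: E1_def)
  qed
  then have "((\<lambda>\<epsilon>. LINT t:{t. - (- x) \<le> t \<and> \<epsilon> \<le> \<bar>t\<bar>}|lborel. exp (- t) / t) \<longlongrightarrow> E1 x) (at_right 0)"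
    by (rule tendsto_eventually)
  then show ?thesis
    unfolding Ei_def by (subst tendsto_Lim) auto
qed

text \<open>The pieces on the two sides of the pole contribute \<open>E1 \<epsilon>\<close> with
  opposite signs; after cancellation only \<open>2 * Shi \<epsilon>\<close> depends on
  \<open>\<epsilon>\<close>, and it tends to 0.\<close>

lemma Ei_pos:
  assumes "x > 0"
  shows "Ei x = - E1 x + 2 * Shi x"
proof -
  \<comment> \<open>With \<open>y = - t > 0\<close>, the identity
    \<open>exp y = 2 * sinh y + exp (- y)\<close> makes this an antiderivative on the negative
    half-line.\<close>
  define G where "G = (\<lambda>t. 2 * Shi (- t) - E1 (- t))"
  have G: "(G has_real_derivative exp (- t) / t) (at t)" if "t < 0" for t
  proof -
    have [derivative_intros]: "((\<lambda>x. Shi (f x)) has_real_derivative sinh (f x) / f x * f') (at x)"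
      if "f x \<noteq> 0" "(f has_real_derivative f') (at x)" for f f' x
      using that by (intro DERIV_chain2[OF Shi_has_deriv])
    have [derivative_intros]: "((\<lambda>x. E1 (f x)) has_real_derivative - (exp (- f x) / f x) * f') (at x)"
      if "f x > 0" "(f has_real_derivative f') (at x)" for f f' x
      using that by (intro DERIV_chain2[OF E1_has_deriv])
    show ?thesis
      unfolding G_def using that
      by (auto intro!: derivative_eq_intros simp: sinh_field_def field_simps)
  qed
  have "(LINT t:{t. - x \<le> t \<and> \<epsilon> \<le> \<bar>t\<bar>}|lborel. exp (- t) / t) = 2 * Shi \<epsilon> + (E1 x - 2 * Shi x)"
    if \<epsilon>: "0 < \<epsilon>" "\<epsilon> < x" for \<epsilon>
  proof -
    have "{t. - x \<le> t \<and> \<epsilon> \<le> \<bar>t\<bar>} = {- x..- \<epsilon>} \<union> {\<epsilon>..}"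
      using \<epsilon> by (auto simp: abs_if)
    moreover have "(LINT t:{- x..- \<epsilon>} \<union> {\<epsilon>..}|lborel. exp (- t) / t)
        = (LINT t:{- x..- \<epsilon>}|lborel. exp (- t) / t) + (LINT t:{\<epsilon>..}|lborel. exp (- t) / t)"
    proof (rule set_integral_Un)
      have "continuous_on {- x..- \<epsilon>} (\<lambda>t. exp (- t) / t)"
        using \<epsilon> by (auto intro!: continuous_intros)
      then show "set_integrable lborel {- x..- \<epsilon>} (\<lambda>t. exp (- t) / t)"
        by (rule borel_integrable_atLeastAtMost')
    qed (use \<epsilon> set_integrable_E1 in auto)
    moreover have "(LINT t:{- x..- \<epsilon>}|lborel. exp (- t) / t) = G (- \<epsilon>) - G (- x)"
      unfolding set_lebesgue_integral_def using \<epsilon>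
      by (intro integral_FTC_atLeastAtMost)
         (auto intro!: has_field_derivative_at_within G continuous_intros
               simp: has_real_derivative_iff_has_vector_derivative[symmetric])
    ultimately show ?thesis
      by (simp add: G_def E1_def)
  qed
  then have ev: "\<forall>\<^sub>F \<epsilon> in at_right 0. (LINT t:{t. - x \<le> t \<and> \<epsilon> \<le> \<bar>t\<bar>}|lborel. exp (- t) / t)
      = 2 * Shi \<epsilon> + (E1 x - 2 * Shi x)"
    unfolding eventually_at_right_field using assms by blast
  have "((\<lambda>\<epsilon>. 2 * Shi \<epsilon> + (E1 x - 2 * Shi x)) \<longlongrightarrow> 2 * Shi 0 + (E1 x - 2 * Shi x)) (at_right 0)"
    using isCont_Shi_0 unfolding isCont_def
    by (intro tendsto_intros) (auto intro: tendsto_within_subset)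
  then have "((\<lambda>\<epsilon>. LINT t:{t. - x \<le> t \<and> \<epsilon> \<le> \<bar>t\<bar>}|lborel. exp (- t) / t) \<longlongrightarrow> E1 x - 2 * Shi x) (at_right 0)"
    using tendsto_cong[OF ev] by simp
  then show ?thesis
    unfolding Ei_def by (subst tendsto_Lim) auto
qed

lemma DERIV_Ei_neg [derivative_intros]:
  assumes "(f has_real_derivative f') (at x)" "f x > 0"
  shows "((\<lambda>x. Ei (- f x)) has_real_derivative exp (- f x) / f x * f') (at x)"
proof (rule DERIV_chain2[OF _ assms(1), of "\<lambda>y. Ei (- y)"])
  have "\<forall>\<^sub>F y in nhds (f x). y > 0"
    using assms(2) by (rule order_tendstoD[OF filterlim_ident])
  then have "\<forall>\<^sub>F y in nhds (f x). Ei (- y) = - E1 y"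
    by (rule eventually_mono) (rule Ei_neg)
  moreover have "((\<lambda>y. - E1 y) has_real_derivative exp (- f x) / f x) (at (f x))"
    using assms(2) E1_has_deriv by (auto intro!: derivative_eq_intros)
  ultimately show "((\<lambda>y. Ei (- y)) has_real_derivative exp (- f x) / f x) (at (f x))"
    by (subst DERIV_cong_ev[OF refl _ refl])
qed

lemma DERIV_Ei_pos:
  assumes "x > 0"
  shows "(Ei has_real_derivative exp x / x) (at x)"
proof -
  have "\<forall>\<^sub>F y in nhds x. y > 0"
    using assms by (rule order_tendstoD[OF filterlim_ident])
  then have "\<forall>\<^sub>F y in nhds x. Ei y = - E1 y + 2 * Shi y"
    by (rule eventually_mono) (rule Ei_pos)
  moreover have "((\<lambda>y. - E1 y + 2 * Shi y) has_real_derivative exp x / x) (at x)"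
    using assms
    by (auto intro!: derivative_eq_intros E1_has_deriv Shi_has_deriv simp: sinh_field_def field_simps)
  ultimately show ?thesis
    by (subst DERIV_cong_ev[OF refl _ refl])
qed

section \<open>Antiderivatives of powers times exp x Ei (- x)\<close>

definition tpsi_term :: "nat \<Rightarrow> real \<Rightarrow> real" where
  "tpsi_term m u = (\<Sum>l\<le>2*m. 2 * u ^ l * exp (- u) / ((2 * real m + 1)^2 * fact l))"

lemma tpsi_term_eq:
  "tpsi_term m u = 2 / (2 * real m + 1)\<^sup>2 * (exp (- u) * (\<Sum>l\<le>2*m. u ^ l / fact l))"
  by (simp add: tpsi_term_def sum_distrib_left field_simps)

lemma exp_partial_sum_le:
  fixes u :: real
  assumes "u \<ge> 0"
  shows "(\<Sum>l\<le>n. u ^ l / fact l) \<le> exp u"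
proof -
  have "(\<Sum>l<Suc n. u ^ l / fact l) \<le> (\<Sum>l. u ^ l / fact l)"
    using assms exp_converges[of u]
    by (intro sum_le_suminf) (auto simp: sums_iff field_simps)
  then show ?thesis
    using exp_converges[of u] by (simp add: sums_iff field_simps lessThan_Suc_atMost)
qed

lemma summable_inverse_odd_squares: "summable (\<lambda>m. 2 / (2 * real m + 1)\<^sup>2)"
proof (rule summable_comparison_test_ev)
  have "norm (2 / (2 * real m + 1)\<^sup>2) \<le> 2 * (1 / real m ^ 2)" if "m \<ge> 1" for m
  proof -
    have "real m ^ 2 \<le> (2 * real m + 1)\<^sup>2" by (intro power_mono) auto
    then show ?thesis using that by (auto simp: field_simps)
  qed
  then show "\<forall>\<^sub>F m in sequentially. norm (2 / (2 * real m + 1)\<^sup>2) \<le> 2 * (1 / real m ^ 2)"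
    by (rule eventually_mono[OF eventually_ge_at_top])
  show "summable (\<lambda>m. 2 * (1 / real m ^ 2))"
    using inverse_power_summable[of 2, where ?'a = real] by (intro summable_mult) (simp add: field_simps)
qed

text \<open>A Taylor partial sum of \<open>exp u\<close> is at most \<open>exp u\<close>, so the
  bound does not involve \<open>u\<close>. The same majorant serves convergence, termwise
  differentiation and the limit at infinity.\<close>

lemma tpsi_term_bound:
  assumes "u \<ge> 0"
  shows "norm (tpsi_term m u) \<le> 2 / (2 * real m + 1)\<^sup>2"
proof -
  have "exp (- u) * (\<Sum>l\<le>2*m. u ^ l / fact l) \<le> exp (- u) * exp u"
    by (intro mult_left_mono exp_partial_sum_le assms) auto
  then have "exp (- u) * (\<Sum>l\<le>2*m. u ^ l / fact l) \<le> 1"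
    by (simp add: mult_exp_exp)
  moreover have "exp (- u) * (\<Sum>l\<le>2*m. u ^ l / fact l) \<ge> 0"
    using assms by (intro mult_nonneg_nonneg sum_nonneg) auto
  ultimately show ?thesis
    by (simp add: tpsi_term_eq abs_mult divide_right_mono)
qed

lemma tpsi_summable: "u \<ge> 0 \<Longrightarrow> summable (\<lambda>m. tpsi_term m u)"
  by (rule summable_comparison_test[OF _ summable_inverse_odd_squares])
     (use tpsi_term_bound in auto)

lemma tpsi_series_eq: "tpsi_series u = (\<Sum>m. tpsi_term m u)"
  by (simp add: tpsi_series_def tpsi_term_def)

lemma psi_series_eq:
  assumes "u \<ge> 0" "v \<ge> 0"
  shows "psi_series u v = tpsi_series v - tpsi_series u"
proof -
  have "psi_series u v = (\<Sum>m. tpsi_term m v - tpsi_term m u)"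
    unfolding psi_series_def tpsi_term_def
    by (simp add: sum_subtractf[symmetric] diff_divide_distrib right_diff_distrib mult.assoc)
  also have "\<dots> = tpsi_series v - tpsi_series u"
    unfolding tpsi_series_eq by (intro suminf_diff[symmetric] tpsi_summable assms)
  finally show ?thesis .
qed

lemma tpsi_term_tendsto: "((\<lambda>u. tpsi_term m u) \<longlongrightarrow> 0) at_top"
proof -
  have "((\<lambda>u. 2 / ((2 * real m + 1)^2 * fact l) * (u ^ l / exp u)) \<longlongrightarrow> 2 / ((2 * real m + 1)^2 * fact l) * 0) at_top" for l
    by (intro tendsto_mult tendsto_const tendsto_power_div_exp_0)
  then have "((\<lambda>u. 2 * u ^ l * exp (- u) / ((2 * real m + 1)^2 * fact l)) \<longlongrightarrow> 0) at_top" for l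
    by (simp add: exp_minus field_simps)
  then show ?thesis
    unfolding tpsi_term_def by (intro tendsto_null_sum) auto
qed

text \<open>Limit and sum are exchanged by Tannery's theorem with the majorant of
  \<open>tpsi_term_bound\<close>.\<close>

lemma tpsi_series_tendsto: "(tpsi_series \<longlongrightarrow> 0) at_top"
proof -
  have "((\<lambda>u. \<Sum>m. tpsi_term m u) \<longlongrightarrow> (\<Sum>m. 0)) at_top"
  proof -
    have "\<forall>\<^sub>F (m, u) in at_top \<times>\<^sub>F at_top. norm (tpsi_term m u) \<le> 2 / (2 * real m + 1)\<^sup>2"
      unfolding case_prod_beta
      using eventually_prodI[OF always_eventually eventually_ge_at_top[of "0::real"], of "\<lambda>_::nat. True"]
      by (rule eventually_mono) (simp_all add: tpsi_term_bound[simplified])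
    from tannerys_theorem[OF tpsi_term_tendsto this summable_inverse_odd_squares] show ?thesis
      by simp
  qed
  then show ?thesis
    by (simp add: tpsi_series_eq[abs_def])
qed

text \<open>The derivative of \<open>exp (- u)\<close> times a Taylor partial sum telescopes to
  minus its last term.\<close>

lemma tpsi_term_has_deriv:
  "(tpsi_term m has_real_derivative - 2 * exp (- u) * u ^ (2 * m) / ((2 * real m + 1)\<^sup>2 * fact (2 * m))) (at u within S)"
proof -
  have "((\<lambda>u. exp (- u) * (\<Sum>l\<le>n. u ^ l / fact l)) has_real_derivative - exp (- u) * u ^ n / fact n) (at u within S)" for n
  proof (induction n)
    case 0
    show ?case by (auto intro!: derivative_eq_intros)
  next
    case (Suc n)
    have "((\<lambda>u. exp (- u) * (\<Sum>l\<le>n. u ^ l / fact l) + exp (- u) * (u ^ Suc n / fact (Suc n))) has_real_derivative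
        - exp (- u) * u ^ n / fact n + (- exp (- u) * (u ^ Suc n / fact (Suc n)) + exp (- u) * (real (Suc n) * u ^ n / fact (Suc n)))) (at u within S)"
      by (rule DERIV_add[OF Suc.IH]) (auto intro!: derivative_eq_intros simp: diff_divide_distrib mult_ac left_diff_distrib simp del: fact_Suc power_Suc)
    also have "real (Suc n) * u ^ n / fact (Suc n) = u ^ n / fact n"
      by (simp del: of_nat_Suc)
    finally show ?case
      by (simp add: distrib_left)
  qed
  from DERIV_cmult[OF this[of "2 * m"], of "2 / (2 * real m + 1)\<^sup>2"] show ?thesis
    unfolding tpsi_term_eq[abs_def] by (simp add: mult.assoc)
qed

text \<open>The last terms that survive add up to the series of \<open>Shi u / u\<close>. This
  explains the inner cutoff \<open>2 * m\<close> and the squared odd weights.\<close>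

lemma DERIV_tpsi_series:
  assumes "u > 0"
  shows "(tpsi_series has_real_derivative - 2 * exp (- u) / u * Shi u) (at u)"
proof -
  let ?f' = "\<lambda>m u. - 2 * exp (- u) * u ^ (2 * m) / ((2 * real m + 1)\<^sup>2 * fact (2 * m))"
  have "((\<lambda>x. \<Sum>m. tpsi_term m x) has_real_derivative (\<Sum>m. ?f' m u)) (at u)"
  proof (rule has_field_derivative_series'(2))
    show "convex {0::real<..}" by simp
    show "(tpsi_term m has_real_derivative ?f' m y) (at y within {0<..})" for m y
      by (rule tpsi_term_has_deriv)
    show "uniformly_convergent_on {0<..} (\<lambda>n x. \<Sum>i<n. ?f' i x)"
    proof (rule Weierstrass_m_test'_ev[OF _ summable_inverse_odd_squares])
      have "norm (?f' m y) \<le> 2 / (2 * real m + 1)\<^sup>2" if y: "y > 0" for m y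
      proof -
        have "y ^ (2 * m) / fact (2 * m) \<le> (\<Sum>l\<le>2*m. y ^ l / fact l)"
          using y by (intro member_le_sum) auto
        also have "\<dots> \<le> exp y"
          using y by (intro exp_partial_sum_le) auto
        finally have "exp (- y) * (y ^ (2 * m) / fact (2 * m)) \<le> exp (- y) * exp y"
          by (intro mult_left_mono) auto
        then have "2 / (2 * real m + 1)\<^sup>2 * (exp (- y) * (y ^ (2 * m) / fact (2 * m))) \<le> 2 / (2 * real m + 1)\<^sup>2"
          by (intro mult_left_le) (auto simp: mult_exp_exp)
        then show ?thesis
          using y by (simp add: abs_mult)
      qed
      then show "\<forall>\<^sub>F m in sequentially. \<forall>y\<in>{0<..}. norm (?f' m y) \<le> 2 / (2 * real m + 1)\<^sup>2"
        by auto
    qed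
    show "u \<in> {0<..}" using assms by simp
    then show "u \<in> interior {0<..}" by (simp add: interior_open)
    show "summable (\<lambda>m. tpsi_term m u)" using assms by (intro tpsi_summable) simp
  qed
  also have "(\<Sum>m. ?f' m u) = - 2 * exp (- u) / u * Shi u"
    unfolding Shi_def suminf_mult[OF Shi_summable, symmetric] using assms
    by (intro arg_cong[where f = suminf] ext) simp
  finally show ?thesis
    by (simp add: tpsi_series_eq[abs_def])
qed

text \<open>Both recursions are integration by parts with \<open>(exp x * Ei (- x))' = exp x * Ei (- x) + 1 / x\<close>.
  In the base case of \<open>F_neg\<close>, \<open>Ei x = Ei (- x) + 2 * Shi x\<close> splits the remaining integral of
  \<open>Ei x * exp (- x) / x\<close> into a square and the series.\<close>

primrec F_nonneg :: "nat \<Rightarrow> real \<Rightarrow> real" where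
  "F_nonneg 0 x = exp x * Ei (- x) - ln x"
| "F_nonneg (Suc n) x = x ^ Suc n * (exp x * Ei (- x)) - x ^ Suc n / real (Suc n) - real (Suc n) * F_nonneg n x"

primrec F_neg :: "nat \<Rightarrow> real \<Rightarrow> real" where
  "F_neg 0 x = Ei (- x) * Ei x - (Ei (- x))\<^sup>2 / 2 + tpsi_series x"
| "F_neg (Suc m) x = (F_neg m x - inverse x ^ Suc m * (exp x * Ei (- x)) - inverse x ^ Suc m / real (Suc m)) / real (Suc m)"

text \<open>The index \<open>- n - 1\<close> appears because \<open>F_neg m\<close> belongs to the
  power \<open>- (m + 1)\<close>.\<close>

definition F_int :: "int \<Rightarrow> real \<Rightarrow> real" where
  "F_int n = (if n \<ge> 0 then F_nonneg (nat n) else F_neg (nat (- n - 1)))"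

lemma DERIV_F_nonneg:
  assumes "x > 0"
  shows "(F_nonneg n has_real_derivative x ^ n * (exp x * Ei (- x))) (at x)"
proof (induction n)
  case 0
  show ?case using assms
    by (auto intro!: derivative_eq_intros simp: exp_minus field_simps)
next
  case (Suc n)
  have "(F_nonneg (Suc n) has_real_derivative
     (real (Suc n) * x ^ n) * (exp x * Ei (- x)) + (exp x * Ei (- x) + exp x * (exp (- x) / x)) * x ^ Suc n
      - real (Suc n) * x ^ n / real (Suc n) - real (Suc n) * (x ^ n * (exp x * Ei (- x)))) (at x)"
    unfolding F_nonneg.simps
    by (intro DERIV_diff DERIV_cmult[OF Suc.IH] DERIV_mult DERIV_cdivide)
       (use assms DERIV_pow[of "Suc n" x] in \<open>auto intro!: derivative_eq_intros simp del: power_Suc\<close>)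
  also have "(real (Suc n) * x ^ n) * (exp x * Ei (- x)) + (exp x * Ei (- x) + exp x * (exp (- x) / x)) * x ^ Suc n
      - real (Suc n) * x ^ n / real (Suc n) - real (Suc n) * (x ^ n * (exp x * Ei (- x))) = x ^ Suc n * (exp x * Ei (- x))"
    using assms by (simp add: exp_minus field_simps del: of_nat_Suc)
  finally show ?case .
qed

lemma DERIV_F_neg:
  assumes "x > 0"
  shows "(F_neg m has_real_derivative inverse x ^ Suc m * (exp x * Ei (- x))) (at x)"
proof (induction m)
  case 0
  have *: "Ei x = Ei (- x) + 2 * Shi x"
    using assms by (simp add: Ei_neg Ei_pos)
  have "(F_neg 0 has_real_derivative exp (- x) / x * Ei x + exp x / x * Ei (- x)
      - Ei (- x) * (exp (- x) / x) + (- 2 * exp (- x) / x * Shi x)) (at x)"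
    unfolding F_neg.simps using assms
    by (intro DERIV_add DERIV_diff DERIV_mult DERIV_tpsi_series DERIV_Ei_pos)
       (auto intro!: derivative_eq_intros)
  also have "exp (- x) / x * Ei x + exp x / x * Ei (- x)
      - Ei (- x) * (exp (- x) / x) + (- 2 * exp (- x) / x * Shi x) = inverse x ^ Suc 0 * (exp x * Ei (- x))"
    unfolding * using assms by (simp add: field_simps)
  finally show ?case .
next
  case (Suc m)
  have "((\<lambda>x. inverse x ^ Suc m) has_real_derivative - (real (Suc m) * inverse x ^ Suc (Suc m))) (at x)"
    using DERIV_power[OF DERIV_inverse[of x], of "Suc m"] assms
    by (simp add: power2_eq_square mult_ac del: of_nat_Suc)
  have "(F_neg (Suc m) has_real_derivative
     (inverse x ^ Suc m * (exp x * Ei (- x)) -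
       (- (real (Suc m) * inverse x ^ Suc (Suc m)) * (exp x * Ei (- x)) + (exp x * Ei (- x) + exp x * (exp (- x) / x)) * inverse x ^ Suc m)
      - - (real (Suc m) * inverse x ^ Suc (Suc m)) / real (Suc m)) / real (Suc m)) (at x)"
    unfolding F_neg.simps
    by (intro DERIV_diff Suc.IH DERIV_mult DERIV_cdivide \<open>((\<lambda>x. inverse x ^ Suc m) has_real_derivative _) _\<close>)
       (use assms in \<open>auto intro!: derivative_eq_intros\<close>)
  also have "(inverse x ^ Suc m * (exp x * Ei (- x)) -
       (- (real (Suc m) * inverse x ^ Suc (Suc m)) * (exp x * Ei (- x)) + (exp x * Ei (- x) + exp x * (exp (- x) / x)) * inverse x ^ Suc m)
      - - (real (Suc m) * inverse x ^ Suc (Suc m)) / real (Suc m)) / real (Suc m) = inverse x ^ Suc (Suc m) * (exp x * Ei (- x))"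
    using assms by (simp add: exp_minus field_simps del: of_nat_Suc)
  finally show ?case .
qed

lemma DERIV_F_int:
  assumes "x > 0"
  shows "(F_int n has_real_derivative x powi n * (exp x * Ei (- x))) (at x)"
proof (cases "n \<ge> 0")
  case True
  then show ?thesis
    using DERIV_F_nonneg[OF assms, of "nat n"] by (simp add: F_int_def power_int_def)
next
  case False
  then have "Suc (nat (- n - 1)) = nat (- n)" by simp
  with False show ?thesis
    using DERIV_F_neg[OF assms, of "nat (- n - 1)"] by (simp add: F_int_def power_int_def)
qed

section \<open>Behaviour at infinity\<close>

lemma exp_mult_Ei_neg_bounds:
  assumes "x > 0"
  shows "\<bar>exp x * Ei (- x)\<bar> \<le> inverse x"
proof -
  have "exp x * E1 x \<le> exp x * (exp (- x) / x)"
    by (intro mult_left_mono E1_le assms) auto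
  then show ?thesis
    using assms E1_nonneg[OF assms] by (simp add: Ei_neg abs_mult mult_exp_exp exp_minus field_simps)
qed

lemma exp_mult_Ei_neg_tendsto: "((\<lambda>x. exp x * Ei (- x)) \<longlongrightarrow> 0) at_top"
proof (rule Lim_null_comparison)
  show "\<forall>\<^sub>F x in at_top. norm (exp x * Ei (- x)) \<le> inverse x"
    by (rule eventually_mono[OF eventually_gt_at_top[of 0]]) (simp add: exp_mult_Ei_neg_bounds[simplified])
qed (rule tendsto_inverse_0_at_top[OF filterlim_ident])

lemma Ei_neg_tendsto: "((\<lambda>x. Ei (- x)) \<longlongrightarrow> 0) at_top"
proof -
  have "((\<lambda>x::real. exp (- x)) \<longlongrightarrow> 0) at_top"
    by (intro filterlim_compose[OF exp_at_bot] filterlim_uminus_at_bot_at_top)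
  from tendsto_mult[OF this exp_mult_Ei_neg_tendsto] show ?thesis
    by (simp add: mult.assoc[symmetric] mult_exp_exp)
qed

text \<open>From 1 onwards the derivative \<open>exp x / x\<close> lies between 0 and
  \<open>exp x\<close>. Growth of order \<open>exp x\<close> is tolerable since
  \<open>exp x * Ei (- x)\<close> tends to 0.\<close>

lemma Ei_le_exp:
  assumes "x \<ge> 1"
  shows "\<bar>Ei x\<bar> \<le> \<bar>Ei 1\<bar> + exp x"
proof -
  have "exp 1 - Ei 1 \<le> exp x - Ei x"
  proof (rule DERIV_nonneg_imp_nondecreasing[OF assms])
    fix y :: real assume "1 \<le> y" "y \<le> x"
    then show "\<exists>z. ((\<lambda>y. exp y - Ei y) has_real_derivative z) (at y) \<and> z \<ge> 0"
      by (intro exI[of _ "exp y - exp y / y"] conjI DERIV_diff DERIV_Ei_pos DERIV_exp)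
         (auto simp: field_simps)
  qed
  moreover have "Ei 1 \<le> Ei x"
  proof (rule DERIV_nonneg_imp_nondecreasing[OF assms])
    fix y :: real assume "1 \<le> y" "y \<le> x"
    then show "\<exists>z. (Ei has_real_derivative z) (at y) \<and> z \<ge> 0"
      by (intro exI[of _ "exp y / y"] conjI DERIV_Ei_pos) auto
  qed
  ultimately show ?thesis using exp_gt_zero[of x] exp_gt_zero[of "1::real"] by arith
qed

lemma Ei_mult_Ei_tendsto: "((\<lambda>x. Ei (- x) * Ei x) \<longlongrightarrow> 0) at_top"
proof (rule Lim_null_comparison)
  have "norm (Ei (- x) * Ei x) \<le> \<bar>Ei 1\<bar> * \<bar>Ei (- x)\<bar> + \<bar>exp x * Ei (- x)\<bar>" if "x \<ge> 1" for x
    using mult_left_mono[OF Ei_le_exp[OF that], of "\<bar>Ei (- x)\<bar>"] by (simp add: abs_mult algebra_simps)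
  then show "\<forall>\<^sub>F x in at_top. norm (Ei (- x) * Ei x) \<le> \<bar>Ei 1\<bar> * \<bar>Ei (- x)\<bar> + \<bar>exp x * Ei (- x)\<bar>"
    by (rule eventually_mono[OF eventually_ge_at_top[of 1]])
  show "((\<lambda>x. \<bar>Ei 1\<bar> * \<bar>Ei (- x)\<bar> + \<bar>exp x * Ei (- x)\<bar>) \<longlongrightarrow> 0) at_top"
    by (intro tendsto_add_zero tendsto_mult_right_zero tendsto_rabs_zero Ei_neg_tendsto exp_mult_Ei_neg_tendsto)
qed

text \<open>The constants of integration are normalized at infinity at every level of the recursion.
  Hence the limit of \<open>Psi n u v\<close> in \<open>v\<close> is \<open>- F_int n u\<close> for
  negative \<open>n\<close>, which is \<open>tPsi\<close>.\<close>

lemma F_neg_tendsto: "(F_neg m \<longlongrightarrow> 0) at_top"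
proof (induction m)
  case 0
  have "((\<lambda>x. Ei (- x) * Ei x - (Ei (- x))\<^sup>2 / 2 + tpsi_series x) \<longlongrightarrow> 0 - 0\<^sup>2 / 2 + 0) at_top"
    by (intro tendsto_intros Ei_mult_Ei_tendsto Ei_neg_tendsto tpsi_series_tendsto) auto
  then show ?case by simp
next
  case (Suc m)
  have "((\<lambda>x::real. inverse x ^ Suc m) \<longlongrightarrow> 0 ^ Suc m) at_top"
    by (intro tendsto_power tendsto_inverse_0_at_top filterlim_ident)
  then have "((\<lambda>x. (F_neg m x - inverse x ^ Suc m * (exp x * Ei (- x)) - inverse x ^ Suc m / real (Suc m)) / real (Suc m))
      \<longlongrightarrow> (0 - 0 ^ Suc m * 0 - 0 ^ Suc m / real (Suc m)) / real (Suc m)) at_top"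
    by (intro tendsto_divide tendsto_diff tendsto_mult tendsto_const Suc.IH exp_mult_Ei_neg_tendsto) auto
  then show ?case by simp
qed

section \<open>From the recursions to the stated finite sums\<close>

lemma F_nonneg_eq:
  "F_nonneg n x = (\<Sum>k=0..n. (-1)^k * fact n / fact (n - k) * (x ^ (n - k) * exp x * Ei (- x)))
     - (\<Sum>k=0..<n. (-1)^k * fact n * x ^ (n - k) / (real (n - k) * fact (n - k)))
     - (-1)^n * fact n * ln x"
proof (induction n)
  case (Suc n)
  have fact: "(-1) ^ Suc k * fact (Suc n) = - real (Suc n) * ((-1) ^ k * fact n)" for k
    by (simp add: algebra_simps)
  have *: "(-1) ^ Suc k * fact (Suc n) * X / Y = - real (Suc n) * ((-1) ^ k * fact n * X / Y)" for k and X Y :: real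
    unfolding fact by (simp del: of_nat_Suc)
  have **: "(-1) ^ Suc k * fact (Suc n) / X * Y = - real (Suc n) * ((-1) ^ k * fact n / X * Y)" for k and X Y :: real
    unfolding fact by (simp del: of_nat_Suc)
  have "(\<Sum>k=0..Suc n. (-1)^k * fact (Suc n) / fact (Suc n - k) * (x ^ (Suc n - k) * exp x * Ei (- x)))
     = x ^ Suc n * (exp x * Ei (- x)) - real (Suc n) * (\<Sum>k=0..n. (-1)^k * fact n / fact (n - k) * (x ^ (n - k) * exp x * Ei (- x)))"
    unfolding sum.atLeast0_atMost_Suc_shift o_def ** diff_Suc_Suc sum_distrib_left[symmetric]
    by (simp del: of_nat_Suc fact_Suc power_Suc)
  moreover have "x ^ Suc n * fact (Suc n) / (real (Suc n) * fact (Suc n)) = x ^ Suc n / real (Suc n)"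
    by (simp del: of_nat_Suc)
  then have "(\<Sum>k=0..<Suc n. (-1)^k * fact (Suc n) * x ^ (Suc n - k) / (real (Suc n - k) * fact (Suc n - k)))
     = x ^ Suc n / real (Suc n) - real (Suc n) * (\<Sum>k=0..<n. (-1)^k * fact n * x ^ (n - k) / (real (n - k) * fact (n - k)))"
    unfolding sum.atLeast0_lessThan_Suc_shift o_def * diff_Suc_Suc sum_distrib_left[symmetric]
    by (simp del: of_nat_Suc fact_Suc power_Suc)
  moreover have "(-1)^Suc n * fact (Suc n) * ln x = - real (Suc n) * ((-1)^n * fact n * ln x)"
    unfolding fact by (simp del: of_nat_Suc)
  ultimately show ?case
    unfolding F_nonneg.simps Suc.IH by (simp only: right_diff_distrib)
qed simp

lemma F_neg_eq:
  defines "n \<equiv> \<lambda>m. - int m - 1"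
  shows "F_neg m x = (- (\<Sum>k=1..m. fact (m - k) / fact m * (x powi (n m + int k) * exp x * Ei (- x))))
     + Ei (- x) * Ei x / fact m
     + (\<Sum>k=1..m. fact (m - k) * x powi (n m + int k) / (fact m * of_int (n m + int k)))
     - (Ei (- x))\<^sup>2 / (2 * fact m) + tpsi_series x / fact m"
proof (induction m)
  case (Suc m)
  \<comment> \<open>Raising \<open>m\<close> lowers \<open>n\<close> by one, so shifting
    \<open>k\<close> leaves the exponent \<open>n + k\<close> unchanged; the only new summand is the
    one at \<open>k = 0\<close> after the shift.\<close>
  have n: "n (Suc m) + int (Suc k) = n m + int k" for k
    by (simp add: n_def)
  have n1: "x powi (n m) = inverse x ^ Suc m" "of_int (n m) = - real (Suc m)"
    by (simp_all add: n_def power_int_def nat_add_distrib)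
  have *: "X / fact (Suc m) * Y = (X / fact m * Y) / real (Suc m)" for X Y :: real
    by simp
  have **: "X / (fact (Suc m) * Y) = (X / (fact m * Y)) / real (Suc m)" for X Y :: real
    by simp
  have "(\<Sum>k=1..Suc m. fact (Suc m - k) / fact (Suc m) * (x powi (n (Suc m) + int k) * exp x * Ei (- x)))
     = (\<Sum>k=0..m. fact (m - k) / fact m * (x powi (n m + int k) * exp x * Ei (- x))) / real (Suc m)"
    unfolding One_nat_def sum.shift_bounds_cl_Suc_ivl n * diff_Suc_Suc sum_divide_distrib ..
  also have "\<dots> = (inverse x ^ Suc m * (exp x * Ei (- x))
      + (\<Sum>k=1..m. fact (m - k) / fact m * (x powi (n m + int k) * exp x * Ei (- x)))) / real (Suc m)"
    by (simp add: sum.atLeast_Suc_atMost[of 0 m] n1 del: of_nat_Suc power_Suc)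
  finally have 1: "(\<Sum>k=1..Suc m. fact (Suc m - k) / fact (Suc m) * (x powi (n (Suc m) + int k) * exp x * Ei (- x))) = \<dots>" .
  have "(\<Sum>k=1..Suc m. fact (Suc m - k) * x powi (n (Suc m) + int k) / (fact (Suc m) * of_int (n (Suc m) + int k)))
     = (\<Sum>k=0..m. fact (m - k) * x powi (n m + int k) / (fact m * of_int (n m + int k))) / real (Suc m)"
    unfolding One_nat_def sum.shift_bounds_cl_Suc_ivl n ** diff_Suc_Suc sum_divide_distrib ..
  also have "\<dots> = (- (inverse x ^ Suc m / real (Suc m))
      + (\<Sum>k=1..m. fact (m - k) * x powi (n m + int k) / (fact m * of_int (n m + int k)))) / real (Suc m)"
    by (simp add: sum.atLeast_Suc_atMost[of 0 m] n1 del: of_nat_Suc power_Suc)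
  finally have 2: "(\<Sum>k=1..Suc m. fact (Suc m - k) * x powi (n (Suc m) + int k) / (fact (Suc m) * of_int (n (Suc m) + int k))) = \<dots>" .
  have 3: "X / fact (Suc m) = (X / fact m) / real (Suc m)" "X / (2 * fact (Suc m)) = (X / (2 * fact m)) / real (Suc m)" for X :: real
    by simp_all
  show ?case
    unfolding F_neg.simps Suc.IH 1 2 unfolding 3
    by (simp only: add_divide_distrib diff_divide_distrib minus_divide_left[symmetric])
qed (simp add: n_def)

text \<open>The four cases of the definition are really two: \<open>n = 0\<close> and
  \<open>n = - 1\<close> are the neighbouring formulas with empty sums.\<close>

lemma Psi_eq:
  assumes "0 < u" "0 < v"
  shows "Psi n u v = F_int n v - F_int n u"
proof (cases "n \<ge> 0")
  case True
  define n' where "n' = nat n"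
  have ln: "ln (v / u) = ln v - ln u"
    using assms by (simp add: ln_div)
  have "Psi n u v = (\<Sum>k=0..n'. (-1)^k * fact n' / fact (n' - k) *
             (v ^ (n' - k) * exp v * Ei (- v) - u ^ (n' - k) * exp u * Ei (- u)))
       - (\<Sum>k=0..<n'. (-1)^k * fact n' * (v ^ (n' - k) - u ^ (n' - k)) / (real (n' - k) * fact (n' - k)))
       - (-1)^n' * fact n' * ln (v / u)"
    using True by (cases "n = 0") (simp_all add: Psi_def n'_def Let_def)
  also have "\<dots> = F_nonneg n' v - F_nonneg n' u"
    unfolding F_nonneg_eq ln
    by (simp only: right_diff_distrib diff_divide_distrib sum_subtractf)
  finally show ?thesis using True by (simp add: F_int_def n'_def)
next
  case False
  define m where "m = nat (- n - 1)"
  have n: "n = - int m - 1" using False by (simp add: m_def)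
  have "Psi n u v =
        (\<Sum>k=1..m. fact (m - k) / fact m *
             (u powi (n + int k) * exp u * Ei (- u) - v powi (n + int k) * exp v * Ei (- v)))
       + (Ei (- v) * Ei v - Ei (- u) * Ei u) / fact m
       + (\<Sum>k=1..m. fact (m - k) * (v powi (n + int k) - u powi (n + int k)) / (fact m * of_int (n + int k)))
       + (Ei (- u)^2 - Ei (- v)^2) / (2 * fact m)
       + psi_series u v / fact m"
    using False by (cases "n = -1") (simp_all add: Psi_def m_def Let_def)
  also have "\<dots> = F_neg m v - F_neg m u"
    unfolding F_neg_eq n[symmetric] psi_series_eq[OF less_imp_le less_imp_le, OF assms]
    by (simp only: right_diff_distrib diff_divide_distrib sum_subtractf)
  finally show ?thesis using False by (simp add: F_int_def m_def)
qed

lemma tPsi_eq: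
  assumes "n \<le> - 1"
  shows "tPsi n u = - F_int n u"
proof -
  define m where "m = nat (- n - 1)"
  have n: "n = - int m - 1" using assms by (simp add: m_def)
  have "tPsi n u = - F_neg m u"
    unfolding F_neg_eq n[symmetric] tPsi_def Let_def m_def[symmetric]
    by (simp add: sum_distrib_left sum_divide_distrib mult_ac)
  then show ?thesis using assms by (simp add: F_int_def m_def)
qed

section \<open>Expected logarithms under Erlang laws\<close>

lemma En_1:
  assumes "x > 0"
  shows "En 1 x = - Ei (- x)"
proof -
  have "(LINT t:{1..}|lborel. exp (- x * t) / t ^ 1) = 0 - Ei (- (x * 1))"
  proof (rule integral_FTC_atLeast)
    show "((\<lambda>t. Ei (- (x * t))) has_real_derivative exp (- x * t) / t ^ 1) (at t)" if "t \<ge> 1" for t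
      using that assms by (auto intro!: derivative_eq_intros)
    show "isCont (\<lambda>t. exp (- x * t) / t ^ 1) t" if "t \<ge> 1" for t
      using that by (auto intro!: continuous_intros)
    have "filterlim (\<lambda>t. x * t) at_top at_top"
      using assms by (intro filterlim_tendsto_pos_mult_at_top[OF tendsto_const] filterlim_ident)
    then show "((\<lambda>t. Ei (- (x * t))) \<longlongrightarrow> 0) at_top"
      by (rule filterlim_compose[OF Ei_neg_tendsto])
  qed (use assms in \<open>intro set_integrable_exp_div_power, auto\<close>)
  then show ?thesis by (simp add: En_def)
qed

text \<open>Integrate the derivative of \<open>- exp (- x * t) / t ^ q\<close> over the half-line
  from 1.\<close>

lemma En_Suc:
  assumes "x > 0" "q \<ge> 1"
  shows "real q * En (Suc q) x = exp (- x) - x * En q x"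
proof -
  let ?f = "\<lambda>q t. exp (- x * t) / t ^ q"
  have int: "set_integrable lborel {1..} (?f q)" for q
    using assms by (intro set_integrable_exp_div_power) auto
  have "(LINT t:{1..}|lborel. x * ?f q t + real q * ?f (Suc q) t) = 0 - (- ?f q 1)"
  proof (rule integral_FTC_atLeast)
    show "((\<lambda>t. - ?f q t) has_real_derivative x * ?f q t + real q * ?f (Suc q) t) (at t)" if "t \<ge> 1" for t
    proof -
      have "((\<lambda>t. - ?f q t) has_real_derivative
         - ((exp (- x * t) * (- x) * t ^ q - exp (- x * t) * (real q * t ^ (q - Suc 0))) / (t ^ q * t ^ q))) (at t)"
        using that assms DERIV_pow[of q t]
        by (intro DERIV_minus DERIV_divide) (auto intro!: derivative_eq_intros)
      also have tq: "t ^ q = t * t ^ (q - Suc 0)"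
        using assms by (cases q) auto
      also have "- ((exp (- x * t) * (- x) * (t * X) - exp (- x * t) * (real q * X)) / ((t * X) * (t * X)))
          = x * (exp (- x * t) / (t * X)) + real q * (exp (- x * t) / (t * (t * X)))" if "X > 0" for X
        using that \<open>t \<ge> 1\<close> by (simp add: field_simps)
      finally show ?thesis
        using that by (simp add: tq)
    qed
    show "isCont (\<lambda>t. x * ?f q t + real q * ?f (Suc q) t) t" if "t \<ge> 1" for t
      using that by (auto intro!: continuous_intros)
    show "set_integrable lborel {1..} (\<lambda>t. x * ?f q t + real q * ?f (Suc q) t)"
      by (intro set_integral_add set_integrable_mult_right int)
    have "((\<lambda>t. exp (- (x * t))) \<longlongrightarrow> 0) at_top"
      by (intro filterlim_compose[OF exp_at_bot] filterlim_compose[OF filterlim_uminus_at_bot_at_top]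
          filterlim_tendsto_pos_mult_at_top[OF tendsto_const] filterlim_ident assms)
    moreover have "((\<lambda>t::real. inverse t ^ q) \<longlongrightarrow> 0 ^ q) at_top"
      by (intro tendsto_power tendsto_inverse_0_at_top filterlim_ident)
    ultimately have "((\<lambda>t. - (exp (- (x * t)) * inverse t ^ q)) \<longlongrightarrow> - (0 * 0 ^ q)) at_top"
      by (intro tendsto_minus tendsto_mult)
    then show "((\<lambda>t. - ?f q t) \<longlongrightarrow> 0) at_top"
      by (simp add: field_simps)
  qed
  also have "(LINT t:{1..}|lborel. x * ?f q t + real q * ?f (Suc q) t) = x * En q x + real q * En (Suc q) x"
    unfolding En_def set_integral_add(2)[OF set_integrable_mult_right set_integrable_mult_right, OF int int]
    by (simp only: set_integral_mult_right)
  finally show ?thesis by simp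
qed

text \<open>The factor \<open>fact q\<close> clears the denominators of \<open>En_Suc\<close>. The
  term with \<open>Ei\<close> is the source of \<open>I1\<close> and \<open>I2\<close>, the finite
  sum over \<open>s\<close> that of \<open>I3\<close>.\<close>

lemma En_closed_form:
  assumes "x > 0"
  shows "fact q * (exp x * En (Suc q) x) =
    - ((- x) ^ q * (exp x * Ei (- x))) + (\<Sum>s<q. fact (q - 1 - s) * (- x) ^ s)"
proof (induction q)
  case 0
  show ?case using En_1[OF assms] by simp
next
  case (Suc q)
  have "fact (Suc q) * (exp x * En (Suc (Suc q)) x) = fact q * exp x * (real (Suc q) * En (Suc (Suc q)) x)"
    by (simp add: mult_ac)
  also have "\<dots> = fact q - x * (fact q * (exp x * En (Suc q) x))"
    using assms by (subst En_Suc) (simp_all add: right_diff_distrib mult_exp_exp mult_ac)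
  also have "\<dots> = - ((- x) ^ Suc q * (exp x * Ei (- x))) + (fact q + (\<Sum>s<q. fact (q - 1 - s) * (- x) ^ Suc s))"
    unfolding Suc.IH by (simp add: sum_distrib_left algebra_simps sum_negf)
  also have "fact q + (\<Sum>s<q. fact (q - 1 - s) * (- x) ^ Suc s) = (\<Sum>s<Suc q. fact (Suc q - 1 - s) * (- x) ^ s)"
    by (subst sum.lessThan_Suc_shift) simp
  finally show ?case .
qed

text \<open>The index is one below the gamma shape: \<open>Er 0\<close> is the law of
  \<open>X\<close> and \<open>Er (M - 2)\<close> that of \<open>Y\<close>, which has shape
  \<open>M - 1\<close>.\<close>

abbreviation (input) Er :: "nat \<Rightarrow> real measure" where
  "Er k \<equiv> density lborel (\<lambda>x. ennreal (erlang_density k 1 x))"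

lemma prob_space_Er: "prob_space (Er k)"
  by (rule prob_space_erlang_density) simp

lemma AE_Er_nonneg: "AE y in Er k. y \<ge> 0"
  by (subst AE_density) (auto simp: erlang_density_def)

lemma integrable_Er_id: "integrable (Er k) (\<lambda>y. y)"
  using prob_space.erlang_ith_moment_integrable[OF prob_space_Er, where X = "\<lambda>x. x" and l = 1 and i = 1 and k = k]
  by (simp add: distributed_def distr_id2)

text \<open>Linear growth is enough because an Erlang law has finite mean.\<close>

lemma integrable_ErI:
  fixes f :: "real \<Rightarrow> real"
  assumes [measurable]: "f \<in> borel_measurable borel"
    and "\<And>y. y \<ge> 0 \<Longrightarrow> \<bar>f y\<bar> \<le> a + b * y"
  shows "integrable (Er k) f"
proof (rule Bochner_Integration.integrable_bound)
  interpret prob_space "Er k" by (rule prob_space_Er)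
  show "integrable (Er k) (\<lambda>y. a + b * y)"
    using integrable_Er_id by (intro Bochner_Integration.integrable_add integrable_mult_right) auto
  show "AE y in Er k. norm (f y) \<le> norm (a + b * y)"
    using AE_Er_nonneg by eventually_elim (use assms(2) in force)
qed simp

lemma integral_Er_eq:
  fixes f :: "real \<Rightarrow> real"
  assumes [measurable]: "f \<in> borel_measurable borel"
  shows "integral\<^sup>L (Er k) f = (LINT y:{0..}|lborel. exp (- y) * y ^ k / fact k * f y)"
    and "integrable (Er k) f \<longleftrightarrow> set_integrable lborel {0..} (\<lambda>y. exp (- y) * y ^ k / fact k * f y)"
proof -
  have eq: "erlang_density k 1 y * f y = indicat_real {0..} y *\<^sub>R (exp (- y) * y ^ k / fact k * f y)" for y
    by (auto simp: erlang_density_def indicator_def)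
  show "integral\<^sup>L (Er k) f = (LINT y:{0..}|lborel. exp (- y) * y ^ k / fact k * f y)"
    unfolding set_lebesgue_integral_def
    by (subst integral_real_density) (auto simp only: eq erlang_density_nonneg assms intro!: AE_I2, auto)
  show "integrable (Er k) f \<longleftrightarrow> set_integrable lborel {0..} (\<lambda>y. exp (- y) * y ^ k / fact k * f y)"
    unfolding set_integrable_def
    by (subst integrable_real_density) (auto simp only: eq erlang_density_nonneg assms intro!: AE_I2, auto)
qed

lemma abs_ln_affine_le:
  fixes A c y :: real
  assumes "A \<ge> 1" "c \<ge> 0" "y \<ge> 0"
  shows "\<bar>ln (A + c * y)\<bar> \<le> A + c * y"
proof -
  have "A + c * y \<ge> 1" using assms by (simp add: add_increasing2)
  then show ?thesis using ln_le_minus_one[of "A + c * y"] ln_ge_zero[of "A + c * y"] by auto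
qed

lemma integrable_Er_ln:
  assumes "A \<ge> 1" "c \<ge> 0"
  shows "integrable (Er k) (\<lambda>y. ln (A + c * y))"
  by (rule integrable_ErI[where a = A and b = c]) (use assms abs_ln_affine_le in auto)

lemma integrable_Er_slope:
  assumes "A \<ge> 1" "c \<ge> 0"
  shows "integrable (Er k) (\<lambda>y. c / (A + c * y))"
proof (rule integrable_ErI[where a = c and b = 0])
  fix y :: real assume "y \<ge> 0"
  then have "A + c * y \<ge> 1" using assms by (simp add: add_increasing2)
  then have "c / (A + c * y) \<le> c / 1" using assms by (intro divide_left_mono) auto
  then show "\<bar>c / (A + c * y)\<bar> \<le> c + 0 * y"
    using assms \<open>A + c * y \<ge> 1\<close> by (auto simp: abs_div)
qed simp

text \<open>Integration by parts against the density \<open>g\<^sub>k = exp (- y) y\<^sup>k / k!\<close>, for which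
  \<open>g\<^sub>k' = g\<^sub>k\<^sub>-\<^sub>1 - g\<^sub>k\<close>.\<close>

lemma Er_by_parts:
  assumes A: "A \<ge> 1" and c: "c \<ge> 0"
  shows "(\<integral>y. ln (A + c * y) \<partial>Er (Suc k)) - (\<integral>y. ln (A + c * y) \<partial>Er k) = (\<integral>y. c / (A + c * y) \<partial>Er (Suc k))"
    and "(\<integral>y. ln (A + c * y) \<partial>Er 0) - ln A = (\<integral>y. c / (A + c * y) \<partial>Er 0)"
proof -
  let ?g = "\<lambda>k y. exp (- y) * y ^ k / fact k :: real"
  let ?L = "\<lambda>y. ln (A + c * y)"
  have pos: "A + c * y \<ge> 1" if "y \<ge> 0" for y
    using A c that by (simp add: add_increasing2)
  have lim: "((\<lambda>y. ?g k y * ?L y) \<longlongrightarrow> 0) at_top" for k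
  proof (rule Lim_null_comparison)
    have "norm (?g k y * ?L y) \<le> A / fact k * (y ^ k / exp y) + c / fact k * (y ^ Suc k / exp y)" if y: "y \<ge> 0" for y
    proof -
      have "norm (?g k y * ?L y) = ?g k y * \<bar>?L y\<bar>"
        using y by (simp add: abs_mult)
      also have "\<dots> \<le> ?g k y * (A + c * y)"
        using y by (intro mult_left_mono abs_ln_affine_le A c) auto
      also have "\<dots> = A / fact k * (y ^ k / exp y) + c / fact k * (y ^ Suc k / exp y)"
        by (simp add: exp_minus field_simps)
      finally show ?thesis .
    qed
    then show "\<forall>\<^sub>F y in at_top. norm (?g k y * ?L y) \<le> A / fact k * (y ^ k / exp y) + c / fact k * (y ^ Suc k / exp y)"
      by (rule eventually_mono[OF eventually_ge_at_top])
    show "((\<lambda>y. A / fact k * (y ^ k / exp y) + c / fact k * (y ^ Suc k / exp y)) \<longlongrightarrow> 0) at_top"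
      by (intro tendsto_add_zero tendsto_mult_right_zero tendsto_power_div_exp_0)
  qed
  have intL: "set_integrable lborel {0..} (\<lambda>y. ?g k y * ?L y)" for k
    using integrable_Er_ln[OF A c, of k] by (simp add: integral_Er_eq)
  have intS: "set_integrable lborel {0..} (\<lambda>y. ?g k y * (c / (A + c * y)))" for k
    using integrable_Er_slope[OF A c, of k] by (simp add: integral_Er_eq)
  have IL: "(\<integral>y. ?L y \<partial>Er k) = (LINT y:{0..}|lborel. ?g k y * ?L y)" for k
    by (rule integral_Er_eq(1)) simp
  have IS: "(\<integral>y. c / (A + c * y) \<partial>Er k) = (LINT y:{0..}|lborel. ?g k y * (c / (A + c * y)))" for k
    by (rule integral_Er_eq(1)) simp
  have DL: "(?L has_real_derivative c / (A + c * y)) (at y)" if "y \<ge> 0" for y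
    using pos[OF that] by (auto intro!: derivative_eq_intros)
  have cont: "isCont (\<lambda>y. ?g k y * ?L y) y" "isCont (\<lambda>y. ?g k y * (c / (A + c * y))) y" if "y \<ge> 0" for k y
    using pos[OF that] by (auto intro!: continuous_intros)
  \<comment> \<open>The integrand is the derivative of \<open>?g (Suc k) * ?L\<close>; the boundary
    term at 0 vanishes with \<open>0 ^ Suc k\<close>.\<close>
  have "(LINT y:{0..}|lborel. ?g (Suc k) y * (c / (A + c * y)) + (?g k y * ?L y - ?g (Suc k) y * ?L y))
      = 0 - ?g (Suc k) 0 * ?L 0"
  proof (rule integral_FTC_atLeast[OF _ _ _ lim])
    fix y :: real assume y: "0 \<le> y"
    have "(?g (Suc k) has_real_derivative ?g k y - ?g (Suc k) y) (at y)"
    proof -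
      have "(?g (Suc k) has_real_derivative (- exp (- y) * y ^ Suc k + (real (Suc k) * y ^ k) * exp (- y)) / fact (Suc k)) (at y)"
        using DERIV_pow[of "Suc k" y]
        by (intro DERIV_cdivide DERIV_mult) (auto intro!: derivative_eq_intros)
      also have "(- exp (- y) * y ^ Suc k + (real (Suc k) * y ^ k) * exp (- y)) / fact (Suc k) = ?g k y - ?g (Suc k) y"
        by (simp add: diff_divide_distrib mult_ac del: of_nat_Suc power_Suc)
      finally show ?thesis .
    qed
    from DERIV_mult[OF this DL[OF y]]
    show "((\<lambda>y. ?g (Suc k) y * ?L y) has_real_derivative
        ?g (Suc k) y * (c / (A + c * y)) + (?g k y * ?L y - ?g (Suc k) y * ?L y)) (at y)"
      by (simp add: algebra_simps)
  next
    show "isCont (\<lambda>y. ?g (Suc k) y * (c / (A + c * y)) + (?g k y * ?L y - ?g (Suc k) y * ?L y)) y" if "y \<ge> 0" for y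
      by (intro continuous_add continuous_diff cont that)
  qed (intro set_integral_add set_integral_diff intL intS)
  then show "(\<integral>y. ln (A + c * y) \<partial>Er (Suc k)) - (\<integral>y. ln (A + c * y) \<partial>Er k) = (\<integral>y. c / (A + c * y) \<partial>Er (Suc k))"
    unfolding IL IS set_integral_add(2)[OF intS set_integral_diff(1)[OF intL intL]]
      set_integral_diff(2)[OF intL intL]
    by simp
  \<comment> \<open>The exponential density equals 1 at the origin, so here the boundary term
    \<open>ln A\<close> takes the place of an expectation of lower shape.\<close>
  have "(LINT y:{0..}|lborel. ?g 0 y * (c / (A + c * y)) - ?g 0 y * ?L y) = 0 - ?g 0 0 * ?L 0"
  proof (rule integral_FTC_atLeast[OF _ _ _ lim])
    fix y :: real assume y: "0 \<le> y"
    have "(?g 0 has_real_derivative - ?g 0 y) (at y)"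
      by (auto intro!: derivative_eq_intros)
    from DERIV_mult[OF this DL[OF y]]
    show "((\<lambda>y. ?g 0 y * ?L y) has_real_derivative ?g 0 y * (c / (A + c * y)) - ?g 0 y * ?L y) (at y)"
      by (simp add: algebra_simps)
  next
    show "isCont (\<lambda>y. ?g 0 y * (c / (A + c * y)) - ?g 0 y * ?L y) y" if "y \<ge> 0" for y
      by (intro continuous_diff cont that)
  qed (intro set_integral_diff intL intS)
  then show "(\<integral>y. ln (A + c * y) \<partial>Er 0) - ln A = (\<integral>y. c / (A + c * y) \<partial>Er 0)"
    unfolding IL IS set_integral_diff(2)[OF intS intL] by simp
qed

text \<open>Both sides obey one recursion:
  \<open>y * (c / (1 + c * y)) = 1 - 1 / (1 + c * y)\<close> lowers the shape on the left, and
  \<open>En_Suc\<close> lowers the order on the right.\<close>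

lemma integral_Er_slope:
  assumes c: "c > 0"
  shows "(\<integral>y. c / (1 + c * y) \<partial>Er k) = exp (1 / c) * En (Suc k) (1 / c)"
proof (induction k)
  case 0
  have pos: "1 + c * y \<ge> 1" if "y \<ge> 0" for y
    using c that by simp
  have "(LINT y:{0..}|lborel. exp (- y) * (c / (1 + c * y))) = 0 - exp (1 / c) * Ei (- (0 + 1 / c))"
  proof (rule integral_FTC_atLeast)
    show "((\<lambda>y. exp (1 / c) * Ei (- (y + 1 / c))) has_real_derivative exp (- y) * (c / (1 + c * y))) (at y)" if y: "y \<ge> 0" for y
    proof -
      have "y + 1 / c > 0" using c y by (simp add: add_nonneg_pos)
      then have "((\<lambda>y. exp (1 / c) * Ei (- (y + 1 / c))) has_real_derivative exp (1 / c) * (exp (- (y + 1 / c)) / (y + 1 / c) * 1)) (at y)"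
        by (intro DERIV_cmult DERIV_Ei_neg) (auto intro!: derivative_eq_intros)
      also have "exp (1 / c) * (exp (- (y + 1 / c)) / (y + 1 / c) * 1) = exp (- y) / (y + 1 / c)"
        by (simp add: mult_exp_exp)
      also have "\<dots> = exp (- y) * (c / (1 + c * y))"
        using c pos[OF y] by (simp add: field_simps)
      finally show ?thesis .
    qed
    show "isCont (\<lambda>y. exp (- y) * (c / (1 + c * y))) y" if "y \<ge> 0" for y
      using pos[OF that] by (auto intro!: continuous_intros)
    show "set_integrable lborel {0..} (\<lambda>y. exp (- y) * (c / (1 + c * y)))"
      using integrable_Er_slope[of 1 c 0] c by (simp add: integral_Er_eq)
    have "((\<lambda>y. Ei (- (1 / c + y))) \<longlongrightarrow> 0) at_top"
      by (intro filterlim_compose[OF Ei_neg_tendsto] filterlim_tendsto_add_at_top[OF tendsto_const] filterlim_ident)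
    then have "((\<lambda>y. exp (1 / c) * Ei (- (1 / c + y))) \<longlongrightarrow> exp (1 / c) * 0) at_top"
      by (intro tendsto_intros)
    then show "((\<lambda>y. exp (1 / c) * Ei (- (y + 1 / c))) \<longlongrightarrow> 0) at_top"
      by (simp add: add.commute)
  qed
  moreover have "En (Suc 0) (1 / c) = - Ei (- (1 / c))"
    using En_1[of "1 / c"] c by simp
  ultimately show ?case
    by (simp add: integral_Er_eq)
next
  case (Suc k)
  interpret prob_space "Er k" by (rule prob_space_Er)
  have "real (Suc k) * (exp (- y) * y ^ Suc k / fact (Suc k) * (c / (1 + c * y)))
      = exp (- y) * y ^ k / fact k * (1 - c / (1 + c * y) / c)" if "y \<ge> 0" for y
  proof -
    have "1 + c * y \<noteq> 0" using c that by (smt (verit) mult_nonneg_nonneg)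
    then have "1 - 1 / (1 + c * y) = y * (c / (1 + c * y))"
      by (simp add: field_simps)
    moreover have "c / (1 + c * y) / c = 1 / (1 + c * y)"
      using c by simp
    ultimately have "1 - c / (1 + c * y) / c = y * (c / (1 + c * y))"
      by simp
    then show ?thesis
      by (simp only: fact_Suc of_nat_mult) (simp add: mult_ac del: of_nat_Suc)
  qed
  note * = this
  have "real (Suc k) * (\<integral>y. c / (1 + c * y) \<partial>Er (Suc k))
      = (LINT y:{0..}|lborel. real (Suc k) * (exp (- y) * y ^ Suc k / fact (Suc k) * (c / (1 + c * y))))"
    by (subst integral_Er_eq(1)) (simp_all only: set_integral_mult_right, measurable)
  also have "\<dots> = (LINT y:{0..}|lborel. exp (- y) * y ^ k / fact k * (1 - c / (1 + c * y) / c))"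
    by (rule set_lebesgue_integral_cong) (use * in auto)
  also have "\<dots> = (\<integral>y. 1 - c / (1 + c * y) / c \<partial>Er k)"
    by (rule integral_Er_eq(1)[symmetric]) measurable
  also have "\<dots> = 1 - (\<integral>y. c / (1 + c * y) \<partial>Er k) / c"
    using c prob_space
    by (subst Bochner_Integration.integral_diff[OF integrable_const integrable_divide[OF integrable_Er_slope]])
       (simp_all only: integral_divide_zero, simp_all)
  also have "\<dots> = exp (1 / c) * (exp (- (1 / c)) - 1 / c * En (Suc k) (1 / c))"
    unfolding Suc.IH by (simp add: right_diff_distrib mult_exp_exp)
  also have "\<dots> = real (Suc k) * (exp (1 / c) * En (Suc (Suc k)) (1 / c))"
    using c by (subst En_Suc[symmetric]) auto
  finally show ?case by simp
qed

text \<open>Telescoping of \<open>Er_by_parts\<close> at \<open>A = 1\<close>, where the starting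
  value \<open>ln A\<close> is 0; each unit of shape adds one slope integral.\<close>

lemma integral_Er_ln:
  assumes c: "c > 0"
  shows "(\<integral>y. ln (1 + c * y) \<partial>Er k) = (\<Sum>q=1..Suc k. exp (1 / c) * En q (1 / c))"
proof (induction k)
  case 0
  show ?case
    using Er_by_parts(2)[of 1 c] integral_Er_slope[OF c, of 0] c by simp
next
  case (Suc k)
  then show ?case
    using Er_by_parts(1)[of 1 c k] integral_Er_slope[OF c, of "Suc k"] c by simp
qed

section \<open>Two independent Erlang variables\<close>

lemma sets_Er_pair: "sets (Er j \<Otimes>\<^sub>M Er k) = sets (borel \<Otimes>\<^sub>M borel)"
  by (intro sets_pair_measure_cong) simp_all

lemma pair_prob_space_Er: "pair_prob_space (Er j) (Er k)"
  by (intro pair_prob_space.intro pair_sigma_finite.intro prob_space_imp_sigma_finite prob_space_Er)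

lemma AE_Er_pair_nonneg: "AE p in Er j \<Otimes>\<^sub>M Er k. fst p \<ge> 0 \<and> snd p \<ge> 0"
proof -
  interpret pair_prob_space "Er j" "Er k" by (rule pair_prob_space_Er)
  show ?thesis
  proof (rule AE_pair_measure)
    show "AE x in Er j. AE y in Er k. fst (x, y) \<ge> 0 \<and> snd (x, y) \<ge> 0"
      using AE_Er_nonneg[of j] AE_Er_nonneg[of k] by (auto elim!: eventually_mono)
  qed measurable
qed

lemma integrable_Er_pairI:
  fixes f :: "real \<times> real \<Rightarrow> real"
  assumes f: "f \<in> borel_measurable (borel \<Otimes>\<^sub>M borel)"
    and bound: "\<And>x y. x \<ge> 0 \<Longrightarrow> y \<ge> 0 \<Longrightarrow> \<bar>f (x, y)\<bar> \<le> a + b * x + c * y"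
  shows "integrable (Er j \<Otimes>\<^sub>M Er k) f"
proof (rule Bochner_Integration.integrable_bound)
  interpret pair_prob_space "Er j" "Er k" by (rule pair_prob_space_Er)
  have fst: "integrable (Er j \<Otimes>\<^sub>M Er k) (\<lambda>p. fst p)" for j k
    by (rule integrable_distr[OF measurable_fst])
       (simp add: prob_space.distr_pair_fst[OF prob_space_Er] integrable_Er_id)
  note 1 = fst[of j k]
  have 2: "integrable (Er j \<Otimes>\<^sub>M Er k) (\<lambda>p. snd p)"
    using integrable_product_swap_iff[of "\<lambda>p. snd p"] fst[of k j] by (simp add: split_beta')
  show "integrable (Er j \<Otimes>\<^sub>M Er k) (\<lambda>p. a + b * fst p + c * snd p)"
    using 1 2 by (intro Bochner_Integration.integrable_add integrable_mult_right P.integrable_const)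
  show "f \<in> borel_measurable (Er j \<Otimes>\<^sub>M Er k)"
    using f by (simp add: measurable_cong_sets[OF sets_Er_pair refl])
  show "AE p in Er j \<Otimes>\<^sub>M Er k. norm (f p) \<le> norm (a + b * fst p + c * snd p)"
    using AE_Er_pair_nonneg by eventually_elim (use bound in \<open>force simp: prod_eq_iff\<close>)
qed

text \<open>The first variable is kept exponential; the recursion moves only the shape of the
  second.\<close>

definition ln_mean_pair :: "nat \<Rightarrow> real \<Rightarrow> real \<Rightarrow> real" where
  "ln_mean_pair k \<alpha> c = (\<integral>p. ln (1 + \<alpha> * fst p + c * snd p) \<partial>(Er 0 \<Otimes>\<^sub>M Er k))"

lemma integrable_ln_mean_pair:
  assumes "\<alpha> \<ge> 0" "c \<ge> 0"
  shows "integrable (Er j \<Otimes>\<^sub>M Er k) (\<lambda>p. ln (1 + \<alpha> * fst p + c * snd p))"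
proof (rule integrable_Er_pairI)
  show "\<bar>ln (1 + \<alpha> * fst (x, y) + c * snd (x, y))\<bar> \<le> 1 + \<alpha> * x + c * y" if "x \<ge> 0" "y \<ge> 0" for x y
    using abs_ln_affine_le[of "1 + \<alpha> * x" c y] assms that by simp
qed measurable

lemma integrable_ln_mean_pair_slope:
  assumes "\<alpha> \<ge> 0" "c \<ge> 0"
  shows "integrable (Er j \<Otimes>\<^sub>M Er k) (\<lambda>p. 1 / (1 + \<alpha> * fst p + c * snd p))"
proof (rule integrable_Er_pairI)
  show "\<bar>1 / (1 + \<alpha> * fst (x, y) + c * snd (x, y))\<bar> \<le> 1 + 0 * x + 0 * y" if "x \<ge> 0" "y \<ge> 0" for x y
  proof -
    have "1 + \<alpha> * x + c * y \<ge> 1" using assms that by simp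
    then show ?thesis by simp
  qed
qed measurable

lemma ln_mean_pair_integral_fst:
  assumes "\<alpha> \<ge> 0" "c \<ge> 0"
  shows "(\<integral>x. (\<integral>y. ln ((1 + \<alpha> * x) + c * y) \<partial>Er k) \<partial>Er 0) = ln_mean_pair k \<alpha> c"
    and "(\<integral>y. (\<integral>x. ln ((1 + c * y) + \<alpha> * x) \<partial>Er 0) \<partial>Er k) = ln_mean_pair k \<alpha> c"
    and "integrable (Er 0) (\<lambda>x. \<integral>y. ln ((1 + \<alpha> * x) + c * y) \<partial>Er k)"
    and "integrable (Er k) (\<lambda>y. \<integral>x. ln ((1 + c * y) + \<alpha> * x) \<partial>Er 0)"
proof -
  interpret pair_prob_space "Er 0" "Er k" by (rule pair_prob_space_Er)
  interpret swap: pair_prob_space "Er k" "Er 0" by (rule pair_prob_space_Er)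
  note int = integrable_ln_mean_pair[OF assms, of 0 k]
  show "(\<integral>x. (\<integral>y. ln ((1 + \<alpha> * x) + c * y) \<partial>Er k) \<partial>Er 0) = ln_mean_pair k \<alpha> c"
    using integral_fst'[OF int] by (simp add: ln_mean_pair_def)
  show "integrable (Er 0) (\<lambda>x. \<integral>y. ln ((1 + \<alpha> * x) + c * y) \<partial>Er k)"
    using integrable_fst'[OF int] by simp
  have int': "integrable (Er 0 \<Otimes>\<^sub>M Er k) (\<lambda>(x, y). ln (1 + c * y + \<alpha> * x))"
    using int by (simp add: split_beta' add_ac)
  show "(\<integral>y. (\<integral>x. ln ((1 + c * y) + \<alpha> * x) \<partial>Er 0) \<partial>Er k) = ln_mean_pair k \<alpha> c"
    using integral_snd[OF int'] by (simp add: ln_mean_pair_def split_beta' add_ac)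
  show "integrable (Er k) (\<lambda>y. \<integral>x. ln ((1 + c * y) + \<alpha> * x) \<partial>Er 0)"
    using swap.integrable_fst'[of "\<lambda>(y, x). ln (1 + c * y + \<alpha> * x)"] integrable_product_swap[OF int']
    by (simp add: split_beta')
qed

lemma ln_mean_pair_slope_integral_fst:
  assumes "\<alpha> \<ge> 0" "c \<ge> 0"
  defines "D \<equiv> \<lambda>k. \<integral>p. 1 / (1 + \<alpha> * fst p + c * snd p) \<partial>(Er 0 \<Otimes>\<^sub>M Er k)"
  shows "(\<integral>x. (\<integral>y. c / ((1 + \<alpha> * x) + c * y) \<partial>Er k) \<partial>Er 0) = c * D k"
    and "(\<integral>y. (\<integral>x. \<alpha> / ((1 + c * y) + \<alpha> * x) \<partial>Er 0) \<partial>Er k) = \<alpha> * D k"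
    and "integrable (Er 0) (\<lambda>x. \<integral>y. c / ((1 + \<alpha> * x) + c * y) \<partial>Er k)"
    and "integrable (Er k) (\<lambda>y. \<integral>x. \<alpha> / ((1 + c * y) + \<alpha> * x) \<partial>Er 0)"
proof -
  interpret pair_prob_space "Er 0" "Er k" by (rule pair_prob_space_Er)
  interpret swap: pair_prob_space "Er k" "Er 0" by (rule pair_prob_space_Er)
  note int = integrable_mult_right[OF integrable_ln_mean_pair_slope[OF assms(1,2), of 0 k]]
  show "(\<integral>x. (\<integral>y. c / ((1 + \<alpha> * x) + c * y) \<partial>Er k) \<partial>Er 0) = c * D k"
    unfolding D_def integral_mult_right_zero[symmetric]
    using integral_fst'[OF int[of c]] by simp
  show "integrable (Er 0) (\<lambda>x. \<integral>y. c / ((1 + \<alpha> * x) + c * y) \<partial>Er k)"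
    using integrable_fst'[OF int[of c]] by simp
  have int': "integrable (Er 0 \<Otimes>\<^sub>M Er k) (\<lambda>(x, y). \<alpha> / (1 + c * y + \<alpha> * x))"
    using int[of \<alpha>] by (simp add: split_beta' add_ac)
  show "(\<integral>y. (\<integral>x. \<alpha> / ((1 + c * y) + \<alpha> * x) \<partial>Er 0) \<partial>Er k) = \<alpha> * D k"
    unfolding D_def integral_mult_right_zero[symmetric]
    using integral_snd[OF int'] by (simp add: split_beta' add_ac)
  show "integrable (Er k) (\<lambda>y. \<integral>x. \<alpha> / ((1 + c * y) + \<alpha> * x) \<partial>Er 0)"
    using swap.integrable_fst'[of "\<lambda>(y, x). \<alpha> / (1 + c * y + \<alpha> * x)"] integrable_product_swap[OF int']
    by (simp add: split_beta')
qed

section \<open>Elimination between the two integrations by parts\<close>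

definition ln_mean :: "nat \<Rightarrow> real \<Rightarrow> real" where
  "ln_mean k c = (\<integral>y. ln (1 + c * y) \<partial>Er k)"

lemma ln_mean_pair_diff_Suc:
  assumes "\<alpha> \<ge> 0" "c \<ge> 0"
  shows "ln_mean_pair (Suc k) \<alpha> c - ln_mean_pair k \<alpha> c = c * (\<integral>p. 1 / (1 + \<alpha> * fst p + c * snd p) \<partial>(Er 0 \<Otimes>\<^sub>M Er (Suc k)))"
proof -
  have "ln_mean_pair (Suc k) \<alpha> c - ln_mean_pair k \<alpha> c =
     (\<integral>x. (\<integral>y. ln ((1 + \<alpha> * x) + c * y) \<partial>Er (Suc k)) - (\<integral>y. ln ((1 + \<alpha> * x) + c * y) \<partial>Er k) \<partial>Er 0)"
    using assms by (subst Bochner_Integration.integral_diff) (simp_all add: ln_mean_pair_integral_fst)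
  also have "\<dots> = (\<integral>x. (\<integral>y. c / ((1 + \<alpha> * x) + c * y) \<partial>Er (Suc k)) \<partial>Er 0)"
  proof (rule integral_cong_AE)
    show "AE x in Er 0. (\<integral>y. ln ((1 + \<alpha> * x) + c * y) \<partial>Er (Suc k)) - (\<integral>y. ln ((1 + \<alpha> * x) + c * y) \<partial>Er k)
        = (\<integral>y. c / ((1 + \<alpha> * x) + c * y) \<partial>Er (Suc k))"
      using AE_Er_nonneg by eventually_elim (intro Er_by_parts, use assms in auto)
  qed (intro borel_measurable_integrable Bochner_Integration.integrable_diff ln_mean_pair_integral_fst
      ln_mean_pair_slope_integral_fst integrable_Er_ln assms order_refl)+
  also have "\<dots> = c * (\<integral>p. 1 / (1 + \<alpha> * fst p + c * snd p) \<partial>(Er 0 \<Otimes>\<^sub>M Er (Suc k)))"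
    by (rule ln_mean_pair_slope_integral_fst[OF assms])
  finally show ?thesis .
qed

text \<open>Parts in \<open>Y\<close> at the lowest shape: the boundary term is
  \<open>ln (1 + \<alpha> * x)\<close>, so the end of the recursion involves \<open>X\<close>
  alone.\<close>

lemma ln_mean_pair_diff_0:
  assumes "\<alpha> \<ge> 0" "c \<ge> 0"
  shows "ln_mean_pair 0 \<alpha> c - ln_mean 0 \<alpha> = c * (\<integral>p. 1 / (1 + \<alpha> * fst p + c * snd p) \<partial>(Er 0 \<Otimes>\<^sub>M Er 0))"
proof -
  have "ln_mean_pair 0 \<alpha> c - ln_mean 0 \<alpha> =
     (\<integral>x. (\<integral>y. ln ((1 + \<alpha> * x) + c * y) \<partial>Er 0) - ln (1 + \<alpha> * x) \<partial>Er 0)"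
    using assms integrable_Er_ln[of 1 \<alpha> 0]
    by (subst Bochner_Integration.integral_diff) (simp_all add: ln_mean_pair_integral_fst ln_mean_def)
  also have "\<dots> = (\<integral>x. (\<integral>y. c / ((1 + \<alpha> * x) + c * y) \<partial>Er 0) \<partial>Er 0)"
  proof (rule integral_cong_AE)
    show "AE x in Er 0. (\<integral>y. ln ((1 + \<alpha> * x) + c * y) \<partial>Er 0) - ln (1 + \<alpha> * x)
        = (\<integral>y. c / ((1 + \<alpha> * x) + c * y) \<partial>Er 0)"
      using AE_Er_nonneg by eventually_elim (intro Er_by_parts, use assms in auto)
  qed (intro borel_measurable_integrable Bochner_Integration.integrable_diff ln_mean_pair_integral_fst
      ln_mean_pair_slope_integral_fst integrable_Er_ln assms order_refl)+
  also have "\<dots> = c * (\<integral>p. 1 / (1 + \<alpha> * fst p + c * snd p) \<partial>(Er 0 \<Otimes>\<^sub>M Er 0))"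
    by (rule ln_mean_pair_slope_integral_fst[OF assms])
  finally show ?thesis .
qed

text \<open>Parts in \<open>X\<close>. The integral of the reciprocal is the one that parts in
  \<open>Y\<close> produces, so the two identities can be played off against each other.\<close>

lemma ln_mean_pair_diff_ln_mean:
  assumes "\<alpha> \<ge> 0" "c \<ge> 0"
  shows "ln_mean_pair k \<alpha> c - ln_mean k c = \<alpha> * (\<integral>p. 1 / (1 + \<alpha> * fst p + c * snd p) \<partial>(Er 0 \<Otimes>\<^sub>M Er k))"
proof -
  have "ln_mean_pair k \<alpha> c - ln_mean k c =
     (\<integral>y. (\<integral>x. ln ((1 + c * y) + \<alpha> * x) \<partial>Er 0) - ln (1 + c * y) \<partial>Er k)"
    using assms integrable_Er_ln[of 1 c k]
    by (subst Bochner_Integration.integral_diff) (simp_all add: ln_mean_pair_integral_fst ln_mean_def)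
  also have "\<dots> = (\<integral>y. (\<integral>x. \<alpha> / ((1 + c * y) + \<alpha> * x) \<partial>Er 0) \<partial>Er k)"
  proof (rule integral_cong_AE)
    show "AE y in Er k. (\<integral>x. ln ((1 + c * y) + \<alpha> * x) \<partial>Er 0) - ln (1 + c * y)
        = (\<integral>x. \<alpha> / ((1 + c * y) + \<alpha> * x) \<partial>Er 0)"
      using AE_Er_nonneg by eventually_elim (intro Er_by_parts, use assms in auto)
  qed (intro borel_measurable_integrable Bochner_Integration.integrable_diff ln_mean_pair_integral_fst
      ln_mean_pair_slope_integral_fst integrable_Er_ln assms order_refl)+
  also have "\<dots> = \<alpha> * (\<integral>p. 1 / (1 + \<alpha> * fst p + c * snd p) \<partial>(Er 0 \<Otimes>\<^sub>M Er k))"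
    by (rule ln_mean_pair_slope_integral_fst[OF assms])
  finally show ?thesis .
qed

lemma ln_mean_pair_0_left: "c \<ge> 0 \<Longrightarrow> ln_mean_pair k 0 c = ln_mean k c"
  using ln_mean_pair_diff_ln_mean[of 0 c k] by simp

text \<open>Eliminating the common integral gives \<open>b * ln_mean_pair (Suc k) = (\<alpha> + b) *
  ln_mean (Suc k) - \<alpha> * ln_mean_pair k\<close>, with the slopes suppressed. Each descent in
  \<open>k\<close> costs a factor \<open>- \<alpha> / b\<close>, where \<open>b\<close> is the gap
  between the slopes.\<close>

lemma ln_mean_pair_expansion:
  assumes "\<alpha> \<ge> 0" "b > 0"
  shows "ln_mean_pair k \<alpha> (\<alpha> + b) =
    (\<Sum>p\<le>k. (- \<alpha> / b) ^ p * ((\<alpha> + b) / b) * ln_mean (k - p) (\<alpha> + b)) + (- \<alpha> / b) ^ Suc k * ln_mean 0 \<alpha>"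
proof (induction k)
  case 0
  have "\<alpha> * (ln_mean_pair 0 \<alpha> (\<alpha> + b) - ln_mean 0 \<alpha>) = (\<alpha> + b) * (ln_mean_pair 0 \<alpha> (\<alpha> + b) - ln_mean 0 (\<alpha> + b))"
    using ln_mean_pair_diff_0[of \<alpha> "\<alpha> + b"] ln_mean_pair_diff_ln_mean[of \<alpha> "\<alpha> + b" 0] assms by simp
  then have "b * ln_mean_pair 0 \<alpha> (\<alpha> + b) = (\<alpha> + b) * ln_mean 0 (\<alpha> + b) - \<alpha> * ln_mean 0 \<alpha>"
    by (simp add: algebra_simps)
  then have "(b * ln_mean_pair 0 \<alpha> (\<alpha> + b)) / b = (\<alpha> + b) / b * ln_mean 0 (\<alpha> + b) + (- \<alpha> / b) * ln_mean 0 \<alpha>"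
    by (simp only: diff_divide_distrib) simp
  then have "ln_mean_pair 0 \<alpha> (\<alpha> + b) = (\<alpha> + b) / b * ln_mean 0 (\<alpha> + b) + (- \<alpha> / b) * ln_mean 0 \<alpha>"
    using assms by simp
  then show ?case by simp
next
  case (Suc k)
  have "\<alpha> * (ln_mean_pair (Suc k) \<alpha> (\<alpha> + b) - ln_mean_pair k \<alpha> (\<alpha> + b)) = (\<alpha> + b) * (ln_mean_pair (Suc k) \<alpha> (\<alpha> + b) - ln_mean (Suc k) (\<alpha> + b))"
    using ln_mean_pair_diff_Suc[of \<alpha> "\<alpha> + b" k] ln_mean_pair_diff_ln_mean[of \<alpha> "\<alpha> + b" "Suc k"] assms by simp
  then have "b * ln_mean_pair (Suc k) \<alpha> (\<alpha> + b) = (\<alpha> + b) * ln_mean (Suc k) (\<alpha> + b) - \<alpha> * ln_mean_pair k \<alpha> (\<alpha> + b)"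
    by (simp add: algebra_simps)
  then have "(b * ln_mean_pair (Suc k) \<alpha> (\<alpha> + b)) / b = (\<alpha> + b) / b * ln_mean (Suc k) (\<alpha> + b) + (- \<alpha> / b) * ln_mean_pair k \<alpha> (\<alpha> + b)"
    by (simp only: diff_divide_distrib) simp
  then have "ln_mean_pair (Suc k) \<alpha> (\<alpha> + b) = (\<alpha> + b) / b * ln_mean (Suc k) (\<alpha> + b) + (- \<alpha> / b) * ln_mean_pair k \<alpha> (\<alpha> + b)"
    using assms by simp
  also have "\<dots> = ((\<alpha> + b) / b * ln_mean (Suc k) (\<alpha> + b)
      + (\<Sum>p\<le>k. (- \<alpha> / b) ^ Suc p * ((\<alpha> + b) / b) * ln_mean (Suc k - Suc p) (\<alpha> + b))) + (- \<alpha> / b) ^ Suc (Suc k) * ln_mean 0 \<alpha>"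
    unfolding Suc.IH by (simp only: distrib_left sum_distrib_left power_Suc mult.assoc diff_Suc_Suc add.assoc)
  also have "(\<alpha> + b) / b * ln_mean (Suc k) (\<alpha> + b)
      + (\<Sum>p\<le>k. (- \<alpha> / b) ^ Suc p * ((\<alpha> + b) / b) * ln_mean (Suc k - Suc p) (\<alpha> + b))
    = (\<Sum>p\<le>Suc k. (- \<alpha> / b) ^ p * ((\<alpha> + b) / b) * ln_mean (Suc k - p) (\<alpha> + b))"
    by (subst sum.atMost_Suc_shift) simp
  finally show ?case .
qed

section \<open>Averaging over the beamforming gain\<close>

abbreviation (input) exp_Ei :: "real \<Rightarrow> real" where
  "exp_Ei x \<equiv> exp x * Ei (- x)"

text \<open>Substitute \<open>x = 1 / (a * z)\<close>: the power \<open>j\<close> becomes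
  \<open>- j\<close>, and \<open>dz\<close> contributes \<open>x powi (- 2) / a\<close> up to sign,
  whence \<open>n = - j - 2\<close>. The endpoint \<open>z = 0\<close> corresponds to
  \<open>x\<close> at infinity.\<close>

lemma has_integral_tPsi:
  assumes a: "a > 0"
  shows "((\<lambda>z. (a * z) ^ j * exp_Ei (1 / (a * z))) has_integral tPsi (- int j - 2) (1 / a) / a) {0..1}"
proof -
  define n where "n = - int j - 2"
  \<comment> \<open>The value at 0 is set to the limit of \<open>F_int n\<close> at infinity; there
    the formula itself would evaluate \<open>1 / 0\<close> as 0.\<close>
  define G where "G = (\<lambda>z. if z = 0 then 0 else - F_int n (1 / (a * z)) / a)"
  have F_lim: "(F_int n \<longlongrightarrow> 0) at_top"
    using F_neg_tendsto by (simp add: F_int_def n_def)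
  have deriv: "(G has_real_derivative (a * z) ^ j * exp_Ei (1 / (a * z))) (at z)" if z: "z > 0" for z
  proof (rule has_field_derivative_transform_within_open[where S = "{0<..}"])
    have "((\<lambda>z. 1 / (a * z)) has_real_derivative - (1 / (a * z\<^sup>2))) (at z)"
      using a z by (auto intro!: derivative_eq_intros simp: power2_eq_square field_simps)
    from DERIV_chain2[OF DERIV_F_int this]
    have "((\<lambda>z. - F_int n (1 / (a * z)) / a) has_real_derivative
        - ((1 / (a * z)) powi n * exp_Ei (1 / (a * z)) * - (1 / (a * z\<^sup>2))) / a) (at z)"
      using a z by (intro DERIV_cdivide DERIV_minus) simp
    also have "(1 / (a * z)) powi n = (a * z) ^ j * (a * z) ^ 2"
      by (simp add: n_def power_int_def nat_add_distrib field_simps power2_eq_square)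
    finally show "((\<lambda>z. - F_int n (1 / (a * z)) / a) has_real_derivative (a * z) ^ j * exp_Ei (1 / (a * z))) (at z)"
      using a z by (simp add: power2_eq_square)
  qed (use z in \<open>auto simp: G_def\<close>)
  have "((\<lambda>z. (a * z) ^ j * exp_Ei (1 / (a * z))) has_integral (G 1 - G 0)) {0..1}"
  proof (rule fundamental_theorem_of_calculus_interior)
    show "(G has_vector_derivative (a * z) ^ j * exp_Ei (1 / (a * z))) (at z)" if "z \<in> {0<..<1}" for z
      using deriv[of z] that by (simp add: has_real_derivative_iff_has_vector_derivative)
    show "continuous_on {0..1} G"
      unfolding continuous_on_eq_continuous_within
    proof
      fix z :: real assume z: "z \<in> {0..1}"
      show "continuous (at z within {0..1}) G"
      proof (cases "z = 0")
        case False
        then show ?thesis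
          using z by (intro continuous_at_imp_continuous_within[OF DERIV_isCont[OF deriv]]) auto
      next
        case True
        have "filterlim (\<lambda>z. inverse a * inverse z) at_top (at_right 0)"
          using a by (intro filterlim_tendsto_pos_mult_at_top[OF tendsto_const] filterlim_inverse_at_top_right) auto
        then have "filterlim (\<lambda>z. inverse (a * z)) at_top (at_right 0)"
          by simp
        then have "((\<lambda>z. - F_int n (inverse (a * z)) / a) \<longlongrightarrow> - 0 / a) (at_right 0)"
          using a by (intro tendsto_divide tendsto_minus tendsto_const filterlim_compose[OF F_lim]) simp_all
        moreover have "\<forall>\<^sub>F z in at_right 0. G z = - F_int n (inverse (a * z)) / a"
          by (auto simp: eventually_at_filter G_def inverse_eq_divide)
        ultimately have "(G \<longlongrightarrow> 0) (at_right 0)"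
          by (subst tendsto_cong) simp_all
        moreover have "at (0::real) within {0..1} = at_right 0"
          by (rule at_within_Icc_at_right) simp
        ultimately show ?thesis
          unfolding True continuous_within by (simp add: G_def)
      qed
    qed
  qed simp
  also have "G 1 - G 0 = tPsi n (1 / a) / a"
    by (simp add: G_def tPsi_eq n_def)
  finally show ?thesis by (simp add: n_def)
qed

text \<open>Here \<open>x = 1 / (a * z + b)\<close> decreases from \<open>1 / b\<close> to
  \<open>1 / (a + b)\<close>, which fixes the order of the arguments of \<open>Psi\<close>; the 2 in
  the exponent is again the contribution of \<open>dz\<close>.\<close>

lemma has_integral_Psi:
  assumes a: "a > 0" and b: "b > 0"
  shows "((\<lambda>z. (1 / (a * z + b)) powi (n + 2) * exp_Ei (1 / (a * z + b))) has_integral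
    Psi n (1 / (a + b)) (1 / b) / a) {0..1}"
proof -
  define G where "G = (\<lambda>z. - F_int n (1 / (a * z + b)) / a)"
  have "((\<lambda>z. (1 / (a * z + b)) powi (n + 2) * exp_Ei (1 / (a * z + b))) has_integral (G 1 - G 0)) {0..1}"
  proof (rule fundamental_theorem_of_calculus)
    fix z :: real assume "z \<in> {0..1}"
    then have w: "a * z + b > 0"
      using a b by (intro add_nonneg_pos) auto
    have "((\<lambda>z. 1 / (a * z + b)) has_real_derivative - (a * (1 / (a * z + b)) ^ 2)) (at z)"
      using w by (auto intro!: derivative_eq_intros simp: power2_eq_square field_simps)
    from DERIV_chain2[OF DERIV_F_int this]
    have "(G has_real_derivative
        - ((1 / (a * z + b)) powi n * exp_Ei (1 / (a * z + b)) * - (a * (1 / (a * z + b)) ^ 2)) / a) (at z)"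
      unfolding G_def using w by (intro DERIV_cdivide DERIV_minus) simp
    also have "- ((1 / (a * z + b)) powi n * exp_Ei (1 / (a * z + b)) * - (a * (1 / (a * z + b)) ^ 2)) / a
        = (1 / (a * z + b)) powi (n + 2) * exp_Ei (1 / (a * z + b))"
      using a w by (simp add: power_int_add)
    finally show "(G has_vector_derivative (1 / (a * z + b)) powi (n + 2) * exp_Ei (1 / (a * z + b))) (at z within {0..1})"
      by (simp add: has_real_derivative_iff_has_vector_derivative has_vector_derivative_at_within)
  qed simp
  also have "G 1 - G 0 = Psi n (1 / (a + b)) (1 / b) / a"
    using a b by (simp add: G_def Psi_eq diff_divide_distrib)
  finally show ?thesis .
qed

text \<open>Euler's integral with third parameter one above the second: the weight
  \<open>1 - x\<close> has exponent 0, and the Gamma quotient reduces to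
  \<open>j + 1\<close>.\<close>

lemma has_integral_hyp2F1:
  assumes a: "a > 0" and b: "b > 0"
  shows "((\<lambda>z. z ^ j * (a * z + b) powi (1 - int s)) has_integral
    hyp2F1 (real s - 1) (real (j + 1)) (real (j + 2)) (- a / b) / (b powi (int s - 1) * real (j + 1))) {0..1}"
proof -
  let ?f = "\<lambda>x. x powr (real (j + 1) - 1) * (1 - x) powr (real (j + 2) - real (j + 1) - 1) * (1 - - a / b * x) powr - (real s - 1)"
  let ?g = "\<lambda>x. x ^ j * (1 + a / b * x) powr (1 - real s)"
  have pos: "1 + a / b * x > 0" if "x \<in> {0..1}" for x
    using a b that by (intro add_pos_nonneg) auto
  have "continuous_on {0..1} ?g"
    using pos by (intro continuous_intros) force+
  then have g: "set_integrable lborel {0..1} ?g"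
    by (rule borel_integrable_atLeastAtMost')
  have "(LINT x:{0..1}|lborel. ?f x) = (LINT x:{0..1}|lborel. ?g x)"
  proof (rule set_lebesgue_integral_cong_AE)
    \<comment> \<open>Equality can fail at the endpoints because \<open>0 powr 0\<close> is 0 while
      \<open>0 ^ 0\<close> is 1.\<close>
    show "AE x in lborel. x \<in> {0..1} \<longrightarrow> ?f x = ?g x"
      using AE_lborel_singleton[of 0] AE_lborel_singleton[of 1]
    proof eventually_elim
      case (elim x)
      then show ?case
        using elim by (auto simp: powr_realpow)
    qed
  qed measurable
  also have "\<dots> = integral {0..1} ?g"
    by (rule set_borel_integral_eq_integral[OF g])
  finally have "hyp2F1 (real s - 1) (real (j + 1)) (real (j + 2)) (- a / b) = real (j + 1) * integral {0..1} ?g"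
    unfolding hyp2F1_def using Gamma_fact[of "j + 1", where ?'a = real] Gamma_fact[of j, where ?'a = real]
    by (simp add: add_ac)
  then have "(?g has_integral hyp2F1 (real s - 1) (real (j + 1)) (real (j + 2)) (- a / b) / real (j + 1)) {0..1}"
    using set_borel_integral_eq_integral(1)[OF g] by (simp add: has_integral_integral del: of_nat_add)
  from has_integral_mult_right[OF this, of "b powi (1 - int s)"]
  have "((\<lambda>z. z ^ j * (a * z + b) powi (1 - int s)) has_integral
    b powi (1 - int s) * (hyp2F1 (real s - 1) (real (j + 1)) (real (j + 2)) (- a / b) / real (j + 1))) {0..1}"
  proof (rule has_integral_eq[rotated])
    fix x :: real assume "x \<in> {0..1}"
    then have "(1 + a / b * x) powr (1 - real s) = (1 + a / b * x) powi (1 - int s)"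
      using powr_real_of_int'[of "1 + a / b * x" "1 - int s"] pos[of x] by simp
    moreover have "a * x + b = b * (1 + a / b * x)" using b by (simp add: field_simps)
    ultimately show "b powi (1 - int s) * ?g x = x ^ j * (a * x + b) powi (1 - int s)"
      by (simp only: power_int_mult_distrib mult_ac)
  qed
  moreover have "b powi (1 - int s) = inverse (b powi (int s - 1))"
    using power_int_minus[of b "int s - 1"] by simp
  ultimately show ?thesis
    by (simp add: divide_inverse mult_ac)
qed

lemma one_minus_power_expansion:
  fixes z :: real
  shows "(1 - z) ^ m = (\<Sum>t=0..m. real (m choose t) * (-1) ^ t * z ^ t)"
proof -
  have "(1 - z) ^ m = (- z + 1) ^ m" by simp
  also have "\<dots> = (\<Sum>t\<le>m. real (m choose t) * (- z) ^ t * 1 ^ (m - t))"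
    by (rule binomial_ring)
  also have "\<dots> = (\<Sum>t=0..m. real (m choose t) * (-1) ^ t * z ^ t)"
    by (intro sum.cong) (auto simp: power_minus[of z])
  finally show ?thesis .
qed

text \<open>After the binomial expansion, \<open>z ^ t = (a * z) ^ t / a ^ t\<close> brings every
  summand into the form of \<open>has_integral_tPsi\<close> with
  \<open>j = t + (M - 1)\<close>.\<close>

lemma has_integral_I1:
  assumes a: "a > 0" and M: "M \<ge> 2"
  shows "((\<lambda>z. (1 - z) ^ (M - 2) * ((a * z) ^ (M - 1) * exp_Ei (1 / (a * z)))) has_integral I1 M a) {0..1}"
proof -
  have "((\<lambda>z. \<Sum>t=0..M-2. real (M - 2 choose t) * (-1)^t / a ^ t * ((a * z) ^ (t + (M - 1)) * exp_Ei (1 / (a * z)))) has_integral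
     (\<Sum>t=0..M-2. real (M - 2 choose t) * (-1)^t / a ^ t * (tPsi (- int (t + (M - 1)) - 2) (1 / a) / a))) {0..1}"
    by (intro has_integral_sum has_integral_mult_right has_integral_tPsi a) simp
  moreover have "(\<Sum>t=0..M-2. real (M - 2 choose t) * (-1)^t / a ^ t * (tPsi (- int (t + (M - 1)) - 2) (1 / a) / a)) = I1 M a"
  proof -
    have "- int (t + (M - 1)) - 2 = - int M - 1 - int t" for t
      using M by simp
    then show ?thesis
      unfolding I1_def by (simp only:) (simp add: mult_ac)
  qed
  moreover have "(\<Sum>t=0..M-2. real (M - 2 choose t) * (-1)^t / a ^ t * ((a * z) ^ (t + (M - 1)) * exp_Ei (1 / (a * z))))
      = (1 - z) ^ (M - 2) * ((a * z) ^ (M - 1) * exp_Ei (1 / (a * z)))" for z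
    unfolding one_minus_power_expansion sum_distrib_right using a
    by (intro sum.cong) (simp_all add: power_add power_mult_distrib)
  ultimately show ?thesis by simp
qed

text \<open>Two binomial expansions are needed since \<open>Psi\<close> integrates functions of
  \<open>w = a * z + b\<close> only: \<open>(1 - z) ^ (M - 2)\<close> yields powers of
  \<open>z\<close>, and \<open>(a * z) ^ (p - 1 + r)\<close> is then expanded as a power of
  \<open>w - b\<close>. The exponent of \<open>1 / w\<close> is \<open>q - 2 - t\<close>, so
  \<open>n = q - 4 - t\<close>.\<close>

lemma has_integral_I2:
  assumes a: "a > 0" and b: "b > 0" and p: "p \<ge> 1" and q: "q \<ge> 1"
  shows "((\<lambda>z. (1 - z) ^ (M - 2) * (a * z) ^ (p - 1) * (a * z + b) *
      ((1 / (a * z + b)) ^ (q - 1) * exp_Ei (1 / (a * z + b)))) has_integral I2 M a b p q) {0..1}"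
proof -
  let ?C = "\<lambda>r t. real (M - 2 choose r) * (-1) ^ r / a ^ r * (real (p - 1 + r choose t) * (- b) ^ (p - 1 + r - t))"
  have "((\<lambda>z. \<Sum>r=0..M-2. \<Sum>t=0..p-1+r. ?C r t * ((1 / (a * z + b)) powi ((int q - 4 - int t) + 2) * exp_Ei (1 / (a * z + b)))) has_integral
     (\<Sum>r=0..M-2. \<Sum>t=0..p-1+r. ?C r t * (Psi (int q - 4 - int t) (1 / (a + b)) (1 / b) / a))) {0..1}"
    by (intro has_integral_sum has_integral_mult_right has_integral_Psi a b) simp_all
  moreover have "(\<Sum>r=0..M-2. \<Sum>t=0..p-1+r. ?C r t * (Psi (int q - 4 - int t) (1 / (a + b)) (1 / b) / a)) = I2 M a b p q"
  proof -
    \<comment> \<open>The signs of the two expansions merge since \<open>2 * r\<close> is even;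
      \<open>p - 1 - t\<close> may be negative, hence \<open>powi\<close>.\<close>
    have "(-1) ^ r * (- b) ^ (p - 1 + r - t) = (-1) powi (int p - 1 - int t) * b ^ (p - 1 + r - t)"
      if "t \<le> p - 1 + r" for r t
    proof -
      have "(-1::real) ^ r * (-1) ^ (p - 1 + r - t) = (-1) powi (int r + int (p - 1 + r - t))"
        by (simp add: power_int_add)
      also have "int r + int (p - 1 + r - t) = (int p - 1 - int t) + 2 * int r"
        using that p by simp
      also have "(-1::real) powi \<dots> = (-1) powi (int p - 1 - int t)"
        by (subst power_int_add) (simp_all add: power_int_mult)
      finally show ?thesis
        by (simp add: power_minus[of b] mult.assoc[symmetric])
    qed
    note sgn = this
    have "?C r t * (X / a) = real (M - 2 choose r) * real (p - 1 + r choose t) * ((-1) ^ r * (- b) ^ (p - 1 + r - t)) / a ^ (r + 1) * X"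
      for r t X
      by (simp add: mult_ac)
    then have "?C r t * (X / a) = real (M - 2 choose r) * real (p - 1 + r choose t) * (-1) powi (int p - 1 - int t)
        * b ^ (p - 1 + r - t) / a ^ (r + 1) * X" if "t \<le> p - 1 + r" for r t X
      by (simp only: sgn[OF that] mult.assoc)
    note coeff = this
    show ?thesis
      unfolding I2_def by (intro sum.cong refl coeff) simp
  qed
  ultimately have "((\<lambda>z. \<Sum>r=0..M-2. \<Sum>t=0..p-1+r. ?C r t * ((1 / (a * z + b)) powi ((int q - 4 - int t) + 2) * exp_Ei (1 / (a * z + b)))) has_integral
     I2 M a b p q) {0..1}" by simp
  then show ?thesis
  proof (rule has_integral_eq[rotated])
    fix z :: real assume z: "z \<in> {0..1}"
    define w where "w = a * z + b"
    have w: "w > 0"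
      unfolding w_def using a b z by (intro add_nonneg_pos) auto
    have pw: "(1 / w) powi ((int q - 4 - int t) + 2) = w ^ t * (w * (1 / w) ^ (q - 1))" for t
    proof -
      have *: "(int q - 4 - int t) + 2 = int (q - 1) - int (Suc t)" using q by simp
      have "(1 / w) powi ((int q - 4 - int t) + 2) = (1 / w) ^ (q - 1) / ((1 / w) * (1 / w) ^ t)"
        unfolding * using w by (subst power_int_diff) (simp_all only: power_int_of_nat power_Suc, simp)
      moreover have "X / ((1 / w) * (1 / w) ^ t) = w ^ t * (w * X)" for X
        by (simp add: power_one_over)
      ultimately show ?thesis by simp
    qed
    have bin: "(\<Sum>t=0..P. real (P choose t) * (- b) ^ (P - t) * w ^ t) = (a * z) ^ P" for P
    proof -
      have "(w + - b) ^ P = (\<Sum>t\<le>P. real (P choose t) * w ^ t * (- b) ^ (P - t))"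
        by (rule binomial_ring)
      then show ?thesis by (simp add: w_def atMost_atLeast0 mult_ac)
    qed
    have "(\<Sum>r=0..M-2. \<Sum>t=0..p-1+r. ?C r t * ((1 / w) powi ((int q - 4 - int t) + 2) * exp_Ei (1 / w)))
      = (\<Sum>r=0..M-2. real (M - 2 choose r) * (-1) ^ r / a ^ r * (\<Sum>t=0..p-1+r. real (p - 1 + r choose t) * (- b) ^ (p - 1 + r - t) * w ^ t))
        * (w * ((1 / w) ^ (q - 1) * exp_Ei (1 / w)))"
      unfolding pw sum_distrib_left sum_distrib_right by (intro sum.cong refl) (simp only: mult_ac times_divide_eq_left times_divide_eq_right)
    also have "(\<Sum>r=0..M-2. real (M - 2 choose r) * (-1) ^ r / a ^ r * (\<Sum>t=0..p-1+r. real (p - 1 + r choose t) * (- b) ^ (p - 1 + r - t) * w ^ t))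
      = (\<Sum>r=0..M-2. real (M - 2 choose r) * (-1) ^ r * z ^ r) * (a * z) ^ (p - 1)"
      unfolding bin sum_distrib_right using a
      by (intro sum.cong refl) (simp add: power_add power_mult_distrib)
    finally show "(\<Sum>r=0..M-2. \<Sum>t=0..p-1+r. ?C r t * ((1 / (a * z + b)) powi ((int q - 4 - int t) + 2) * exp_Ei (1 / (a * z + b))))
      = (1 - z) ^ (M - 2) * (a * z) ^ (p - 1) * (a * z + b) * ((1 / (a * z + b)) ^ (q - 1) * exp_Ei (1 / (a * z + b)))"
      unfolding one_minus_power_expansion w_def[symmetric] by (simp only: mult.assoc)
  qed
qed

text \<open>Without a factor \<open>Ei\<close>, monomials in \<open>z\<close> times a power of
  \<open>a * z + b\<close> are covered by Euler's integral, so a single expansion suffices.\<close>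

lemma has_integral_I3:
  assumes a: "a > 0" and b: "b > 0" and p: "p \<ge> 1"
  shows "((\<lambda>z. (1 - z) ^ (M - 2) * (a * z) ^ (p - 1) * (a * z + b) * (1 / (a * z + b)) ^ s) has_integral I3 M a b p s) {0..1}"
proof -
  let ?C = "\<lambda>t. real (M - 2 choose t) * (-1) ^ t * a ^ (p - 1)"
  have "((\<lambda>z. \<Sum>t=0..M-2. ?C t * (z ^ (p - 1 + t) * (a * z + b) powi (1 - int s))) has_integral
     (\<Sum>t=0..M-2. ?C t * (hyp2F1 (real s - 1) (real (p - 1 + t + 1)) (real (p - 1 + t + 2)) (- a / b)
        / (b powi (int s - 1) * real (p - 1 + t + 1))))) {0..1}"
    by (intro has_integral_sum has_integral_mult_right has_integral_hyp2F1 a b) simp_all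
  moreover have "p - 1 + t + 1 = p + t" "p - 1 + t + 2 = p + t + 1" for t
    using p by simp_all
  ultimately have "((\<lambda>z. \<Sum>t=0..M-2. ?C t * (z ^ (p - 1 + t) * (a * z + b) powi (1 - int s))) has_integral I3 M a b p s) {0..1}"
    by (simp add: I3_def)
  then show ?thesis
  proof (rule has_integral_eq[rotated])
    fix z :: real assume z: "z \<in> {0..1}"
    have w: "a * z + b > 0"
      using a b z by (intro add_nonneg_pos) auto
    have "(a * z + b) powi (1 - int s) = (a * z + b) * (1 / (a * z + b)) ^ s"
      using w by (simp add: power_int_diff power_one_over)
    then show "(\<Sum>t=0..M-2. ?C t * (z ^ (p - 1 + t) * (a * z + b) powi (1 - int s)))
        = (1 - z) ^ (M - 2) * (a * z) ^ (p - 1) * (a * z + b) * (1 / (a * z + b)) ^ s"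
      unfolding one_minus_power_expansion sum_distrib_right
      by (intro sum.cong refl) (simp only: power_add power_mult_distrib mult_ac)
  qed
qed

text \<open>The truncated difference \<open>q - 2 - s\<close> is harmless: at \<open>q = 1\<close>
  the inner sum is empty.\<close>

lemma ln_mean_eq:
  assumes "c > 0"
  shows "ln_mean k c = (\<Sum>q=1..Suc k. (- ((- (1 / c)) ^ (q - 1) * exp_Ei (1 / c)) + (\<Sum>s<q-1. fact (q - 2 - s) * (- (1 / c)) ^ s)) / fact (q - 1))"
  unfolding ln_mean_def integral_Er_ln[OF assms]
proof (rule sum.cong[OF refl])
  fix q assume "q \<in> {1..Suc k}"
  then obtain q' where q': "q = Suc q'" by (cases q) auto
  have "exp (1 / c) * En q (1 / c) = (fact q' * (exp (1 / c) * En (Suc q') (1 / c))) / fact q'"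
    by (simp add: q')
  then show "exp (1 / c) * En q (1 / c) =
    (- ((- (1 / c)) ^ (q - 1) * exp_Ei (1 / c)) + (\<Sum>s<q-1. fact (q - 2 - s) * (- (1 / c)) ^ s)) / fact (q - 1)"
    unfolding En_closed_form[OF zero_less_divide_1_iff[THEN iffD2, OF assms]] by (simp add: q' numeral_2_eq_2)
qed

text \<open>The weight is the density of \<open>Z\<close>, and the slopes \<open>a * z\<close> and
  \<open>a * z + b\<close> have gap \<open>b\<close> for every \<open>z\<close>. In
  \<open>ln_mean_pair_expansion\<close> the last term gives \<open>I1\<close>, while each
  \<open>ln_mean\<close> splits into an \<open>Ei\<close> part for \<open>I2\<close> and a finite
  part for \<open>I3\<close>.\<close>

lemma has_integral_Theta:
  assumes a: "a > 0" and b: "b > 0" and M: "M \<ge> 2"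
  shows "((\<lambda>z. real (M - 1) * (1 - z) ^ (M - 2) * ln_mean_pair (M - 2) (a * z) (a * z + b)) has_integral Theta M a b * ln 2) {0..1}"
proof -
  define A where "A = (\<lambda>z. (1 - z) ^ (M - 2) * ((a * z) ^ (M - 1) * exp_Ei (1 / (a * z))))"
  define Bq where "Bq = (\<lambda>p q z. (1 - z) ^ (M - 2) * (a * z) ^ (p - 1) * (a * z + b) * ((1 / (a * z + b)) ^ (q - 1) * exp_Ei (1 / (a * z + b))))"
  define C where "C = (\<lambda>p s z. (1 - z) ^ (M - 2) * (a * z) ^ (p - 1) * (a * z + b) * (1 / (a * z + b)) ^ s)"
  have log: "log 2 (exp 1) = 1 / ln 2" by (simp add: log_def)
  have "((\<lambda>z. (-1)^M * real (M - 1) / b ^ (M - 1) * A z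
     + (\<Sum>p=1..M-1. \<Sum>q=1..M-p. (-1)^(p + q + 1) * real (M - 1) / (fact (q - 1) * b ^ p) * Bq p q z)
     + (\<Sum>p=1..M-1. \<Sum>q=2..M-p. \<Sum>s=0..q-2.
          (-1)^(p + s - 1) * fact (q - s - 2) * real (M - 1) / (fact (q - 1) * b ^ p) * C p s z))
    has_integral
     ( (-1)^M * real (M - 1) / b ^ (M - 1) * I1 M a
     + (\<Sum>p=1..M-1. \<Sum>q=1..M-p. (-1)^(p + q + 1) * real (M - 1) / (fact (q - 1) * b ^ p) * I2 M a b p q)
     + (\<Sum>p=1..M-1. \<Sum>q=2..M-p. \<Sum>s=0..q-2.
          (-1)^(p + s - 1) * fact (q - s - 2) * real (M - 1) / (fact (q - 1) * b ^ p) * I3 M a b p s))) {0..1}"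
    unfolding A_def Bq_def C_def
    by (intro has_integral_add has_integral_sum has_integral_mult_right has_integral_I1 has_integral_I2 has_integral_I3 a b M) auto
  also have "( (-1)^M * real (M - 1) / b ^ (M - 1) * I1 M a
     + (\<Sum>p=1..M-1. \<Sum>q=1..M-p. (-1)^(p + q + 1) * real (M - 1) / (fact (q - 1) * b ^ p) * I2 M a b p q)
     + (\<Sum>p=1..M-1. \<Sum>q=2..M-p. \<Sum>s=0..q-2.
          (-1)^(p + s - 1) * fact (q - s - 2) * real (M - 1) / (fact (q - 1) * b ^ p) * I3 M a b p s)) = Theta M a b * ln 2"
    unfolding Theta_def log by simp
  finally show ?thesis
  \<comment> \<open>The point 0 is set aside because the closed form of
    \<open>ln_mean 0 (a * z)\<close> requires a positive slope.\<close>
  proof (rule has_integral_spike_finite[of "{0}", rotated 2])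
    fix z :: real assume "z \<in> {0..1} - {0}"
    then have z: "z > 0" "z \<le> 1" by auto
    define w where "w = a * z + b"
    define x where "x = 1 / w"
    define m where "m = real (M - 1)"
    define u where "u = (1 - z) ^ (M - 2)"
    have w: "w > 0" unfolding w_def using a b z by (intro add_nonneg_pos) auto
    \<comment> \<open>Signs: \<open>p + q + 1\<close> has the parity of
      \<open>(p - 1) + (q - 1) + 1\<close>, with the last 1 from the minus sign before the
      \<open>Ei\<close> term; \<open>p + s - 1\<close> is \<open>(p - 1) + s\<close>.\<close>
    have q_term: "(-1)^(p + q + 1) * m / (fact (q - 1) * b ^ p) * Bq p q z
        + (\<Sum>s<q-1. (-1)^(p + s - 1) * fact (q - s - 2) * m / (fact (q - 1) * b ^ p) * C p s z)
        = m * u * ((- (a * z) / b) ^ (p - 1) * (w / b) *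
           ((- ((- x) ^ (q - 1) * exp_Ei x) + (\<Sum>s<q-1. fact (q - 2 - s) * (- x) ^ s)) / fact (q - 1)))"
      if pq: "p \<ge> 1" "q \<ge> 1" for p q
    proof -
      obtain p' q' where p': "p = Suc p'" and q': "q = Suc q'"
        using pq by (cases p; cases q) auto
      define y where "y = (a * z) ^ p'"
      have sgn: "(- (a * z) / b) ^ p' = (-1) ^ p' * y / b ^ p'"
        unfolding y_def by (simp only: power_divide power_minus[of "a * z"])
      have "(-1)^(p + q + 1) * m / (fact (q - 1) * b ^ p) * Bq p q z
         = m * u * ((- (a * z) / b) ^ (p - 1) * (w / b) * (- ((- x) ^ (q - 1) * exp_Ei x) / fact (q - 1)))"
        unfolding Bq_def w_def[symmetric] x_def[symmetric] u_def[symmetric] p' q' diff_Suc_1 sgn power_minus[of x]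
        by (simp add: y_def power_add mult_ac)
      moreover have "(-1)^(p + s - 1) * fact (q - s - 2) * m / (fact (q - 1) * b ^ p) * C p s z
         = m * u * ((- (a * z) / b) ^ (p - 1) * (w / b) * (fact (q - 2 - s) * (- x) ^ s / fact (q - 1)))" for s
      proof -
        have "q - s - 2 = q - 2 - s" "p + s - 1 = p' + s" by (simp_all add: p')
        then show ?thesis
          unfolding C_def w_def[symmetric] x_def[symmetric] u_def[symmetric] p' diff_Suc_1 sgn power_minus[of x]
          by (simp add: y_def power_add mult_ac)
      qed
      ultimately show ?thesis
        by (simp only: add_divide_distrib sum_divide_distrib distrib_left sum_distrib_left)
    qed
    have third: "(\<Sum>q=2..M-p. \<Sum>s=0..q-2. f q s) = (\<Sum>q=1..M-p. \<Sum>s<q-1. f q s)" for p and f :: "nat \<Rightarrow> nat \<Rightarrow> real"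
    proof (rule sum.mono_neutral_cong_left)
      show "\<forall>q\<in>{1..M-p} - {2..M-p}. (\<Sum>s<q-1. f q s) = 0"
      proof
        fix q assume "q \<in> {1..M-p} - {2..M-p}"
        then have "q = 1" by auto
        then show "(\<Sum>s<q-1. f q s) = 0" by simp
      qed
      show "(\<Sum>s=0..q-2. f q s) = (\<Sum>s<q-1. f q s)" if "q \<in> {2..M-p}" for q
        using that by (intro sum.cong) auto
    qed auto
    have "(\<Sum>p=1..M-1. \<Sum>q=1..M-p. (-1)^(p + q + 1) * m / (fact (q - 1) * b ^ p) * Bq p q z)
     + (\<Sum>p=1..M-1. \<Sum>q=2..M-p. \<Sum>s=0..q-2.
          (-1)^(p + s - 1) * fact (q - s - 2) * m / (fact (q - 1) * b ^ p) * C p s z)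
     = (\<Sum>p=1..M-1. m * u * ((- (a * z) / b) ^ (p - 1) * (w / b) * ln_mean (M - 1 - p) w))"
      unfolding third sum.distrib[symmetric]
    proof (rule sum.cong[OF refl])
      fix p assume p: "p \<in> {1..M-1}"
      then have "Suc (M - 1 - p) = M - p" by auto
      then show "(\<Sum>q=1..M-p. (-1)^(p + q + 1) * m / (fact (q - 1) * b ^ p) * Bq p q z
        + (\<Sum>s<q-1. (-1)^(p + s - 1) * fact (q - s - 2) * m / (fact (q - 1) * b ^ p) * C p s z))
        = m * u * ((- (a * z) / b) ^ (p - 1) * (w / b) * ln_mean (M - 1 - p) w)"
        unfolding ln_mean_eq[OF w] x_def[symmetric] sum_distrib_left using p
        by (intro sum.cong q_term) auto
    qed
    also have "\<dots> = (\<Sum>p\<le>M-2. m * u * ((- (a * z) / b) ^ p * (w / b) * ln_mean (M - 2 - p) w))"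
    proof -
      have "M - 1 = Suc (M - 2)" using M by simp
      moreover have "M - 1 - Suc p = M - 2 - p" for p by simp
      ultimately show ?thesis
        by (simp only: One_nat_def sum.atLeast1_atMost_eq diff_Suc_1 lessThan_Suc_atMost)
           (simp add: numeral_2_eq_2)
    qed
    \<comment> \<open>The end of the recursion carries \<open>M - 1\<close> signs, and
      \<open>ln_mean 0\<close> supplies one more.\<close>
    moreover have "(-1)^M * m / b ^ (M - 1) * A z = m * u * ((- (a * z) / b) ^ Suc (M - 2) * ln_mean 0 (a * z))"
    proof -
      have "ln_mean 0 (a * z) = - exp_Ei (1 / (a * z))"
        using a z by (subst ln_mean_eq) auto
      moreover have "Suc (M - 2) = M - 1" "M = Suc (M - 1)" using M by simp_all
      moreover have "(-1) ^ Suc (M - 1) * m / b ^ (M - 1) * A z = m * u * ((- (a * z) / b) ^ (M - 1) * - exp_Ei (1 / (a * z)))"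
        unfolding A_def u_def power_divide power_minus[of "a * z"] by (simp add: mult_ac)
      ultimately show ?thesis by metis
    qed
    ultimately have "(-1)^M * m / b ^ (M - 1) * A z +
     ((\<Sum>p=1..M-1. \<Sum>q=1..M-p. (-1)^(p + q + 1) * m / (fact (q - 1) * b ^ p) * Bq p q z)
     + (\<Sum>p=1..M-1. \<Sum>q=2..M-p. \<Sum>s=0..q-2.
          (-1)^(p + s - 1) * fact (q - s - 2) * m / (fact (q - 1) * b ^ p) * C p s z))
      = m * u * ln_mean_pair (M - 2) (a * z) w"
      using ln_mean_pair_expansion[of "a * z" b "M - 2"] a b z
      by (simp only: w_def sum_distrib_left distrib_left mult_nonneg_nonneg less_imp_le add.commute)
    then show "real (M - 1) * (1 - z) ^ (M - 2) * ln_mean_pair (M - 2) (a * z) (a * z + b) =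
      (-1)^M * real (M - 1) / b ^ (M - 1) * A z
     + (\<Sum>p=1..M-1. \<Sum>q=1..M-p. (-1)^(p + q + 1) * real (M - 1) / (fact (q - 1) * b ^ p) * Bq p q z)
     + (\<Sum>p=1..M-1. \<Sum>q=2..M-p. \<Sum>s=0..q-2.
          (-1)^(p + s - 1) * fact (q - s - 2) * real (M - 1) / (fact (q - 1) * b ^ p) * C p s z)"
      unfolding m_def u_def w_def by (simp only: add.assoc)
  qed simp
qed

section \<open>The quantized feedback model\<close>

text \<open>At \<open>m = M - 2\<close> this is the mean \<open>1 / (M - 1)\<close> of each
  interference gain, the origin of the divisor \<open>M - 1\<close> in \<open>c\<close>.\<close>

lemma beta1_expectation:
  assumes "m \<ge> 1"
  shows "(\<integral>v. beta1_density m v * v \<partial>lborel) = 1 / (real m + 1)"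
proof -
  have eq: "beta1_density m v * v = indicat_real {0..1} v *\<^sub>R (real m * (1 - v) ^ (m - 1) * v)" for v
    by (simp add: beta1_density_def indicator_def)
  define F where "F = (\<lambda>v::real. - (v * (1 - v) ^ m) - (1 - v) ^ Suc m / real (Suc m))"
  have "(LINT v:{0..1}|lborel. real m * (1 - v) ^ (m - 1) * v) = F 1 - F 0"
    unfolding set_lebesgue_integral_def
  proof (rule integral_FTC_atLeastAtMost)
    show "(F has_vector_derivative real m * (1 - v) ^ (m - 1) * v) (at v within {0..1})" for v
    proof -
      have *: "((\<lambda>v::real. (1 - v) ^ j) has_real_derivative - (real j * (1 - v) ^ (j - Suc 0))) (at v)" for j
      proof -
        have "((\<lambda>v::real. 1 - v) has_real_derivative 0 - 1) (at v)"
          by (intro DERIV_diff DERIV_const DERIV_ident)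
        from DERIV_power[OF this, of j] show ?thesis by (simp add: mult_ac)
      qed
      have "(F has_real_derivative - (1 * (1 - v) ^ m + - (real m * (1 - v) ^ (m - Suc 0)) * v)
          - - (real (Suc m) * (1 - v) ^ (Suc m - Suc 0)) / real (Suc m)) (at v)"
        unfolding F_def by (intro DERIV_diff DERIV_minus DERIV_cdivide DERIV_mult DERIV_ident *)
      then have "(F has_real_derivative real m * (1 - v) ^ (m - 1) * v) (at v)"
        by (simp del: of_nat_Suc)
      then show ?thesis
        by (simp add: has_real_derivative_iff_has_vector_derivative has_vector_derivative_at_within)
    qed
  qed (auto intro!: continuous_intros)
  also have "F 1 - F 0 = 1 / (real m + 1)"
    using assms by (simp add: F_def power_0_left)
  finally show ?thesis
    unfolding eq set_lebesgue_integral_def .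
qed

lemma borel_measurable_beta1_density [measurable]: "beta1_density m \<in> borel_measurable borel"
  unfolding beta1_density_def[abs_def] by measurable

lemma beta1_density_nonneg: "beta1_density m x \<ge> 0"
  by (simp add: beta1_density_def)

lemma (in prob_space) beta1_distributed:
  assumes X: "distributed M lborel X (\<lambda>v. ennreal (beta1_density m v))"
  shows "random_variable borel X" and "AE \<omega> in M. 0 \<le> X \<omega> \<and> X \<omega> \<le> 1"
    and "distr M borel X = density lborel (\<lambda>v. ennreal (beta1_density m v))"
proof -
  show meas: "random_variable borel X"
    using distributed_measurable[OF X] by simp
  show eq: "distr M borel X = density lborel (\<lambda>v. ennreal (beta1_density m v))"
    unfolding distributed_distr_eq_density[OF X, symmetric] by (rule distr_cong) simp_all
  have "AE v in density lborel (\<lambda>v. ennreal (beta1_density m v)). 0 \<le> v \<and> v \<le> 1"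
    by (subst AE_density) (auto simp: beta1_density_def)
  then show "AE \<omega> in M. 0 \<le> X \<omega> \<and> X \<omega> \<le> 1"
    unfolding eq[symmetric] using meas by (subst (asm) AE_distr_iff) auto
qed

text \<open>Independence, given as a product law, passes to functions of the two components. It is
  used to go from the full vectors to a slope and one single gain.\<close>

lemma (in prob_space) distr_pair_compose:
  assumes eq: "distr M (S \<Otimes>\<^sub>M T) (\<lambda>x. (X x, Y x)) = distr M S X \<Otimes>\<^sub>M distr M T Y"
    and X [measurable]: "X \<in> M \<rightarrow>\<^sub>M S" and Y [measurable]: "Y \<in> M \<rightarrow>\<^sub>M T"
    and f [measurable]: "f \<in> S \<rightarrow>\<^sub>M S'" and g [measurable]: "g \<in> T \<rightarrow>\<^sub>M T'"
  shows "distr M (S' \<Otimes>\<^sub>M T') (\<lambda>x. (f (X x), g (Y x))) = distr M S' (\<lambda>x. f (X x)) \<Otimes>\<^sub>M distr M T' (\<lambda>x. g (Y x))"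
proof -
  have sf: "sigma_finite_measure (distr (distr M T Y) T' g)"
    by (intro prob_space_imp_sigma_finite prob_space.prob_space_distr[OF prob_space_distr]) simp_all
  have "distr M S' (\<lambda>x. f (X x)) \<Otimes>\<^sub>M distr M T' (\<lambda>x. g (Y x)) = distr (distr M S X) S' f \<Otimes>\<^sub>M distr (distr M T Y) T' g"
    by (simp add: distr_distr comp_def)
  also have "\<dots> = distr (distr M S X \<Otimes>\<^sub>M distr M T Y) (S' \<Otimes>\<^sub>M T') (\<lambda>(x, y). (f x, g y))"
    by (rule pair_measure_distr[OF _ _ sf]) simp_all
  also have "\<dots> = distr M (S' \<Otimes>\<^sub>M T') (\<lambda>x. (f (X x), g (Y x)))"
    unfolding eq[symmetric] by (subst distr_distr) (simp_all add: comp_def)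
  finally show ?thesis ..
qed

text \<open>Supporting line at \<open>\<mu>\<close> of the convex function \<open>w \<mapsto> ln ((A + s w) / (B + s w))\<close>, for \<open>A \<ge> B\<close>.\<close>

lemma ln_ratio_above_tangent:
  fixes A B s w \<mu> :: real
  assumes AB: "A \<ge> B" and pos: "B + s * w > 0" "B + s * \<mu> > 0"
  shows "ln (A + s * w) - ln (B + s * w) \<ge>
    (ln (A + s * \<mu>) - ln (B + s * \<mu>)) + (s / (A + s * \<mu>) - s / (B + s * \<mu>)) * (w - \<mu>)"
proof -
  define p where "p = s * (w - \<mu>)"
  \<comment> \<open>The two sides of the claim differ by the increment of this function from
    \<open>B + s * \<mu>\<close> to \<open>A + s * \<mu>\<close>, so convexity turns into
    monotonicity in \<open>x\<close>.\<close>
  let ?\<psi> = "\<lambda>x. ln (x + p) - ln x - p / x"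
  have "?\<psi> (B + s * \<mu>) \<le> ?\<psi> (A + s * \<mu>)"
  proof (rule DERIV_nonneg_imp_nondecreasing[where f = ?\<psi>])
    show "B + s * \<mu> \<le> A + s * \<mu>" using AB by simp
    fix x assume x: "B + s * \<mu> \<le> x"
    have "x > 0" "x + p > 0"
      using x pos by (simp_all add: p_def algebra_simps)
    moreover from this have "(?\<psi> has_real_derivative 1 / (x + p) - 1 / x + p / x ^ 2) (at x)"
      by (auto intro!: derivative_eq_intros simp: power2_eq_square)
    moreover have "1 / (x + p) - 1 / x + p / x ^ 2 = p ^ 2 / (x ^ 2 * (x + p))"
    proof -
      have "1 / w - 1 / x + (w - x) / x ^ 2 = (w - x) ^ 2 / (x ^ 2 * w)" if "w > 0" "x > 0" for w x :: real
        using that by (simp add: field_simps power2_eq_square)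
      from this[OF calculation(2,1)] show ?thesis by simp
    qed
    ultimately show "\<exists>y. (?\<psi> has_real_derivative y) (at x) \<and> y \<ge> 0"
      by (intro exI[of _ "p ^ 2 / (x ^ 2 * (x + p))"]) auto
  qed
  then show ?thesis
    by (simp add: p_def algebra_simps diff_divide_distrib)
qed

text \<open>One fixed user. The law speaks of the pair \<open>G * T\<close>,
  \<open>G * (1 - T)\<close>, so statements about \<open>G\<close> are obtained from the sum of its
  components.\<close>

locale rvq_model = prob_space PS for PS :: "'a measure" +
  fixes G T Z :: "'a \<Rightarrow> real" and \<delta> :: real and M :: nat
  assumes M_ge: "M \<ge> 3" and \<delta>: "0 < \<delta>" "\<delta> \<le> 1"
    and GT_law: "distr PS (borel \<Otimes>\<^sub>M borel) (\<lambda>\<omega>. (G \<omega> * T \<omega>, G \<omega> * (1 - T \<omega>)))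
        = distr (Er 0 \<Otimes>\<^sub>M Er (M - 2)) (borel \<Otimes>\<^sub>M borel) (\<lambda>(x, y). (\<delta> * y, x + (1 - \<delta>) * y))"
    and Z_law: "distributed PS lborel Z (\<lambda>z. ennreal (beta1_density (M - 1) z))"
    and G_meas [measurable]: "G \<in> borel_measurable PS" and T_meas [measurable]: "T \<in> borel_measurable PS"
    and Z_indep: "distr PS ((borel \<Otimes>\<^sub>M borel) \<Otimes>\<^sub>M borel) (\<lambda>\<omega>. ((G \<omega>, T \<omega>), Z \<omega>))
        = distr PS (borel \<Otimes>\<^sub>M borel) (\<lambda>\<omega>. (G \<omega>, T \<omega>)) \<Otimes>\<^sub>M distr PS borel Z"
begin

lemma Z_meas [measurable]: "Z \<in> borel_measurable PS"
  and AE_Z: "AE \<omega> in PS. 0 \<le> Z \<omega> \<and> Z \<omega> \<le> 1"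
  and distr_Z: "distr PS borel Z = density lborel (\<lambda>z. ennreal (beta1_density (M - 1) z))"
  using beta1_distributed[OF Z_law] by auto

lemma law_map_measurable [measurable]:
  "(\<lambda>(x, y). (\<delta> * y, x + (1 - \<delta>) * y)) \<in> Er 0 \<Otimes>\<^sub>M Er (M - 2) \<rightarrow>\<^sub>M borel \<Otimes>\<^sub>M borel"
  by measurable

lemma expectation_GT:
  fixes h :: "real \<times> real \<Rightarrow> real"
  assumes [measurable]: "h \<in> borel_measurable (borel \<Otimes>\<^sub>M borel)"
  shows "expectation (\<lambda>\<omega>. h (G \<omega> * T \<omega>, G \<omega> * (1 - T \<omega>)))
      = (\<integral>p. h (\<delta> * snd p, fst p + (1 - \<delta>) * snd p) \<partial>(Er 0 \<Otimes>\<^sub>M Er (M - 2)))"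
    and "integrable PS (\<lambda>\<omega>. h (G \<omega> * T \<omega>, G \<omega> * (1 - T \<omega>))) \<longleftrightarrow>
      integrable (Er 0 \<Otimes>\<^sub>M Er (M - 2)) (\<lambda>p. h (\<delta> * snd p, fst p + (1 - \<delta>) * snd p))"
proof -
  have 1: "(\<lambda>\<omega>. (G \<omega> * T \<omega>, G \<omega> * (1 - T \<omega>))) \<in> PS \<rightarrow>\<^sub>M borel \<Otimes>\<^sub>M borel"
    by measurable
  show "expectation (\<lambda>\<omega>. h (G \<omega> * T \<omega>, G \<omega> * (1 - T \<omega>)))
      = (\<integral>p. h (\<delta> * snd p, fst p + (1 - \<delta>) * snd p) \<partial>(Er 0 \<Otimes>\<^sub>M Er (M - 2)))"
    using integral_distr[OF 1 assms] integral_distr[OF law_map_measurable assms]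
    by (simp add: GT_law split_beta')
  show "integrable PS (\<lambda>\<omega>. h (G \<omega> * T \<omega>, G \<omega> * (1 - T \<omega>))) \<longleftrightarrow>
      integrable (Er 0 \<Otimes>\<^sub>M Er (M - 2)) (\<lambda>p. h (\<delta> * snd p, fst p + (1 - \<delta>) * snd p))"
    using integrable_distr_eq[OF 1 assms] integrable_distr_eq[OF law_map_measurable assms]
    by (simp add: GT_law split_beta')
qed

lemma AE_GT: "AE \<omega> in PS. G \<omega> \<ge> 0 \<and> G \<omega> * T \<omega> \<ge> 0"
proof -
  have 1: "(\<lambda>\<omega>. (G \<omega> * T \<omega>, G \<omega> * (1 - T \<omega>))) \<in> PS \<rightarrow>\<^sub>M borel \<Otimes>\<^sub>M borel"
    by measurable
  have 2: "{p \<in> space (borel \<Otimes>\<^sub>M borel). fst p + snd p \<ge> 0 \<and> fst p \<ge> (0::real)} \<in> sets (borel \<Otimes>\<^sub>M borel)"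
    by measurable
  have "AE p in distr (Er 0 \<Otimes>\<^sub>M Er (M - 2)) (borel \<Otimes>\<^sub>M borel) (\<lambda>(x, y). (\<delta> * y, x + (1 - \<delta>) * y)).
      fst p + snd p \<ge> 0 \<and> fst p \<ge> 0"
    unfolding AE_distr_iff[OF law_map_measurable 2]
    using AE_Er_pair_nonneg
  proof eventually_elim
    case (elim p)
    have "\<delta> * snd p + (fst p + (1 - \<delta>) * snd p) = fst p + snd p"
      by (simp add: algebra_simps)
    then show ?case using elim \<delta> by (simp add: split_beta)
  qed
  then have "AE \<omega> in PS. G \<omega> * T \<omega> + G \<omega> * (1 - T \<omega>) \<ge> 0 \<and> G \<omega> * T \<omega> \<ge> 0"
    unfolding GT_law[symmetric] AE_distr_iff[OF 1 2] by simp
  then show ?thesis by (simp add: algebra_simps)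
qed

lemma integrable_G: "integrable PS G" and integrable_GT: "integrable PS (\<lambda>\<omega>. G \<omega> * T \<omega>)"
proof -
  have "integrable (Er 0 \<Otimes>\<^sub>M Er (M - 2)) (\<lambda>p. fst p + snd p)"
    by (auto intro!: integrable_Er_pairI[where a = 0 and b = 1 and c = 1])
  moreover have eq: "\<delta> * y + (x + (1 - \<delta>) * y) = x + y" for x y
    by (simp add: algebra_simps)
  ultimately have "integrable PS (\<lambda>\<omega>. fst (G \<omega> * T \<omega>, G \<omega> * (1 - T \<omega>)) + snd (G \<omega> * T \<omega>, G \<omega> * (1 - T \<omega>)))"
    by (subst expectation_GT(2)) (measurable, simp only: fst_conv snd_conv eq)
  then show "integrable PS G" by (simp add: algebra_simps)
  have "integrable PS (\<lambda>\<omega>. fst (G \<omega> * T \<omega>, G \<omega> * (1 - T \<omega>)))"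
    by (subst expectation_GT(2))
       (auto intro!: integrable_mult_right integrable_Er_pairI[where a = 0 and b = 0 and c = 1])
  then show "integrable PS (\<lambda>\<omega>. G \<omega> * T \<omega>)" by simp
qed

text \<open>In the model \<open>G\<close> is \<open>x + y\<close> and \<open>G * T\<close> is
  \<open>\<delta> * y\<close>. Sharing \<open>y\<close> produces the slopes \<open>a * z\<close> and
  \<open>a * z + b * \<delta>\<close>, with gap \<open>b * \<delta>\<close>.\<close>

lemma expectation_ln_fixed_Z:
  "expectation (\<lambda>\<omega>. ln (1 + a * (G \<omega> * z) + b * (G \<omega> * T \<omega>))) = ln_mean_pair (M - 2) (a * z) (a * z + b * \<delta>)"
proof -
  have "expectation (\<lambda>\<omega>. ln (1 + a * (G \<omega> * z) + b * (G \<omega> * T \<omega>)))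
     = expectation (\<lambda>\<omega>. (\<lambda>p. ln (1 + a * ((fst p + snd p) * z) + b * fst p)) (G \<omega> * T \<omega>, G \<omega> * (1 - T \<omega>)))"
    by (simp add: algebra_simps)
  also have "\<dots> = (\<integral>p. ln (1 + a * ((\<delta> * snd p + (fst p + (1 - \<delta>) * snd p)) * z) + b * (\<delta> * snd p)) \<partial>(Er 0 \<Otimes>\<^sub>M Er (M - 2)))"
    by (subst expectation_GT(1)) simp_all
  also have "\<dots> = ln_mean_pair (M - 2) (a * z) (a * z + b * \<delta>)"
    unfolding ln_mean_pair_def by (simp add: algebra_simps)
  finally show ?thesis .
qed

lemma integrable_ln:
  assumes "a \<ge> 0" "b \<ge> 0"
  shows "integrable PS (\<lambda>\<omega>. ln (1 + a * (G \<omega> * Z \<omega>) + b * (G \<omega> * T \<omega>)))"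
proof (rule Bochner_Integration.integrable_bound)
  show "integrable PS (\<lambda>\<omega>. a * G \<omega> + b * (G \<omega> * T \<omega>))"
    by (intro Bochner_Integration.integrable_add integrable_mult_right integrable_G integrable_GT)
  show "AE \<omega> in PS. norm (ln (1 + a * (G \<omega> * Z \<omega>) + b * (G \<omega> * T \<omega>))) \<le> norm (a * G \<omega> + b * (G \<omega> * T \<omega>))"
    using AE_GT AE_Z
  proof eventually_elim
    case (elim \<omega>)
    let ?x = "a * (G \<omega> * Z \<omega>) + b * (G \<omega> * T \<omega>)"
    have "?x \<ge> 0" using elim assms by simp
    then have "\<bar>ln (1 + ?x)\<bar> \<le> ?x"
      using ln_add_one_self_le_self[of ?x] ln_ge_zero[of "1 + ?x"] by simp
    also have "?x \<le> a * G \<omega> + b * (G \<omega> * T \<omega>)"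
      using elim assms by (intro add_right_mono mult_left_mono) (auto intro: mult_left_le)
    finally show ?case by (simp add: add.assoc)
  qed
qed measurable

text \<open>Integrate over \<open>(G, T)\<close> first; the remaining average over \<open>Z\<close>
  is the one computed in \<open>has_integral_Theta\<close>.\<close>

lemma expectation_ln_eq_Theta:
  assumes a: "a > 0" and b: "b > 0"
  shows "expectation (\<lambda>\<omega>. ln (1 + a * (G \<omega> * Z \<omega>) + b * (G \<omega> * T \<omega>))) = Theta M a (b * \<delta>) * ln 2"
proof -
  define f :: "(real \<times> real) \<times> real \<Rightarrow> real" where
    "f = (\<lambda>p. ln (1 + a * (fst (fst p) * snd p) + b * (fst (fst p) * snd (fst p))))"
  define \<mu> where "\<mu> = distr PS (borel \<Otimes>\<^sub>M borel) (\<lambda>\<omega>. (G \<omega>, T \<omega>))"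
  define \<nu> where "\<nu> = distr PS borel Z"
  have f_meas: "f \<in> borel_measurable ((borel \<Otimes>\<^sub>M borel) \<Otimes>\<^sub>M borel)"
    unfolding f_def by measurable
  have GTZ_meas: "(\<lambda>\<omega>. ((G \<omega>, T \<omega>), Z \<omega>)) \<in> PS \<rightarrow>\<^sub>M (borel \<Otimes>\<^sub>M borel) \<Otimes>\<^sub>M borel"
    by measurable
  have GT_meas: "(\<lambda>\<omega>. (G \<omega>, T \<omega>)) \<in> PS \<rightarrow>\<^sub>M borel \<Otimes>\<^sub>M borel"
    by measurable
  interpret \<mu>: prob_space \<mu> unfolding \<mu>_def by (rule prob_space_distr) measurable
  interpret \<nu>: prob_space \<nu> unfolding \<nu>_def by (rule prob_space_distr) measurable
  interpret P: pair_sigma_finite \<mu> \<nu> ..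
  have "integrable PS (\<lambda>\<omega>. f ((G \<omega>, T \<omega>), Z \<omega>))"
    unfolding f_def using integrable_ln[of a b] a b by simp
  then have int: "integrable (\<mu> \<Otimes>\<^sub>M \<nu>) f"
    unfolding \<mu>_def \<nu>_def Z_indep[symmetric] using integrable_distr_eq[OF GTZ_meas f_meas] by simp
  then have int': "integrable (\<mu> \<Otimes>\<^sub>M \<nu>) (case_prod (\<lambda>p z. f (p, z)))"
    by simp
  have inner: "(\<integral>p. f (p, z) \<partial>\<mu>) = ln_mean_pair (M - 2) (a * z) (a * z + b * \<delta>)" for z
  proof -
    have "(\<integral>p. f (p, z) \<partial>\<mu>) = expectation (\<lambda>\<omega>. f ((G \<omega>, T \<omega>), z))"
      unfolding \<mu>_def by (rule integral_distr[OF GT_meas]) (simp add: f_def)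
    also have "\<dots> = ln_mean_pair (M - 2) (a * z) (a * z + b * \<delta>)"
      unfolding f_def using expectation_ln_fixed_Z by simp
    finally show ?thesis .
  qed
  let ?H = "\<lambda>z. ln_mean_pair (M - 2) (a * z) (a * z + b * \<delta>)"
  have H_int: "integrable \<nu> ?H"
    using P.integrable_snd[OF int'] by (simp add: inner)
  have H_meas: "?H \<in> borel_measurable lborel"
    using borel_measurable_integrable[OF H_int] by (simp add: \<nu>_def)
  have dens: "beta1_density (M - 1) z * y = indicat_real {0..1} z *\<^sub>R (real (M - 1) * (1 - z) ^ (M - 2) * y)" for z y
    by (simp add: beta1_density_def indicator_def numeral_2_eq_2)
  have "integrable lborel (\<lambda>z. beta1_density (M - 1) z * ?H z)"
    using H_int integrable_real_density[OF _ _ H_meas, of "beta1_density (M - 1)"]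
    by (simp add: \<nu>_def distr_Z beta1_density_nonneg)
  \<comment> \<open>Lebesgue integrability, inherited from Fubini, is what allows the integral to be
    read as the gauge integral of \<open>has_integral_Theta\<close>.\<close>
  then have set_int: "set_integrable lborel {0..1} (\<lambda>z. real (M - 1) * (1 - z) ^ (M - 2) * ?H z)"
    unfolding set_integrable_def dens .
  have "expectation (\<lambda>\<omega>. ln (1 + a * (G \<omega> * Z \<omega>) + b * (G \<omega> * T \<omega>))) = expectation (\<lambda>\<omega>. f ((G \<omega>, T \<omega>), Z \<omega>))"
    by (simp add: f_def)
  also have "\<dots> = integral\<^sup>L (\<mu> \<Otimes>\<^sub>M \<nu>) f"
    unfolding \<mu>_def \<nu>_def Z_indep[symmetric] by (rule integral_distr[OF GTZ_meas f_meas, symmetric])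
  also have "\<dots> = (\<integral>z. ?H z \<partial>\<nu>)"
    using P.integral_snd[OF int'] by (simp add: inner)
  also have "\<dots> = (\<integral>z. beta1_density (M - 1) z * ?H z \<partial>lborel)"
    unfolding \<nu>_def distr_Z
    by (rule integral_real_density[OF _ _ H_meas]) (auto simp: beta1_density_nonneg)
  also have "\<dots> = integral {0..1} (\<lambda>z. real (M - 1) * (1 - z) ^ (M - 2) * ?H z)"
    unfolding dens using set_borel_integral_eq_integral(2)[OF set_int] by (simp add: set_lebesgue_integral_def)
  also have "\<dots> = Theta M a (b * \<delta>) * ln 2"
    by (rule integral_unique[OF has_integral_Theta]) (use a b \<delta> M_ge in auto)
  finally show ?thesis .
qed

text \<open>Without a signal term only \<open>Y\<close> remains, so the one-variable formula
  applies. This is the degenerate counterpart of \<open>Theta\<close>, whose terms divide by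
  \<open>a\<close>.\<close>

lemma expectation_ln_eq_En:
  assumes b: "b > 0"
  shows "expectation (\<lambda>\<omega>. ln (1 + b * (G \<omega> * T \<omega>))) = exp (1 / (b * \<delta>)) * (\<Sum>q=1..M-1. En q (1 / (b * \<delta>)))"
proof -
  have "expectation (\<lambda>\<omega>. ln (1 + b * (G \<omega> * T \<omega>))) = ln_mean_pair (M - 2) 0 (b * \<delta>)"
    using expectation_ln_fixed_Z[of 0 0 b] by simp
  also have "\<dots> = (\<Sum>q=1..Suc (M - 2). exp (1 / (b * \<delta>)) * En q (1 / (b * \<delta>)))"
    using b \<delta> by (subst ln_mean_pair_0_left) (auto simp: ln_mean_def integral_Er_ln)
  also have "Suc (M - 2) = M - 1" using M_ge by simp
  finally show ?thesis by (simp add: sum_distrib_left)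
qed

text \<open>The interference \<open>\<Sum>i V\<^sub>i Q\<^sub>i\<close> enters through its mean only: by convexity the logarithm lies above
  its supporting line there, whose slope depends on \<open>(G, T, Z)\<close> alone and is bounded.\<close>

lemma expectation_ln_SINR_ge:
  fixes V :: "nat \<Rightarrow> 'a \<Rightarrow> real" and Q :: "nat \<Rightarrow> real"
  assumes I: "finite I" "I \<noteq> {}" and Q: "\<And>i. i \<in> I \<Longrightarrow> Q i > 0"
    and V_law: "\<And>i. i \<in> I \<Longrightarrow> distributed PS lborel (V i) (\<lambda>v. ennreal (beta1_density (M - 2) v))"
    and V_indep: "distr PS (((borel \<Otimes>\<^sub>M borel) \<Otimes>\<^sub>M borel) \<Otimes>\<^sub>M (\<Pi>\<^sub>M i\<in>I. borel))
          (\<lambda>\<omega>. (((G \<omega>, T \<omega>), Z \<omega>), restrict (\<lambda>i. V i \<omega>) I))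
        = distr PS ((borel \<Otimes>\<^sub>M borel) \<Otimes>\<^sub>M borel) (\<lambda>\<omega>. ((G \<omega>, T \<omega>), Z \<omega>))
          \<Otimes>\<^sub>M distr PS (\<Pi>\<^sub>M i\<in>I. borel) (\<lambda>\<omega>. restrict (\<lambda>i. V i \<omega>) I)"
    and L: "L > 0" and a: "a1 \<ge> a2" "a2 \<ge> 0"
  defines "\<mu> \<equiv> (\<Sum>i\<in>I. Q i) / (real M - 1)"
  shows "expectation (\<lambda>\<omega>. ln (1 + (a1 - a2) * G \<omega> * Z \<omega> / (1 + a2 * G \<omega> * Z \<omega> + L * G \<omega> * T \<omega> * (\<Sum>i\<in>I. V i \<omega> * Q i))))
    \<ge> expectation (\<lambda>\<omega>. ln (1 + a1 * (G \<omega> * Z \<omega>) + L * \<mu> * (G \<omega> * T \<omega>)))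
      - expectation (\<lambda>\<omega>. ln (1 + a2 * (G \<omega> * Z \<omega>) + L * \<mu> * (G \<omega> * T \<omega>)))"
proof -
  have \<mu>: "\<mu> > 0"
    unfolding \<mu>_def using I Q M_ge by (intro divide_pos_pos sum_pos) auto
  have V_meas [measurable]: "V i \<in> borel_measurable PS" if "i \<in> I" for i
    using beta1_distributed(1)[OF V_law[OF that]] .
  have V_AE: "AE \<omega> in PS. \<forall>i\<in>I. 0 \<le> V i \<omega> \<and> V i \<omega> \<le> 1"
    using I beta1_distributed(2)[OF V_law] by (intro AE_finite_allI) auto
  have V_int: "integrable PS (V i)" if i: "i \<in> I" for i
  proof (rule integrable_const_bound)
    show "AE \<omega> in PS. norm (V i \<omega>) \<le> 1"
      using V_AE by eventually_elim (use i in auto)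
  qed (use i in simp)
  have V_mean: "expectation (V i) = 1 / (real M - 1)" if i: "i \<in> I" for i
  proof -
    have "expectation (V i) = (\<integral>v. beta1_density (M - 2) v * v \<partial>lborel)"
      by (rule distributed_integral[symmetric, OF V_law[OF i]]) (auto simp: beta1_density_nonneg)
    also have "\<dots> = 1 / (real (M - 2) + 1)"
      using M_ge by (intro beta1_expectation) simp
    also have "real (M - 2) + 1 = real M - 1" using M_ge by simp
    finally show ?thesis .
  qed
  \<comment> \<open>The slope at \<open>\<mu>\<close> of the supporting line, as a measurable
    function of \<open>((G, T), Z)\<close>.\<close>
  define d :: "(real \<times> real) \<times> real \<Rightarrow> real" where
    "d = (\<lambda>p. let s = L * (fst (fst p) * snd (fst p)); y = fst (fst p) * snd p in
        s / (1 + a1 * y + s * \<mu>) - s / (1 + a2 * y + s * \<mu>))"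
  define D where "D = (\<lambda>\<omega>. d ((G \<omega>, T \<omega>), Z \<omega>))"
  have d_meas [measurable]: "d \<in> borel_measurable ((borel \<Otimes>\<^sub>M borel) \<Otimes>\<^sub>M borel)"
    unfolding d_def Let_def by measurable
  have D_meas [measurable]: "D \<in> borel_measurable PS"
    unfolding D_def by measurable
  have D_int: "integrable PS D"
  proof (rule integrable_const_bound)
    \<comment> \<open>Both fractions lie between 0 and \<open>1 / \<mu>\<close>, since each
      denominator is at least \<open>s * \<mu>\<close>; hence so does the modulus of their
      difference.\<close>
    show "AE \<omega> in PS. norm (D \<omega>) \<le> 1 / \<mu>"
      using AE_GT AE_Z
    proof eventually_elim
      case (elim \<omega>)
      define s where "s = L * (G \<omega> * T \<omega>)"
      have s: "s \<ge> 0" using elim L by (simp add: s_def)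
      have bnd: "0 \<le> s / (1 + y + s * \<mu>) \<and> s / (1 + y + s * \<mu>) \<le> 1 / \<mu>" if "y \<ge> 0" for y
      proof -
        have "1 + y + s * \<mu> > 0" using that s \<mu> by (simp add: add_pos_nonneg)
        then show ?thesis using that s \<mu> by (auto simp: field_simps)
      qed
      have "a1 * (G \<omega> * Z \<omega>) \<ge> 0" "a2 * (G \<omega> * Z \<omega>) \<ge> 0" using elim a by auto
      from bnd[OF this(1)] bnd[OF this(2)] show ?case
        by (simp add: D_def d_def Let_def s_def[symmetric] abs_le_iff)
    qed
  qed simp
  \<comment> \<open>\<open>W\<close> is linear in the gains, so \<open>D * (W - \<mu>)\<close> is
    averaged from the independence of \<open>D\<close> and each single \<open>V i\<close>.\<close>
  have indep: "indep_var borel D borel (V i)" if i: "i \<in> I" for i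
  proof -
    have "distr PS (borel \<Otimes>\<^sub>M borel) (\<lambda>\<omega>. (d ((G \<omega>, T \<omega>), Z \<omega>), restrict (\<lambda>i. V i \<omega>) I i))
      = distr PS borel (\<lambda>\<omega>. d ((G \<omega>, T \<omega>), Z \<omega>)) \<Otimes>\<^sub>M distr PS borel (\<lambda>\<omega>. restrict (\<lambda>i. V i \<omega>) I i)"
    proof (rule distr_pair_compose[OF V_indep _ _ d_meas measurable_component_singleton[OF i]])
      show "(\<lambda>\<omega>. ((G \<omega>, T \<omega>), Z \<omega>)) \<in> PS \<rightarrow>\<^sub>M (borel \<Otimes>\<^sub>M borel) \<Otimes>\<^sub>M borel"
        by measurable
    qed (auto intro!: measurable_restrict)
    then show ?thesis
      using i by (simp add: indep_var_distribution_eq D_def)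
  qed
  define W where "W = (\<lambda>\<omega>. \<Sum>i\<in>I. V i \<omega> * Q i)"
  have W_meas [measurable]: "W \<in> borel_measurable PS"
    unfolding W_def by (intro borel_measurable_sum borel_measurable_times V_meas) auto
  have DV_int: "integrable PS (\<lambda>\<omega>. D \<omega> * V i \<omega>)" if "i \<in> I" for i
    by (rule indep_var_integrable[OF indep[OF that] D_int V_int[OF that]])
  have DW_eq: "D \<omega> * (W \<omega> - \<mu>) = (\<Sum>i\<in>I. Q i * (D \<omega> * V i \<omega>)) - \<mu> * D \<omega>" for \<omega>
    by (simp add: W_def right_diff_distrib sum_distrib_left mult_ac)
  have DW_int: "integrable PS (\<lambda>\<omega>. D \<omega> * (W \<omega> - \<mu>))"
    unfolding DW_eq by (intro Bochner_Integration.integrable_diff Bochner_Integration.integrable_sum integrable_mult_right DV_int D_int)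
  have DW_0: "expectation (\<lambda>\<omega>. D \<omega> * (W \<omega> - \<mu>)) = 0"
  proof -
    have "expectation (\<lambda>\<omega>. D \<omega> * (W \<omega> - \<mu>)) = (\<Sum>i\<in>I. Q i * expectation (\<lambda>\<omega>. D \<omega> * V i \<omega>)) - \<mu> * expectation D"
      unfolding DW_eq using DV_int D_int
      by (subst Bochner_Integration.integral_diff) (auto intro!: Bochner_Integration.integral_sum Bochner_Integration.integrable_sum)
    also have "(\<Sum>i\<in>I. Q i * expectation (\<lambda>\<omega>. D \<omega> * V i \<omega>)) = (\<Sum>i\<in>I. Q i * (expectation D * (1 / (real M - 1))))"
      by (intro sum.cong refl) (simp add: indep_var_lebesgue_integral[OF indep D_int V_int] V_mean)
    also have "\<dots> = \<mu> * expectation D"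
      unfolding \<mu>_def sum_divide_distrib sum_distrib_right by (intro sum.cong refl) simp
    finally show ?thesis by simp
  qed
  define f1 where "f1 = (\<lambda>\<omega>. ln (1 + a1 * (G \<omega> * Z \<omega>) + L * \<mu> * (G \<omega> * T \<omega>)))"
  define f2 where "f2 = (\<lambda>\<omega>. ln (1 + a2 * (G \<omega> * Z \<omega>) + L * \<mu> * (G \<omega> * T \<omega>)))"
  have f_int: "integrable PS f1" "integrable PS f2"
    unfolding f1_def f2_def using L \<mu> a by (intro integrable_ln; simp)+
  define g where "g = (\<lambda>\<omega>. ln (1 + (a1 - a2) * G \<omega> * Z \<omega> / (1 + a2 * G \<omega> * Z \<omega> + L * G \<omega> * T \<omega> * W \<omega>)))"
  have basic: "AE \<omega> in PS. G \<omega> * Z \<omega> \<ge> 0 \<and> G \<omega> * Z \<omega> \<le> G \<omega> \<and> G \<omega> * T \<omega> \<ge> 0 \<and> W \<omega> \<ge> 0"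
    using AE_GT AE_Z V_AE
  proof eventually_elim
    case (elim \<omega>)
    have "W \<omega> \<ge> 0"
      unfolding W_def using elim Q by (intro sum_nonneg mult_nonneg_nonneg) (auto intro: less_imp_le)
    then show ?case using elim by (auto intro: mult_left_le)
  qed
  have g_int: "integrable PS g"
  proof (rule Bochner_Integration.integrable_bound)
    show "integrable PS (\<lambda>\<omega>. (a1 - a2) * G \<omega>)"
      by (intro integrable_mult_right integrable_G)
    show "g \<in> borel_measurable PS" unfolding g_def by measurable
    \<comment> \<open>The denominator is at least 1 and \<open>ln (1 + x)\<close> is at most
      \<open>x\<close>, so the signal term alone dominates.\<close>
    show "AE \<omega> in PS. norm (g \<omega>) \<le> norm ((a1 - a2) * G \<omega>)"
      using basic
    proof eventually_elim
      case (elim \<omega>)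
      let ?den = "1 + a2 * G \<omega> * Z \<omega> + L * G \<omega> * T \<omega> * W \<omega>"
      let ?num = "(a1 - a2) * G \<omega> * Z \<omega>"
      have num: "0 \<le> ?num" "?num \<le> (a1 - a2) * G \<omega>"
        using elim a by (auto simp: mult.assoc intro: mult_left_mono)
      have "0 \<le> a2 * (G \<omega> * Z \<omega>)" "0 \<le> L * (G \<omega> * T \<omega>) * W \<omega>"
        using elim a L by auto
      then have den: "?den \<ge> 1"
        unfolding mult.assoc by linarith
      have "?num / ?den \<ge> 0" using num den by (intro divide_nonneg_pos) auto
      moreover have "?num / ?den \<le> ?num"
        using num den by (intro divide_left_mono[of 1, simplified]) auto
      ultimately show ?case
        unfolding g_def using num ln_add_one_self_le_self[of "?num / ?den"] ln_ge_zero[of "1 + ?num / ?den"] by auto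
    qed
  qed
  have "expectation (\<lambda>\<omega>. (f1 \<omega> - f2 \<omega>) + D \<omega> * (W \<omega> - \<mu>)) \<le> expectation g"
  proof (rule integral_mono_AE)
    show "AE \<omega> in PS. (f1 \<omega> - f2 \<omega>) + D \<omega> * (W \<omega> - \<mu>) \<le> g \<omega>"
      using basic
    proof eventually_elim
      case (elim \<omega>)
      define s where "s = L * (G \<omega> * T \<omega>)"
      define y where "y = G \<omega> * Z \<omega>"
      have s: "s \<ge> 0" and y: "y \<ge> 0" using elim L by (simp_all add: s_def y_def)
      have ge: "1 + a2 * y \<ge> 1" "1 + a1 * y \<ge> 1 + a2 * y"
        using a y by (auto intro: mult_right_mono)
      have pos: "1 + a2 * y + s * W \<omega> > 0" "1 + a1 * y + s * W \<omega> > 0" "1 + a2 * y + s * \<mu> > 0"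
        using ge s elim \<mu> by (auto intro!: add_pos_nonneg)
      have "g \<omega> = ln (1 + (a1 - a2) * y / (1 + a2 * y + s * W \<omega>))"
        by (simp add: g_def y_def s_def mult_ac)
      also have "1 + (a1 - a2) * y / (1 + a2 * y + s * W \<omega>) = (1 + a1 * y + s * W \<omega>) / (1 + a2 * y + s * W \<omega>)"
        using pos(1) by (simp add: field_simps)
      also have "ln \<dots> = ln (1 + a1 * y + s * W \<omega>) - ln (1 + a2 * y + s * W \<omega>)"
        using pos by (simp add: ln_div)
      finally have g_eq: "g \<omega> = \<dots>" .
      have "f1 \<omega> = ln (1 + a1 * y + s * \<mu>)" "f2 \<omega> = ln (1 + a2 * y + s * \<mu>)"
        by (simp_all add: f1_def f2_def y_def s_def mult_ac)
      moreover have "D \<omega> = s / (1 + a1 * y + s * \<mu>) - s / (1 + a2 * y + s * \<mu>)"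
        by (simp add: D_def d_def Let_def y_def s_def)
      ultimately show ?case
        unfolding g_eq using ln_ratio_above_tangent[OF ge(2) pos(1) pos(3)] by simp
    qed
  qed (intro Bochner_Integration.integrable_add Bochner_Integration.integrable_diff f_int DW_int g_int)+
  also have "expectation (\<lambda>\<omega>. (f1 \<omega> - f2 \<omega>) + D \<omega> * (W \<omega> - \<mu>)) = expectation f1 - expectation f2"
    using f_int DW_int DW_0 by simp
  finally show ?thesis
    unfolding f1_def f2_def g_def W_def .
qed

end

theorem theorem1:
  fixes N K M :: nat
    and d sigma2 P :: "nat \<Rightarrow> nat \<Rightarrow> real"
    and alpha :: real
    and B :: "nat \<Rightarrow> nat \<Rightarrow> nat"
    and n k :: nat
    and PS :: "'a measure"
    and G T Z :: "'a \<Rightarrow> real"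
    and V :: "nat \<Rightarrow> 'a \<Rightarrow> real"
  assumes N2: "N \<ge> 2" and K2: "K \<ge> 2" and MNK: "M > (N - 1) * K"
    and alpha_pos: "alpha > 0"
    and d_pos: "\<And>i j. i \<in> {1..N} \<Longrightarrow> j \<in> {1..K} \<Longrightarrow> d i j > 0"
    and sigma_pos: "\<And>i j. i \<in> {1..N} \<Longrightarrow> j \<in> {1..K} \<Longrightarrow> sigma2 i j > 0"
    and P_pos: "\<And>i j. i \<in> {1..N} \<Longrightarrow> j \<in> {1..K} \<Longrightarrow> P i j > 0"
    and n_rng: "n \<in> {1..N}" and k_rng: "k \<in> {1..K}"
    and PS: "prob_space PS"
    and GT_law: "distr PS (borel \<Otimes>\<^sub>M borel) (\<lambda>\<omega>. (G \<omega> * T \<omega>, G \<omega> * (1 - T \<omega>)))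
        = distr (density lborel (\<lambda>x. ennreal (erlang_density 0 1 x))
                   \<Otimes>\<^sub>M density lborel (\<lambda>y. ennreal (erlang_density (M - 2) 1 y)))
                (borel \<Otimes>\<^sub>M borel)
                (\<lambda>(x, y). (2 powr (- real (B n k) / (real M - 1)) * y,
                            x + (1 - 2 powr (- real (B n k) / (real M - 1))) * y))"
    and Z_law: "distributed PS lborel Z (\<lambda>z. ennreal (beta1_density (M - 1) z))"
    and G_meas: "G \<in> borel_measurable PS" and T_meas: "T \<in> borel_measurable PS"
    and Z_indep: "distr PS ((borel \<Otimes>\<^sub>M borel) \<Otimes>\<^sub>M borel) (\<lambda>\<omega>. ((G \<omega>, T \<omega>), Z \<omega>))
        = distr PS (borel \<Otimes>\<^sub>M borel) (\<lambda>\<omega>. (G \<omega>, T \<omega>)) \<Otimes>\<^sub>M distr PS borel Z"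
    and V_law: "\<And>i. i \<in> {1..N} - {n} \<Longrightarrow>
        distributed PS lborel (V i) (\<lambda>v. ennreal (beta1_density (M - 2) v))"
    and V_indep: "distr PS (((borel \<Otimes>\<^sub>M borel) \<Otimes>\<^sub>M borel) \<Otimes>\<^sub>M (\<Pi>\<^sub>M i\<in>{1..N} - {n}. borel))
          (\<lambda>\<omega>. (((G \<omega>, T \<omega>), Z \<omega>), restrict (\<lambda>i. V i \<omega>) ({1..N} - {n})))
        = distr PS ((borel \<Otimes>\<^sub>M borel) \<Otimes>\<^sub>M borel) (\<lambda>\<omega>. ((G \<omega>, T \<omega>), Z \<omega>))
          \<Otimes>\<^sub>M distr PS (\<Pi>\<^sub>M i\<in>{1..N} - {n}. borel) (\<lambda>\<omega>. restrict (\<lambda>i. V i \<omega>) ({1..N} - {n}))"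
  shows
    "let L = d n k powr (- alpha) / sigma2 n k;
         \<delta> = 2 powr (- real (B n k) / (real M - 1));
         S1 = L * (\<Sum>j=1..k. P n j);
         S2 = L * (\<Sum>j=1..k-1. P n j);
         S3 = L * (\<Sum>i\<in>{1..N} - {n}. \<Sum>j=1..K. P i j);
         c = S3 * \<delta> / (real M - 1);
         \<gamma> = (\<lambda>\<omega>. L * P n k * G \<omega> * Z \<omega> /
                (1 + S2 * G \<omega> * Z \<omega>
                   + L * G \<omega> * T \<omega> * (\<Sum>i\<in>{1..N} - {n}. V i \<omega> * (\<Sum>l=1..K. P i l))));
         R = integral\<^sup>L PS (\<lambda>\<omega>. log 2 (1 + \<gamma> \<omega>));
         RLB = (if k = 1 then
                  Theta M S1 c - log 2 (exp 1) * exp ((real M - 1) / (S3 * \<delta>))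
                    * (\<Sum>q=1..M-1. En q ((real M - 1) / (S3 * \<delta>)))
                else Theta M S1 c - Theta M S2 c)
     in R \<ge> RLB"
proof -
  define L where "L = d n k powr (- alpha) / sigma2 n k"
  define \<delta> where "\<delta> = 2 powr (- real (B n k) / (real M - 1))"
  define S1 where "S1 = L * (\<Sum>j=1..k. P n j)"
  define S2 where "S2 = L * (\<Sum>j=1..k-1. P n j)"
  define S3 where "S3 = L * (\<Sum>i\<in>{1..N} - {n}. \<Sum>j=1..K. P i j)"
  define I where "I = {1..N} - {n}"
  define Q where "Q = (\<lambda>i. \<Sum>l=1..K. P i l)"
  define b where "b = L * ((\<Sum>i\<in>I. Q i) / (real M - 1))"
  \<comment> \<open>This forces \<open>M\<close> to be at least 3, so that
    \<open>beta1_expectation\<close> applies at \<open>M - 2\<close>.\<close>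
  have "1 * 2 \<le> (N - 1) * K"
    using N2 K2 by (intro mult_le_mono) auto
  then have M: "M \<ge> 3" using MNK by simp
  have L: "L > 0"
    unfolding L_def using d_pos[OF n_rng k_rng] sigma_pos[OF n_rng k_rng] by simp
  have \<delta>: "0 < \<delta>" "\<delta> \<le> 1"
  proof -
    have "- real (B n k) / (real M - 1) \<le> 0" using M by (intro divide_nonpos_pos) auto
    then have "\<delta> \<le> 2 powr 0" unfolding \<delta>_def by (intro powr_mono) auto
    then show "\<delta> \<le> 1" by simp
  qed (simp add: \<delta>_def)
  interpret rvq_model PS G T Z \<delta> M
    unfolding rvq_model_def rvq_model_axioms_def \<delta>_def[symmetric]
    using PS M \<delta> GT_law Z_law G_meas T_meas Z_indep by (simp add: \<delta>_def)
  have I: "finite I" "I \<noteq> {}"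
  proof -
    \<comment> \<open>Some other cluster exists, which makes the mean interference, and with it
      \<open>b\<close>, strictly positive.\<close>
    have "(if n = 1 then 2 else 1) \<in> I" unfolding I_def using N2 n_rng by auto
    then show "I \<noteq> {}" by blast
  qed (simp add: I_def)
  have Q: "Q i > 0" if "i \<in> I" for i
    unfolding Q_def using that K2 by (intro sum_pos P_pos) (auto simp: I_def)
  have b: "b > 0"
    unfolding b_def using L I Q M by (intro mult_pos_pos divide_pos_pos sum_pos) auto
  have S1: "S1 > 0"
    unfolding S1_def using L k_rng n_rng by (intro mult_pos_pos sum_pos P_pos) auto
  \<comment> \<open>The signal power is the difference of the two partial sums, the form
    \<open>a1 - a2\<close> in which \<open>expectation_ln_SINR_ge\<close> expects it.\<close>
  have S12: "S1 - S2 = L * P n k"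
  proof -
    obtain k' where "k = Suc k'" using k_rng by (cases k) auto
    then show ?thesis by (simp add: S1_def S2_def distrib_left)
  qed
  have S2: "S2 \<ge> 0"
    unfolding S2_def using L k_rng n_rng by (intro mult_nonneg_nonneg sum_nonneg less_imp_le[OF P_pos]) auto
  have "S1 \<ge> S2"
    using S12 mult_pos_pos[OF L P_pos[OF n_rng k_rng]] by simp
  have c: "b * \<delta> = S3 * \<delta> / (real M - 1)"
    by (simp add: b_def S3_def I_def Q_def)
  define X where "X = (\<lambda>\<omega>. 1 + L * P n k * G \<omega> * Z \<omega> /
      (1 + S2 * G \<omega> * Z \<omega> + L * G \<omega> * T \<omega> * (\<Sum>i\<in>I. V i \<omega> * Q i)))"
  have "expectation (\<lambda>\<omega>. ln (X \<omega>)) \<ge> expectation (\<lambda>\<omega>. ln (1 + S1 * (G \<omega> * Z \<omega>) + b * (G \<omega> * T \<omega>)))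
      - expectation (\<lambda>\<omega>. ln (1 + S2 * (G \<omega> * Z \<omega>) + b * (G \<omega> * T \<omega>)))"
    unfolding X_def S12[symmetric] b_def
    by (rule expectation_ln_SINR_ge[OF I Q V_law[folded I_def] V_indep[folded I_def] L \<open>S1 \<ge> S2\<close> S2])
  also have "expectation (\<lambda>\<omega>. ln (1 + S1 * (G \<omega> * Z \<omega>) + b * (G \<omega> * T \<omega>))) = Theta M S1 (b * \<delta>) * ln 2"
    by (rule expectation_ln_eq_Theta[OF S1 b])
  finally have "expectation (\<lambda>\<omega>. ln (X \<omega>)) / ln 2 \<ge> (Theta M S1 (b * \<delta>) * ln 2
      - expectation (\<lambda>\<omega>. ln (1 + S2 * (G \<omega> * Z \<omega>) + b * (G \<omega> * T \<omega>)))) / ln 2"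
    by (intro divide_right_mono) auto
  then have main: "expectation (\<lambda>\<omega>. log 2 (X \<omega>)) \<ge>
      Theta M S1 (b * \<delta>) - expectation (\<lambda>\<omega>. ln (1 + S2 * (G \<omega> * Z \<omega>) + b * (G \<omega> * T \<omega>))) / ln 2"
    by (simp add: log_def diff_divide_distrib)
  \<comment> \<open>For \<open>k = 1\<close> the sum in \<open>S2\<close> is empty, and
    \<open>Theta\<close> is replaced by the formula for a vanishing signal slope.\<close>
  have "(if k = 1 then log 2 (exp 1) * exp ((real M - 1) / (S3 * \<delta>)) * (\<Sum>q=1..M-1. En q ((real M - 1) / (S3 * \<delta>)))
      else Theta M S2 (b * \<delta>)) = expectation (\<lambda>\<omega>. ln (1 + S2 * (G \<omega> * Z \<omega>) + b * (G \<omega> * T \<omega>))) / ln 2"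
  proof (cases "k = 1")
    case True
    have "(real M - 1) / (S3 * \<delta>) = 1 / (b * \<delta>)" unfolding c by simp
    moreover have "S2 = 0" using True by (simp add: S2_def)
    ultimately show ?thesis
      using True expectation_ln_eq_En[OF b] by (simp add: log_def)
  next
    case False
    then have "S2 > 0"
      unfolding S2_def using L k_rng n_rng by (intro mult_pos_pos sum_pos P_pos) auto
    then show ?thesis
      using False expectation_ln_eq_Theta[OF _ b] by simp
  qed
  with main have "expectation (\<lambda>\<omega>. log 2 (X \<omega>)) \<ge> (if k = 1 then
                  Theta M S1 (b * \<delta>) - log 2 (exp 1) * exp ((real M - 1) / (S3 * \<delta>))
                    * (\<Sum>q=1..M-1. En q ((real M - 1) / (S3 * \<delta>)))
                else Theta M S1 (b * \<delta>) - Theta M S2 (b * \<delta>))"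
    by (auto split: if_splits)
  then show ?thesis
    unfolding Let_def X_def c unfolding S1_def S2_def S3_def I_def Q_def \<delta>_def L_def .
qed

end
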